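(* The language $AFFINE$, consisting of all XOR-AND circuits $C$ such that the function $f_C$ computed by $C$ is affine, is $\mathbf{coNP}$-complete.
   Context: An XOR-AND circuit is a Boolean circuit with fan-in 2 over the basis $(\land,\oplus,1)$ (arithmetic over $\mathbb{F}_2$); $f_C:\mathbb{F}_2^n\to\mathbb{F}_2$ is the function computed by circuit $C$ with $n$ inputs. A function $f:\mathbb{F}_2^n\to\mathbb{F}_2$ is affine if there exist $\mathbf{a}\in\mathbb{F}_2^n$ and $c\in\mathbb{F}_2$ with $f(\mathbf{x})=\mathbf{a}\cdot\mathbf{x}+c$ for all $\mathbf{x}$. *)

theory Defs
  imports "HOL-Computational_Algebra.Polynomial" "HOL-Library.Z2"
begin

section \<open>Multi-tape Turing machines\<close>

text \<open>
  Deterministic machines with finitely many two-way infinite tapes. States and tape symbols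
  are initial segments of the natural numbers. Symbol 0 is the blank; symbols 1 and 2 are the
  input/output bits 0 and 1. The input is written on the first tape and the output is read off
  the last one (which is the same tape for a one-tape machine).
\<close>

datatype move = Left | Stay | Right

record tm =
  num_tapes :: nat
  num_states :: nat
  num_symbols :: nat
  start :: nat
  halt :: nat
  trans :: "nat \<Rightarrow> nat list \<Rightarrow> nat \<times> (nat \<times> move) list"

definition wf_tm :: "tm \<Rightarrow> bool" where
  "wf_tm M \<longleftrightarrow>
     num_tapes M \<ge> 1 \<and> num_symbols M \<ge> 3 \<and>
     start M < num_states M \<and> halt M < num_states M \<and>
     (\<forall>q rs. q < num_states M \<and> length rs = num_tapes M \<and> (\<forall>r\<in>set rs. r < num_symbols M) \<longrightarrow>
        (case trans M q rs of (q', acts) \<Rightarrow>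
           q' < num_states M \<and> length acts = num_tapes M \<and>
           (\<forall>(s, d)\<in>set acts. s < num_symbols M)))"

text \<open>A tape is its content together with the head position.\<close>

type_synonym tape = "(int \<Rightarrow> nat) \<times> int"
type_synonym config = "nat \<times> tape list"

fun move_head :: "move \<Rightarrow> int \<Rightarrow> int" where
  "move_head Left h = h - 1"
| "move_head Stay h = h"
| "move_head Right h = h + 1"

fun read_tape :: "tape \<Rightarrow> nat" where
  "read_tape (c, h) = c h"

fun act_tape :: "nat \<times> move \<Rightarrow> tape \<Rightarrow> tape" where
  "act_tape (s, d) (c, h) = (c(h := s), move_head d h)"

fun step :: "tm \<Rightarrow> config \<Rightarrow> config" where
  "step M (q, ts) =
     (if q = halt M then (q, ts)
      else case trans M q (map read_tape ts) of (q', acts) \<Rightarrow> (q', map2 act_tape acts ts))"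

definition bit_symbol :: "bool \<Rightarrow> nat" where
  "bit_symbol b = (if b then 2 else 1)"

definition blank_tape :: tape where
  "blank_tape = (\<lambda>_. 0, 0)"

definition input_tape :: "bool list \<Rightarrow> tape" where
  "input_tape x =
     (\<lambda>i. if 0 \<le> i \<and> i < int (length x) then bit_symbol (x ! nat i) else 0, 0)"

definition init_config :: "tm \<Rightarrow> bool list \<Rightarrow> config" where
  "init_config M x = (start M, input_tape x # replicate (num_tapes M - 1) blank_tape)"

text \<open>The output string occupies the cells from 0 up to the first blank.\<close>

definition tape_holds :: "tape \<Rightarrow> bool list \<Rightarrow> bool" where
  "tape_holds t y \<longleftrightarrow>
     (\<forall>i<length y. fst t (int i) = bit_symbol (y ! i)) \<and> fst t (int (length y)) = 0"

text \<open>
  Since halting configurations are fixed points of \<^const>\<open>step\<close>, running for exactly \<open>T\<close>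
  steps and being in the halting state means having halted within \<open>T\<close> steps.
\<close>

definition computes_in_time ::
    "tm \<Rightarrow> (bool list \<Rightarrow> bool list) \<Rightarrow> (nat \<Rightarrow> nat) \<Rightarrow> bool" where
  "computes_in_time M f T \<longleftrightarrow>
     (\<forall>x. case (step M ^^ T (length x)) (init_config M x) of (q, ts) \<Rightarrow>
        q = halt M \<and> tape_holds (last ts) (f x))"


section \<open>Complexity classes\<close>

type_synonym language = "bool list set"

definition polytime_computable :: "(bool list \<Rightarrow> bool list) \<Rightarrow> bool" where
  "polytime_computable f \<longleftrightarrow>
     (\<exists>M (p :: nat poly). wf_tm M \<and> computes_in_time M f (poly p))"

definition class_P :: "language set" where
  "class_P = {L. polytime_computable (\<lambda>x. [x \<in> L])}"

text \<open>Self-delimiting pairing: each bit of the first component is preceded by a 1.\<close>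

definition pair_string :: "bool list \<Rightarrow> bool list \<Rightarrow> bool list" where
  "pair_string x u = concat (map (\<lambda>b. [True, b]) x) @ False # u"

definition class_NP :: "language set" where
  "class_NP = {L. \<exists>R\<in>class_P. \<exists>p :: nat poly. \<forall>x.
     x \<in> L \<longleftrightarrow> (\<exists>u. length u = poly p (length x) \<and> pair_string x u \<in> R)}"

definition class_coNP :: "language set" where
  "class_coNP = {L. - L \<in> class_NP}"

definition polytime_reducible :: "language \<Rightarrow> language \<Rightarrow> bool" (infix "\<le>\<^sub>p" 50) where
  "L \<le>\<^sub>p L' \<longleftrightarrow> (\<exists>f. polytime_computable f \<and> (\<forall>x. x \<in> L \<longleftrightarrow> f x \<in> L'))"

definition coNP_complete :: "language \<Rightarrow> bool" where
  "coNP_complete L \<longleftrightarrow> L \<in> class_coNP \<and> (\<forall>L'\<in>class_coNP. L' \<le>\<^sub>p L)"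


section \<open>XOR-AND circuits\<close>

text \<open>
  The nodes of a circuit are numbered: nodes \<open>0, \<dots>, n - 1\<close> are the inputs, and node \<open>n + k\<close>
  is the \<open>k\<close>-th gate. Gates are listed in topological order.
\<close>

datatype gate = One_Gate | Xor_Gate nat nat | And_Gate nat nat

record circuit =
  num_inputs :: nat
  gates :: "gate list"
  output_node :: nat

fun wf_gate :: "nat \<Rightarrow> gate \<Rightarrow> bool" where
  "wf_gate m One_Gate \<longleftrightarrow> True"
| "wf_gate m (Xor_Gate i j) \<longleftrightarrow> i < m \<and> j < m"
| "wf_gate m (And_Gate i j) \<longleftrightarrow> i < m \<and> j < m"

definition wf_circuit :: "circuit \<Rightarrow> bool" where
  "wf_circuit C \<longleftrightarrow>
     (\<forall>k<length (gates C). wf_gate (num_inputs C + k) (gates C ! k)) \<and>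
     output_node C < num_inputs C + length (gates C)"

fun gate_value :: "bit list \<Rightarrow> gate \<Rightarrow> bit" where
  "gate_value vs One_Gate = 1"
| "gate_value vs (Xor_Gate i j) = vs ! i + vs ! j"
| "gate_value vs (And_Gate i j) = vs ! i * vs ! j"

definition node_values :: "circuit \<Rightarrow> bit list \<Rightarrow> bit list" where
  "node_values C x = foldl (\<lambda>vs g. vs @ [gate_value vs g]) x (gates C)"

definition circuit_fun :: "circuit \<Rightarrow> bit list \<Rightarrow> bit" where
  "circuit_fun C x = node_values C x ! output_node C"

text \<open>Elements of \<open>F\<^sub>2\<^sup>n\<close> are the lists of length \<open>n\<close> over the two-element field.\<close>

definition affine :: "nat \<Rightarrow> (bit list \<Rightarrow> bit) \<Rightarrow> bool" where
  "affine n f \<longleftrightarrow>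
     (\<exists>a c. length a = n \<and> (\<forall>x. length x = n \<longrightarrow> f x = (\<Sum>i<n. a ! i * x ! i) + c))"

text \<open>
  Node numbers are written in unary. Every input and every gate is a node of the circuit and
  node numbers are bounded by the number of nodes, so for well-formed circuits this is
  polynomially equivalent to writing them in binary.
\<close>

definition encode_nat :: "nat \<Rightarrow> bool list" where
  "encode_nat k = replicate k True @ [False]"

fun encode_gate :: "gate \<Rightarrow> bool list" where
  "encode_gate One_Gate = [False, True]"
| "encode_gate (Xor_Gate i j) = [True, False] @ encode_nat i @ encode_nat j"
| "encode_gate (And_Gate i j) = [True, True] @ encode_nat i @ encode_nat j"

text \<open>The tag 00 marks the end of the gate list.\<close>

definition encode_circuit :: "circuit \<Rightarrow> bool list" where
  "encode_circuit C =
     encode_nat (num_inputs C) @ concat (map encode_gate (gates C)) @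
     [False, False] @ encode_nat (output_node C)"

lemma encode_nat_append_eq_iff [simp]:
  "encode_nat i @ xs = encode_nat j @ ys \<longleftrightarrow> i = j \<and> xs = ys"
proof (induction i arbitrary: j)
  case 0
  show ?case by (cases j) (auto simp: encode_nat_def)
next
  case (Suc i)
  then show ?case by (cases j) (auto simp: encode_nat_def)
qed

lemma encode_gates_append_eq_iff:
  "concat (map encode_gate gs) @ [False, False] @ xs =
   concat (map encode_gate hs) @ [False, False] @ ys \<longleftrightarrow> gs = hs \<and> xs = ys"
proof (induction gs arbitrary: hs)
  case Nil
  show ?case
  proof (cases hs)
    case (Cons h hs')
    then show ?thesis by (cases h) auto
  qed auto
next
  case (Cons g gs)
  show ?case
  proof (cases hs)
    case Nil
    then show ?thesis by (cases g) auto
  next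
    case (Cons h hs')
    then show ?thesis using Cons.IH[of hs'] by (cases g; cases h) auto
  qed
qed

lemma inj_encode_circuit: "inj encode_circuit"
proof (rule injI)
  fix C D assume "encode_circuit C = encode_circuit D"
  then have "num_inputs C = num_inputs D" and
    *: "concat (map encode_gate (gates C)) @ [False, False] @ encode_nat (output_node C) =
        concat (map encode_gate (gates D)) @ [False, False] @ encode_nat (output_node D)"
    unfolding encode_circuit_def by simp_all
  moreover have "gates C = gates D" "encode_nat (output_node C) = encode_nat (output_node D)"
    using * unfolding encode_gates_append_eq_iff by simp_all
  moreover from this(2) have "output_node C = output_node D"
    using encode_nat_append_eq_iff[of "output_node C" "[]" "output_node D" "[]"] by simp
  ultimately show "C = D" by simp
qed

definition AFFINE :: language where
  "AFFINE = {encode_circuit C | C. wf_circuit C \<and> affine (num_inputs C) (circuit_fun C)}"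

end

theory Submission
  imports Defs
begin

text \<open>
  Turing machines are programmed in a loop language on registers, one per tape, whose programs denote
  total functions. A stratification of the registers by levels bounds the running time by a polynomial
  once and for all, so that only functional correctness remains to be shown for each program.

  Membership: \<open>f\<close> is affine iff \<open>f 0 + f y + f z + f (y + z) = 0\<close> for all \<open>y\<close> and \<open>z\<close>; a verifier reads
  \<open>y\<close> and \<open>z\<close> from the witness and evaluates the circuit at these four points. Strings that are not
  encodings of circuits are accepted.

  Hardness: the computation of an NP verifier on \<open>(x, u)\<close> is unrolled into a circuit \<open>g\<^sub>x(u)\<close> in which
  every bit of a configuration is a polynomial of bounded size in the bits of the previous one. The
  function \<open>y\<^sub>1 y\<^sub>2 g\<^sub>x(u)\<close> is affine iff \<open>g\<^sub>x\<close> vanishes identically.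
\<close>

section \<open>A while language on tapes\<close>

text \<open>The emitting program has to know the number of every node that it refers to. Since node
  numbers are written in unary, a number is kept as the length of a register, and a reference is
  written by looping over that register. To make the numbers linear in the index of a cell, the
  polynomial of each bit is padded to a block of exactly \<open>G\<close> gates with its value in
  the last one. The head positions depend on the witness, so no fixed node holds the symbol that is
  read. A bit accumulated from left to right along each row carries this symbol to the last cell,
  where all cells of the next row find it. The verifier reads the circuit only once, so one symbol
  stores the values of a node at all four points. A circuit with n inputs has an encoding of length
  at least n, hence a witness of twice the length of the input has room for two points. If
  \<open>g\<^sub>x(u) = 1\<close>, then the four-point identity fails at (1, 0, u) and (0, 1, 0),
  whatever other values \<open>g\<^sub>x\<close> takes; this is the purpose of the two additional
  inputs.\<close>

datatype lcom =
    LSkip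
  | Act nat "nat option" move
  | LSeq lcom lcom
  | LIf nat nat lcom lcom
  | LWhile nat lcom

fun lwf :: "nat \<Rightarrow> nat \<Rightarrow> lcom \<Rightarrow> bool" where
  "lwf K S LSkip \<longleftrightarrow> True"
| "lwf K S (Act r w d) \<longleftrightarrow> r < K \<and> (\<forall>a. w = Some a \<longrightarrow> a < S)"
| "lwf K S (LSeq c d) \<longleftrightarrow> lwf K S c \<and> lwf K S d"
| "lwf K S (LIf r a c d) \<longleftrightarrow> lwf K S c \<and> lwf K S d"
| "lwf K S (LWhile r c) \<longleftrightarrow> lwf K S c"

definition idle :: "(nat \<Rightarrow> nat) \<Rightarrow> nat \<Rightarrow> nat \<times> move" where
  "idle rd = (\<lambda>i. (rd i, Stay))"

text \<open>The control state is a stack of pending commands. Unfolding a command or testing a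
  symbol is a step of its own, in which every tape is rewritten unchanged.\<close>

fun lstep :: "lcom list \<Rightarrow> (nat \<Rightarrow> nat) \<Rightarrow> lcom list \<times> (nat \<Rightarrow> nat \<times> move)" where
  "lstep [] rd = ([], idle rd)"
| "lstep (LSkip # k) rd = (k, idle rd)"
| "lstep (Act r w d # k) rd = (k, (idle rd)(r := (case w of None \<Rightarrow> rd r | Some a \<Rightarrow> a, d)))"
| "lstep (LSeq c1 c2 # k) rd = (c1 # c2 # k, idle rd)"
| "lstep (LIf r a c1 c2 # k) rd = ((if rd r = a then c1 else c2) # k, idle rd)"
| "lstep (LWhile r c # k) rd = (if rd r = 0 then k else c # LWhile r c # k, idle rd)"

text \<open>A syntactic, hence finite, overapproximation of the stacks that occur while
  \<open>c\<close> runs on top of the pending commands \<open>k\<close>. With \<open>k = []\<close>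
  it supplies the states of the machine.\<close>

fun conts :: "lcom \<Rightarrow> lcom list \<Rightarrow> lcom list set" where
  "conts LSkip k = {LSkip # k, k}"
| "conts (Act r w d) k = {Act r w d # k, k}"
| "conts (LSeq c1 c2) k = insert (LSeq c1 c2 # k) (conts c1 (c2 # k) \<union> conts c2 k)"
| "conts (LIf r a c1 c2) k = insert (LIf r a c1 c2 # k) (conts c1 k \<union> conts c2 k)"
| "conts (LWhile r c) k = insert k (insert (LWhile r c # k) (conts c (LWhile r c # k)))"

lemma finite_conts: "finite (conts c k)"
  by (induction c arbitrary: k) auto

lemma conts_start: "c # k \<in> conts c k"
  by (cases c) auto

lemma conts_end: "k \<in> conts c k"
  by (induction c arbitrary: k) auto

text \<open>The stack \<open>k\<close> is exempt because the step from there belongs to whatever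
  follows \<open>c\<close>. The empty stack is a fixed point of \<open>lstep\<close>, so for
  \<open>k = []\<close> the set is closed under steps.\<close>

lemma conts_closed:
  "\<kappa> \<in> conts c k \<Longrightarrow> \<kappa> = k \<or> fst (lstep \<kappa> rd) \<in> conts c k"
proof (induction c arbitrary: k)
  case (LSeq c1 c2)
  from LSeq.prems consider "\<kappa> = LSeq c1 c2 # k" | "\<kappa> \<in> conts c1 (c2 # k)" | "\<kappa> \<in> conts c2 k"
    by auto
  then show ?case
  proof cases
    case 2
    then show ?thesis
      using LSeq.IH(1)[OF 2] LSeq.IH(2)[of k] conts_start[of c2 k] by (cases "\<kappa> = c2 # k") auto
  qed (use LSeq.IH conts_start conts_end in auto)
next
  case (LWhile r c)
  from LWhile.prems consider "\<kappa> = k" | "\<kappa> = LWhile r c # k" | "\<kappa> \<in> conts c (LWhile r c # k)"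
    by auto
  then show ?case
  proof cases
    case 3
    then show ?thesis using LWhile.IH[OF 3] conts_start[of c "LWhile r c # k"]
      by (cases "\<kappa> = LWhile r c # k") auto
  qed (use conts_start in auto)
qed (use conts_start conts_end in auto)

lemma conts_lwf:
  "\<kappa> \<in> conts c k \<Longrightarrow> lwf K S c \<Longrightarrow> list_all (lwf K S) k \<Longrightarrow> list_all (lwf K S) \<kappa>"
  by (induction c arbitrary: k) fastforce+

text \<open>Tapes with numbers at least \<open>K\<close> do not exist; they are read as blank.\<close>

definition reads :: "nat \<Rightarrow> (nat \<Rightarrow> tape) \<Rightarrow> nat \<Rightarrow> nat" where
  "reads K ts = (\<lambda>i. if i < K then read_tape (ts i) else 0)"

lemma reads_nth: "i < K \<Longrightarrow> reads K ts i = read_tape (ts i)"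
  by (simp add: reads_def)

fun cstep :: "nat \<Rightarrow> lcom list \<times> (nat \<Rightarrow> tape) \<Rightarrow> lcom list \<times> (nat \<Rightarrow> tape)" where
  "cstep K (\<kappa>, ts) =
     (case lstep \<kappa> (reads K ts) of (\<kappa>', acts) \<Rightarrow>
        (\<kappa>', \<lambda>i. if i < K then act_tape (acts i) (ts i) else ts i))"

lemma act_tape_idle: "act_tape (read_tape t, Stay) t = t"
  by (cases t) auto

lemma idle_tapes:
  "(\<lambda>i. if i < K then act_tape (idle (reads K ts) i) (ts i) else ts i) = ts"
  by (auto simp: idle_def reads_def act_tape_idle)

lemma funpow_fixpoint: "f x = x \<Longrightarrow> (f ^^ n) x = x"
  by (induction n) auto

section \<open>Machines whose states are stacks of pending commands\<close>

locale continuation_machine =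
  fixes K S :: nat and c :: lcom and e :: "lcom list \<Rightarrow> nat" and M :: tm
  assumes wf: "lwf K S c" "K \<ge> 1" "S \<ge> 3"
    and e: "bij_betw e (conts c []) {0..<card (conts c [])}"
    and M: "M = \<lparr>num_tapes = K, num_states = card (conts c []), num_symbols = S,
       start = e [c], halt = e [],
       trans = (\<lambda>q rs. case lstep (inv_into (conts c []) e q) (\<lambda>i. if i < K then rs ! i else 0) of
          (\<kappa>, acts) \<Rightarrow> (e \<kappa>, map acts [0..<K]))\<rparr>"
begin

lemma inv_e: "\<kappa> \<in> conts c [] \<Longrightarrow> inv_into (conts c []) e (e \<kappa>) = \<kappa>"
  using e by (simp add: bij_betw_def)

lemma e_less: "\<kappa> \<in> conts c [] \<Longrightarrow> e \<kappa> < card (conts c [])"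
  using e by (auto simp: bij_betw_def)

lemma lstep_closed: "\<kappa> \<in> conts c [] \<Longrightarrow> fst (lstep \<kappa> rd) \<in> conts c []"
  using conts_closed[of \<kappa> c "[]" rd] by (auto intro: conts_end)

lemma wf_tm: "wf_tm M"
proof -
  have "case trans M q rs of (q', acts) \<Rightarrow> q' < num_states M \<and> length acts = num_tapes M \<and>
           (\<forall>(s, d)\<in>set acts. s < num_symbols M)"
    if q: "q < num_states M" and rs: "length rs = num_tapes M" "\<forall>r\<in>set rs. r < num_symbols M" for q rs
  proof -
    obtain \<kappa> where \<kappa>: "\<kappa> \<in> conts c []" "q = e \<kappa>"
      using q e by (auto simp: bij_betw_def M image_iff set_eq_iff)
    define rd where "rd = (\<lambda>i. if i < K then rs ! i else 0)"
    obtain \<kappa>' acts where l: "lstep \<kappa> rd = (\<kappa>', acts)" by fastforce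
    have k': "\<kappa>' \<in> conts c []" using lstep_closed[OF \<kappa>(1), of rd] l by simp
    have rd: "rd i < S" for i using rs wf by (auto simp: rd_def M)
    have wk: "list_all (lwf K S) \<kappa>" using conts_lwf[OF \<kappa>(1) wf(1)] by simp
    have a: "fst (acts i) < S" for i
      using l wk rd by (induction \<kappa> rd rule: lstep.induct) (auto simp: idle_def split: option.splits)
    show ?thesis
      using e_less[OF k'] a l inv_e[OF \<kappa>(1)] by (auto simp: M \<kappa>(2) rd_def[symmetric]) (metis fst_conv)
  qed
  then show ?thesis
    using wf e_less[OF conts_start] e_less[OF conts_end] unfolding wf_tm_def by (auto simp: M)
qed

lemma step_cstep:
  assumes "\<kappa> \<in> conts c []"
  shows "step M (e \<kappa>, map ts [0..<K]) =
    (case cstep K (\<kappa>, ts) of (\<kappa>', ts') \<Rightarrow> (e \<kappa>', map ts' [0..<K]))"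
proof (cases "\<kappa> = []")
  case True
  then show ?thesis by (simp add: M idle_tapes)
next
  case False
  \<comment> \<open>Injectivity of the numbering keeps a nonempty stack apart from the halting
    state, in which \<open>step\<close> would stand still.\<close>
  have "e \<kappa> \<noteq> e []"
    using e assms False conts_end[of "[]" c] by (auto simp: bij_betw_def inj_on_def)
  moreover have "(\<lambda>i. if i < K then map (read_tape \<circ> ts) [0..<K] ! i else 0) = reads K ts"
    by (auto simp: reads_def)
  ultimately show ?thesis
    by (auto simp: M inv_e[OF assms] split: prod.splits intro!: nth_equalityI)
qed

lemma steps_csteps:
  assumes "\<kappa> \<in> conts c []" "(cstep K ^^ t) (\<kappa>, ts) = (\<kappa>', ts')"
  shows "(step M ^^ t) (e \<kappa>, map ts [0..<K]) = (e \<kappa>', map ts' [0..<K]) \<and> \<kappa>' \<in> conts c []"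
  using assms(2)
proof (induction t arbitrary: \<kappa>' ts')
  case 0
  then show ?case using assms(1) by simp
next
  case (Suc t)
  obtain \<kappa>1 ts1 where 1: "(cstep K ^^ t) (\<kappa>, ts) = (\<kappa>1, ts1)" by fastforce
  from Suc.IH[OF 1] have 2: "(step M ^^ t) (e \<kappa>, map ts [0..<K]) = (e \<kappa>1, map ts1 [0..<K])"
    and k1: "\<kappa>1 \<in> conts c []" by auto
  have 3: "cstep K (\<kappa>1, ts1) = (\<kappa>', ts')" using Suc.prems 1 by simp
  then have "\<kappa>' \<in> conts c []" using lstep_closed[OF k1] by (auto split: prod.splits) (metis fst_conv)
  then show ?case using step_cstep[OF k1, of ts1] 2 3 by simp
qed

end

text \<open>Quantifying over the pending stack makes runs composable, since the same run can be
  placed in front of any continuation.\<close>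

definition lruns :: "nat \<Rightarrow> lcom \<Rightarrow> (nat \<Rightarrow> tape) \<Rightarrow> nat \<Rightarrow> (nat \<Rightarrow> tape) \<Rightarrow> bool" where
  "lruns K c ts t ts' \<longleftrightarrow> (\<forall>\<kappa>. (cstep K ^^ t) (c # \<kappa>, ts) = (\<kappa>, ts'))"

lemma lruns_cong: "lruns K c ts t ts' \<Longrightarrow> t = t' \<Longrightarrow> ts' = ts'' \<Longrightarrow> lruns K c ts t' ts''"
  by simp

lemma funpow_Suc_start: "(f ^^ Suc n) x = (f ^^ n) (f x)"
  by (simp add: funpow_swap1)

lemma lruns_Skip: "lruns K LSkip ts 1 ts"
  by (simp add: lruns_def idle_tapes)

lemma lruns_Act:
  assumes "r < K"
  shows "lruns K (Act r w d) ts 1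
    (ts(r := act_tape (case w of None \<Rightarrow> read_tape (ts r) | Some a \<Rightarrow> a, d) (ts r)))"
  using assms by (auto simp: lruns_def reads_def idle_def act_tape_idle fun_eq_iff)

lemma lruns_Seq:
  assumes "lruns K c1 ts t1 ts1" "lruns K c2 ts1 t2 ts2"
  shows "lruns K (LSeq c1 c2) ts (Suc (t1 + t2)) ts2"
  unfolding lruns_def
proof
  fix \<kappa>
  have "(cstep K ^^ Suc (t2 + t1)) (LSeq c1 c2 # \<kappa>, ts) = (cstep K ^^ t2) ((cstep K ^^ t1) (c1 # c2 # \<kappa>, ts))"
    unfolding funpow_Suc_start by (simp add: idle_tapes funpow_add)
  then show "(cstep K ^^ Suc (t1 + t2)) (LSeq c1 c2 # \<kappa>, ts) = (\<kappa>, ts2)"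
    using assms by (simp only: lruns_def add.commute)
qed

lemma lruns_If:
  assumes "r < K" "lruns K (if read_tape (ts r) = a then c1 else c2) ts t ts'"
  shows "lruns K (LIf r a c1 c2) ts (Suc t) ts'"
  using assms unfolding lruns_def funpow_Suc_start by (auto simp: idle_tapes reads_nth)

lemma lruns_While_done:
  assumes "r < K" "read_tape (ts r) = 0"
  shows "lruns K (LWhile r c) ts 1 ts"
  using assms by (auto simp: lruns_def idle_tapes reads_nth)

lemma lruns_While_step:
  assumes "r < K" "read_tape (ts r) \<noteq> 0" "lruns K c ts t ts1" "lruns K (LWhile r c) ts1 t' ts2"
  shows "lruns K (LWhile r c) ts (Suc (t + t')) ts2"
  unfolding lruns_def
proof
  fix \<kappa>
  have "(cstep K ^^ Suc (t' + t)) (LWhile r c # \<kappa>, ts) =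
      (cstep K ^^ t') ((cstep K ^^ t) (c # LWhile r c # \<kappa>, ts))"
    unfolding funpow_Suc_start using assms(1,2) by (simp add: idle_tapes funpow_add reads_nth)
  then show "(cstep K ^^ Suc (t + t')) (LWhile r c # \<kappa>, ts) = (\<kappa>, ts2)"
    using assms(3,4) by (simp only: lruns_def add.commute)
qed

section \<open>A loop language on registers\<close>

type_synonym store = "nat \<Rightarrow> nat list"

datatype com =
    Skip
  | Push nat nat
  | Pop nat
  | Seq com com (infixr ";;" 60)
  | IfTop nat nat com com
  | For nat com com

text \<open>Programs that satisfy \<open>wfc\<close> never store the blank 0, so the value 0 is free
  to signal an empty register.\<close>

definition top_of :: "nat list \<Rightarrow> nat" where
  "top_of xs = (if xs = [] then 0 else last xs)"

fun sem :: "com \<Rightarrow> store \<Rightarrow> store" where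
  "sem Skip s = s"
| "sem (Push r a) s = s(r := s r @ [a])"
| "sem (Pop r) s = s(r := butlast (s r))"
| "sem (c1 ;; c2) s = sem c2 (sem c1 s)"
| "sem (IfTop r a c1 c2) s = (if top_of (s r) = a then sem c1 s else sem c2 s)"
| "sem (For r c1 c2) s = fold (\<lambda>b s. if b = 1 then sem c1 s else sem c2 s) (s r) s"

abbreviation sweep :: "com \<Rightarrow> com \<Rightarrow> nat list \<Rightarrow> store \<Rightarrow> store" where
  "sweep c1 c2 \<equiv> fold (\<lambda>b s. if b = 1 then sem c1 s else sem c2 s)"

fun regs :: "com \<Rightarrow> nat set" where
  "regs Skip = {}"
| "regs (Push r a) = {r}"
| "regs (Pop r) = {r}"
| "regs (c1 ;; c2) = regs c1 \<union> regs c2"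
| "regs (IfTop r a c1 c2) = insert r (regs c1 \<union> regs c2)"
| "regs (For r c1 c2) = insert r (regs c1 \<union> regs c2)"

text \<open>The head of the tape of \<open>r\<close> sweeps over the register during a loop, so the body of the loop
  must not touch \<open>r\<close>.\<close>

fun wfc :: "nat \<Rightarrow> nat \<Rightarrow> com \<Rightarrow> bool" where
  "wfc K S Skip \<longleftrightarrow> True"
| "wfc K S (Push r a) \<longleftrightarrow> r < K \<and> 0 < a \<and> a < S"
| "wfc K S (Pop r) \<longleftrightarrow> r < K"
| "wfc K S (c1 ;; c2) \<longleftrightarrow> wfc K S c1 \<and> wfc K S c2"
| "wfc K S (IfTop r a c1 c2) \<longleftrightarrow> r < K \<and> wfc K S c1 \<and> wfc K S c2"
| "wfc K S (For r c1 c2) \<longleftrightarrow> r < K \<and> r \<notin> regs c1 \<and> r \<notin> regs c2 \<and> wfc K S c1 \<and> wfc K S c2"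

text \<open>A move to the left uncovers the top symbol. Cell -1 stays blank, so reading 0 there
  means that the register is empty. A loop rewinds to cell 0 and sweeps to the right, which brings
  the head back to its resting place on the first blank.\<close>

fun compile :: "com \<Rightarrow> lcom" where
  "compile Skip = LSkip"
| "compile (Push r a) = Act r (Some a) Right"
| "compile (Pop r) = LSeq (Act r None Left) (LIf r 0 (Act r None Right) (Act r (Some 0) Stay))"
| "compile (c1 ;; c2) = LSeq (compile c1) (compile c2)"
| "compile (IfTop r a c1 c2) = LSeq (Act r None Left)
     (LIf r a (LSeq (Act r None Right) (compile c1)) (LSeq (Act r None Right) (compile c2)))"
| "compile (For r c1 c2) = LSeq (LSeq (Act r None Left) (LSeq (LWhile r (Act r None Left)) (Act r None Right)))
     (LWhile r (LSeq (LIf r 1 (compile c1) (compile c2)) (Act r None Right)))"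

text \<open>An upper bound on the register lengths (\<open>Some r\<close>) and the running time (\<open>None\<close>). Both branches of
  a conditional are charged one after the other and \<open>Pop\<close> is not credited, which makes the bound
  monotone and inflationary.\<close>

definition bump :: "nat \<Rightarrow> (nat option \<Rightarrow> nat) \<Rightarrow> nat option \<Rightarrow> nat" where
  "bump n l = l(None := l None + n)"

fun ub :: "com \<Rightarrow> (nat option \<Rightarrow> nat) \<Rightarrow> nat option \<Rightarrow> nat" where
  "ub Skip l = bump 1 l"
| "ub (Push r a) l = (bump 1 l)(Some r := l (Some r) + 1)"
| "ub (Pop r) l = bump 4 l"
| "ub (c1 ;; c2) l = bump 1 (ub c2 (ub c1 l))"
| "ub (IfTop r a c1 c2) l = bump 5 (ub c2 (ub c1 l))"
| "ub (For r c1 c2) l =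
     bump 7 (((\<lambda>l. bump 6 (ub c2 (ub c1 l))) ^^ l (Some r)) l)"

lemma bump_mono: "l \<le> l' \<Longrightarrow> bump n l \<le> bump n l'"
  by (auto simp: bump_def le_fun_def)

lemma bump_incr: "l \<le> bump n l"
  by (auto simp: bump_def le_fun_def)

lemma funpow_incr:
  fixes f :: "('a \<Rightarrow> nat) \<Rightarrow> 'a \<Rightarrow> nat"
  assumes "\<And>l. l \<le> f l" "a \<le> b"
  shows "(f ^^ a) l \<le> (f ^^ b) l"
  using assms(2)
proof (induction b)
  case (Suc b)
  then show ?case using assms(1)[of "(f ^^ b) l"] by (cases "a = Suc b") (auto intro: order_trans)
qed auto

lemma funpow_mono':
  fixes f :: "('a \<Rightarrow> nat) \<Rightarrow> 'a \<Rightarrow> nat"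
  assumes "\<And>l l'. l \<le> l' \<Longrightarrow> f l \<le> f l'" "l \<le> l'"
  shows "(f ^^ n) l \<le> (f ^^ n) l'"
  using assms by (induction n) auto

lemma ub_incr: "l \<le> ub c l"
proof (induction c arbitrary: l)
  case (Seq c1 c2)
  then show ?case using bump_incr order_trans by (metis ub.simps(4))
next
  case (IfTop r a c1 c2)
  then show ?case using bump_incr order_trans by (metis ub.simps(5))
next
  case (For r c1 c2)
  have "l \<le> bump 6 (ub c2 (ub c1 l))" for l
    using For.IH bump_incr order_trans by metis
  from funpow_incr[OF this, of 0 "l (Some r)" l] show ?case
    using bump_incr[of "((\<lambda>l. bump 6 (ub c2 (ub c1 l))) ^^ l (Some r)) l" 7] by (auto intro: order_trans)
qed (auto simp: le_fun_def bump_def)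

lemma loop_body_incr: "l \<le> bump n (ub c2 (ub c1 l))"
  using ub_incr[of l c1] ub_incr[of "ub c1 l" c2] bump_incr[of "ub c2 (ub c1 l)" n]
  by (blast intro: order_trans)

lemma ub_mono: "l \<le> l' \<Longrightarrow> ub c l \<le> ub c l'"
proof (induction c arbitrary: l l')
  case (For r c1 c2)
  let ?f = "\<lambda>l. bump 6 (ub c2 (ub c1 l))"
  have "(?f ^^ l (Some r)) l \<le> (?f ^^ l' (Some r)) l"
    using le_funD[OF For.prems]
    by (intro funpow_incr loop_body_incr)
  also have "\<dots> \<le> (?f ^^ l' (Some r)) l'"
    using For by (intro funpow_mono' bump_mono) auto
  finally show ?case by (simp add: bump_mono)
qed (auto intro!: bump_mono simp: le_fun_def bump_def)

lemma sem_unchanged: "r \<notin> regs c \<Longrightarrow> sem c s r = s r"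
proof (induction c arbitrary: s)
  case (For q c1 c2)
  have "sweep c1 c2 xs s r = s r" for xs
    using For by (induction xs arbitrary: s) auto
  then show ?case by simp
qed auto

lemma sem_nonzero: "wfc K S c \<Longrightarrow> \<forall>r. 0 \<notin> set (s r) \<Longrightarrow> 0 \<notin> set (sem c s r)"
proof (induction c arbitrary: s r)
  case (For q c1 c2)
  have "\<forall>r. 0 \<notin> set (sweep c1 c2 xs s r)" for xs
    using For by (induction xs arbitrary: s) auto
  then show ?case by simp
qed (auto dest: in_set_butlastD split: if_splits)

text \<open>Which branch runs is not known, so both are charged: by \<open>ub_incr\<close> and
  \<open>ub_mono\<close> the bound for either body alone is at most the bound for one after the
  other.\<close>

lemma sem_length:
  "\<forall>r. length (s r) \<le> l (Some r) \<Longrightarrow> length (sem c s r) \<le> ub c l (Some r)"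
proof (induction c arbitrary: s l r)
  case (IfTop q a c1 c2)
  have "length (sem c1 s r) \<le> ub c2 (ub c1 l) (Some r)"
    using IfTop.IH(1)[OF IfTop.prems, of r] ub_incr[of "ub c1 l" c2] by (meson le_funD order_trans)
  moreover have "length (sem c2 s r) \<le> ub c2 (ub c1 l) (Some r)"
    using IfTop.IH(2)[OF IfTop.prems, of r] ub_mono[OF ub_incr, of c2 l c1] by (meson le_funD order_trans)
  ultimately show ?case by (auto simp: bump_def)
next
  case (For q c1 c2)
  let ?f = "\<lambda>l. bump 6 (ub c2 (ub c1 l))"
  have step: "\<forall>r. length ((if b = 1 then sem c1 s else sem c2 s) r) \<le> ?f l (Some r)"
    if "\<forall>r. length (s r) \<le> l (Some r)" for b :: nat and s l
    using order_trans[OF For.IH(1)[OF that] le_funD[OF ub_incr[of "ub c1 l" c2]]]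
      order_trans[OF For.IH(2)[OF that] le_funD[OF ub_mono[OF ub_incr, of c2 l c1]]]
    by (simp add: bump_def)
  have *: "\<forall>r. length (sweep c1 c2 xs s r)
      \<le> (?f ^^ length xs) l (Some r)"
    if "\<forall>r. length (s r) \<le> l (Some r)" for xs s l
    using that
  proof (induction xs arbitrary: s l)
    case (Cons b xs)
    show ?case using Cons.IH[OF step[OF Cons.prems]] by (simp only: fold.simps o_apply length_Cons funpow_Suc_start simp_thms)
  qed auto
  have "length (sem (For q c1 c2) s r) \<le> (?f ^^ length (s q)) l (Some r)"
    using *[OF For.prems, of "s q"] by simp
  also have "\<dots> \<le> (?f ^^ l (Some q)) l (Some r)"
    using For.prems by (intro le_funD[OF funpow_incr[OF loop_body_incr]]) blast
  finally show ?case by (simp add: bump_def)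
next
  case (Pop q)
  then have "length (s r) \<le> l (Some r)" by blast
  then show ?case by (auto simp: bump_def)
qed (auto simp: bump_def)

text \<open>Registers that are only read, such as those that merely bound a loop, are not counted.
  \<open>regs\<close> is too coarse to show that they keep their contents.\<close>

fun writes :: "com \<Rightarrow> nat set" where
  "writes Skip = {}"
| "writes (Push r a) = {r}"
| "writes (Pop r) = {r}"
| "writes (c1 ;; c2) = writes c1 \<union> writes c2"
| "writes (IfTop r a c1 c2) = writes c1 \<union> writes c2"
| "writes (For r c1 c2) = writes c1 \<union> writes c2"

lemma sem_unwritten: "r \<notin> writes c \<Longrightarrow> sem c s r = s r"
proof (induction c arbitrary: s)
  case (For q c1 c2)
  have "sweep c1 c2 xs s r = s r" for xs
    using For by (induction xs arbitrary: s) auto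
  then show ?case by simp
qed auto

lemma writes_subset_regs: "writes c \<subseteq> regs c"
  by (induction c) auto

definition Loop :: "nat \<Rightarrow> com \<Rightarrow> com" where
  "Loop r c = For r c c"

lemma sem_Loop: "sem (Loop r c) s = (sem c ^^ length (s r)) s"
proof -
  have "fold (\<lambda>_. sem c) xs s = (sem c ^^ length xs) s" for xs :: "nat list"
    by (induction xs arbitrary: s) (simp_all add: funpow_swap1)
  then show ?thesis by (simp add: Loop_def)
qed

lemma regs_Loop [simp]: "regs (Loop r c) = insert r (regs c)"
  by (simp add: Loop_def)

lemma wfc_Loop [simp]: "wfc K S (Loop r c) \<longleftrightarrow> r < K \<and> r \<notin> regs c \<and> wfc K S c"
  by (auto simp: Loop_def)

section \<open>Registers as tapes\<close>

text \<open>Between commands the head of a tape rests on the first blank after the register.\<close>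

definition cells :: "nat list \<Rightarrow> int \<Rightarrow> nat" where
  "cells xs = (\<lambda>i. if 0 \<le> i \<and> i < int (length xs) then xs ! nat i else 0)"

definition tape_of :: "nat list \<Rightarrow> tape" where
  "tape_of xs = (cells xs, int (length xs))"

lemma cells_snoc: "(cells xs)(int (length xs) := a) = cells (xs @ [a])"
  by (auto simp: cells_def fun_eq_iff nth_append)

lemma cells_butlast: "xs \<noteq> [] \<Longrightarrow> (cells xs)(int (length xs) - 1 := 0) = cells (butlast xs)"
  by (auto simp: cells_def fun_eq_iff nth_butlast)

lemma cells_last: "cells xs (int (length xs) - 1) = top_of xs"
  by (auto simp: cells_def top_of_def last_conv_nth nat_diff_distrib' intro!: arg_cong[of _ _ "(!) xs"])

lemma top_of_eq_0: "0 \<notin> set xs \<Longrightarrow> top_of xs = 0 \<longleftrightarrow> xs = []"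
  using last_in_set[of xs] by (auto simp: top_of_def simp del: last_in_set) (metis neq0_conv)

text \<open>Each cell costs two steps, a test and a move. As the register contains no blank, the
  loop cannot stop before cell -1.\<close>

lemma lruns_rewind_loop:
  assumes "r < K" "0 \<notin> set xs" "n \<le> length xs" "ts r = (cells xs, int n - 1)"
  shows "lruns K (LWhile r (Act r None Left)) ts (1 + 2 * n) (ts(r := (cells xs, -1)))"
  using assms(3,4)
proof (induction n arbitrary: ts)
  case 0
  then have "ts(r := (cells xs, -1)) = ts" by auto
  moreover have "read_tape (ts r) = 0" using 0 by (simp add: cells_def)
  ultimately show ?case using lruns_While_done[OF assms(1), of ts] by simp
next
  case (Suc n)
  have "xs ! n \<noteq> 0" using Suc.prems(1) assms(2) nth_mem[of n xs] by (metis Suc_le_eq)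
  then have "read_tape (ts r) \<noteq> 0" using Suc.prems assms(2) by (auto simp: cells_def)
  note rd = this
  let ?ts = "ts(r := (cells xs, int n - 1))"
  have 1: "lruns K (Act r None Left) ts 1 ?ts"
    using lruns_Act[OF assms(1), of None Left ts] Suc.prems(2) by simp
  have 2: "lruns K (LWhile r (Act r None Left)) ?ts (1 + 2 * n) (?ts(r := (cells xs, -1)))"
    using Suc.prems(1) by (intro Suc.IH) auto
  show ?case by (rule lruns_cong[OF lruns_While_step[OF assms(1) rd 1 2]]) auto
qed

lemma lruns_rewind:
  assumes "r < K" "0 \<notin> set xs" "ts r = tape_of xs"
  shows "lruns K (LSeq (Act r None Left) (LSeq (LWhile r (Act r None Left)) (Act r None Right))) ts
    (Suc (Suc (Suc (Suc (Suc (2 * length xs)))))) (ts(r := (cells xs, 0)))"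
proof -
  let ?t1 = "ts(r := (cells xs, int (length xs) - 1))" and ?t2 = "ts(r := (cells xs, -1))"
  have 1: "lruns K (Act r None Left) ts 1 ?t1"
    using lruns_Act[OF assms(1), of None Left ts] assms(3) by (simp add: tape_of_def)
  have 2: "lruns K (LWhile r (Act r None Left)) ?t1 (1 + 2 * length xs) ?t2"
    using lruns_rewind_loop[OF assms(1,2) order_refl, of ?t1] by simp
  have 3: "lruns K (Act r None Right) ?t2 1 (ts(r := (cells xs, 0)))"
    using lruns_Act[OF assms(1), of None Right ?t2] by simp
  show ?thesis using lruns_Seq[OF 1 lruns_Seq[OF 2 3]] by simp
qed

text \<open>Tapes outside \<open>regs c\<close> may be in any position. This matters for loops,
  where the head of the loop register is in the middle of its word while the body runs.\<close>

definition updated :: "com \<Rightarrow> store \<Rightarrow> (nat \<Rightarrow> tape) \<Rightarrow> nat \<Rightarrow> tape" where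
  "updated c s ts = (\<lambda>r. if r \<in> regs c then tape_of (sem c s r) else ts r)"

text \<open>The entry \<open>l None\<close> stands for the time spent so far, so the bounds of
  consecutive commands compose without extra bookkeeping. Only the tapes of \<open>regs c\<close>
  are required to be at rest.\<close>

theorem compile_correct:
  assumes "wfc K S c" "\<forall>r\<in>regs c. ts r = tape_of (s r)" "\<forall>r. 0 \<notin> set (s r)"
    "\<forall>r. length (s r) \<le> l (Some r)"
  shows "\<exists>t. lruns K (compile c) ts t (updated c s ts) \<and> t + l None \<le> ub c l None"
  using assms
proof (induction c arbitrary: ts s l)
  case Skip
  then show ?case using lruns_Skip[of K ts] by (auto simp: updated_def bump_def intro!: exI[of _ 1])
next
  case (Push r a)
  have "lruns K (compile (Push r a)) ts 1 (updated (Push r a) s ts)"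
    using lruns_Act[of r K "Some a" Right ts] Push.prems
    by (auto simp: updated_def tape_of_def cells_snoc fun_eq_iff elim!: lruns_cong)
  then show ?case by (auto simp: bump_def intro!: exI[of _ 1])
next
  case (Pop r)
  let ?ts = "ts(r := (cells (s r), int (length (s r)) - 1))"
  have r: "r < K" and tsr: "ts r = (cells (s r), int (length (s r)))" and nz: "0 \<notin> set (s r)"
    using Pop.prems by (auto simp: tape_of_def)
  have 1: "lruns K (Act r None Left) ts 1 ?ts"
    using lruns_Act[OF r, of None Left ts] tsr by simp
  have 2: "lruns K (LIf r 0 (Act r None Right) (Act r (Some 0) Stay)) ?ts (Suc 1) (updated (Pop r) s ts)"
  proof (rule lruns_If[OF r])
    show "lruns K (if read_tape (?ts r) = 0 then Act r None Right else Act r (Some 0) Stay) ?ts 1 (updated (Pop r) s ts)"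
    proof (cases "s r = []")
      case True
      then show ?thesis
        using lruns_Act[OF r, of None Right ?ts]
        by (auto simp: updated_def tape_of_def cells_def fun_eq_iff elim!: lruns_cong)
    next
      case False
      have "updated (Pop r) s ts = ts(r := ((cells (s r))(int (length (s r)) - 1 := 0), int (length (s r)) - 1))"
        using False by (auto simp: updated_def tape_of_def cells_butlast[OF False] fun_eq_iff of_nat_diff Suc_leI)
      then show ?thesis
        using lruns_Act[OF r, of "Some 0" Stay ?ts] False by (simp add: cells_last top_of_eq_0[OF nz])
    qed
  qed
  show ?case using lruns_Seq[OF 1 2] by (auto simp: bump_def)
next
  case (Seq c1 c2)
  obtain t1 where t1: "lruns K (compile c1) ts t1 (updated c1 s ts)" "t1 + l None \<le> ub c1 l None"
    using Seq.IH(1)[of ts s l] Seq.prems by auto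
  have "\<forall>r\<in>regs c2. updated c1 s ts r = tape_of (sem c1 s r)"
    using Seq.prems by (simp add: updated_def sem_unchanged)
  then obtain t2 where t2: "lruns K (compile c2) (updated c1 s ts) t2 (updated c2 (sem c1 s) (updated c1 s ts))"
    "t2 + ub c1 l None \<le> ub c2 (ub c1 l) None"
    using Seq.IH(2)[of "updated c1 s ts" "sem c1 s" "ub c1 l"] Seq.prems sem_nonzero[of K S c1 s] sem_length[of s l c1]
    by auto
  have "updated c2 (sem c1 s) (updated c1 s ts) = updated (c1 ;; c2) s ts"
    using Seq.prems by (auto simp: updated_def sem_unchanged fun_eq_iff)
  then show ?case using lruns_Seq[OF t1(1) t2(1)] t1(2) t2(2) by (auto simp: bump_def intro!: exI)
next
  case (IfTop r a c1 c2)
  let ?c = "if top_of (s r) = a then c1 else c2"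
  let ?ts = "ts(r := (cells (s r), int (length (s r)) - 1))"
  have r: "r < K" and tsr: "ts r = (cells (s r), int (length (s r)))"
    using IfTop.prems by (auto simp: tape_of_def)
  have 1: "lruns K (Act r None Left) ts 1 ?ts"
    using lruns_Act[OF r, of None Left ts] tsr by simp
  have 2: "lruns K (Act r None Right) ?ts 1 ts"
    using lruns_Act[OF r, of None Right ?ts] tsr by (simp add: fun_upd_idem)
  obtain t1 where t1: "lruns K (compile c1) ts t1 (updated c1 s ts)" "t1 + l None \<le> ub c1 l None"
    using IfTop.IH(1)[of ts s l] IfTop.prems by auto
  obtain t2 where t2: "lruns K (compile c2) ts t2 (updated c2 s ts)" "t2 + l None \<le> ub c2 l None"
    using IfTop.IH(2)[of ts s l] IfTop.prems by auto
  have "ub c1 l \<le> ub c2 (ub c1 l)" "ub c2 l \<le> ub c2 (ub c1 l)"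
    using ub_incr[of "ub c1 l" c2] ub_mono[OF ub_incr, of c2 l c1] by auto
  note le = le_funD[OF this(1)] le_funD[OF this(2)]
  obtain t where t: "lruns K (compile ?c) ts t (updated ?c s ts)" "t + l None \<le> ub c2 (ub c1 l) None"
    using t1 t2 order_trans[OF t1(2) le(1)] order_trans[OF t2(2) le(2)]
    by (cases "top_of (s r) = a") auto
  have "updated ?c s ts = updated (IfTop r a c1 c2) s ts"
    using IfTop.prems(2) sem_unchanged[of _ ?c s] by (auto simp: updated_def fun_eq_iff tape_of_def)
  with t have 3: "lruns K (LIf r a (LSeq (Act r None Right) (compile c1)) (LSeq (Act r None Right) (compile c2))) ?ts
      (Suc (Suc (1 + t))) (updated (IfTop r a c1 c2) s ts)"
    using lruns_Seq[OF 2, of "compile ?c" t] by (intro lruns_If[OF r]) (auto simp: cells_last split: if_splits)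
  show ?case using lruns_Seq[OF 1 3] t(2) by (auto simp: bump_def intro!: exI)
next
  case (For r c1 c2)
  let ?f = "\<lambda>l. bump 6 (ub c2 (ub c1 l))"
  let ?F = "sweep c1 c2"
  let ?R = "regs c1 \<union> regs c2"
  let ?body = "LSeq (LIf r 1 (compile c1) (compile c2)) (Act r None Right)"
  have r: "r < K" "r \<notin> ?R" and wf: "wfc K S c1" "wfc K S c2" using For.prems by auto
  \<comment> \<open>Here \<open>pre\<close> is the part already swept and \<open>ys\<close> the
    rest. One iteration has an overhead of 4 steps but is charged 6; the remaining 2 per symbol form
    the summand \<open>2 * length ys\<close>, which is set aside for the rewind. The
    \<open>Suc\<close> pays for the final test.\<close>
  have loop: "\<exists>t. lruns K (LWhile r ?body) ts t
        (\<lambda>q. if q = r then tape_of xs else if q \<in> ?R then tape_of (?F ys s q) else ts q) \<and>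
      t + l None + 2 * length ys \<le> Suc ((?f ^^ length ys) l None)"
    if "xs = pre @ ys" "0 \<notin> set xs" "ts r = (cells xs, int (length pre))" "\<forall>q\<in>?R. ts q = tape_of (s q)"
      "\<forall>q. 0 \<notin> set (s q)" "\<forall>q. length (s q) \<le> l (Some q)" for xs ys pre ts s l
    using that
  proof (induction ys arbitrary: pre ts s l)
    case Nil
    have "(\<lambda>q. if q = r then tape_of xs else if q \<in> ?R then tape_of (?F [] s q) else ts q) = ts"
      using Nil by (auto simp: fun_eq_iff tape_of_def)
    moreover have "read_tape (ts r) = 0" using Nil by (simp add: cells_def)
    ultimately show ?case using lruns_While_done[OF r(1), of ts ?body] by (auto intro!: exI[of _ 1])
  next
    case (Cons b ys)
    let ?c = "if b = 1 then c1 else c2"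
    have rd: "read_tape (ts r) = b" using Cons.prems(1,3) by (simp add: cells_def)
    have b0: "b \<noteq> 0" using Cons.prems(1,2) by auto
    obtain t1 where t1: "lruns K (compile c1) ts t1 (updated c1 s ts)" "t1 + l None \<le> ub c1 l None"
      using For.IH(1)[of ts s l] wf Cons.prems by auto
    obtain t2 where t2: "lruns K (compile c2) ts t2 (updated c2 s ts)" "t2 + l None \<le> ub c2 l None"
      using For.IH(2)[of ts s l] wf Cons.prems by auto
    have le: "ub c1 l \<le> ub c2 (ub c1 l)" "ub c2 l \<le> ub c2 (ub c1 l)"
      using ub_incr[of "ub c1 l" c2] ub_mono[OF ub_incr, of c2 l c1] by auto
    then obtain t where t: "lruns K (compile ?c) ts t (updated ?c s ts)" "t + l None \<le> ub c2 (ub c1 l) None"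
      using t1 t2 order_trans[OF t1(2) le_funD[OF le(1)]] order_trans[OF t2(2) le_funD[OF le(2)]]
      by (cases "b = 1") auto
    have rc: "r \<notin> regs ?c" using r by auto
    let ?ts = "(updated ?c s ts)(r := (cells xs, int (length (pre @ [b]))))"
    have 1: "lruns K (LIf r 1 (compile c1) (compile c2)) ts (Suc t) (updated ?c s ts)"
      using t(1) rd by (intro lruns_If[OF r(1)]) (auto split: if_splits)
    have 2: "lruns K (Act r None Right) (updated ?c s ts) 1 ?ts"
      using lruns_Act[OF r(1), of None Right "updated ?c s ts"] rc Cons.prems(3)
      by (simp add: updated_def add.commute)
    have s': "\<forall>q. 0 \<notin> set (sem ?c s q)"
      using sem_nonzero[of K S ?c s] wf Cons.prems(5) by (cases "b = 1") auto
    have "\<forall>q. length (sem ?c s q) \<le> ub c2 (ub c1 l) (Some q)"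
      using order_trans[OF sem_length[OF Cons.prems(6), of c1] le_funD[OF le(1)]]
        order_trans[OF sem_length[OF Cons.prems(6), of c2] le_funD[OF le(2)]] by simp
    then have l': "\<forall>q. length (sem ?c s q) \<le> ?f l (Some q)" by (simp add: bump_def)
    have ts': "\<forall>q\<in>?R. ?ts q = tape_of (sem ?c s q)"
      using r Cons.prems(4) sem_unchanged[of _ ?c s] by (auto simp: updated_def)
    have xs: "xs = (pre @ [b]) @ ys" and tsr: "?ts r = (cells xs, int (length (pre @ [b])))"
      using Cons.prems(1) by auto
    from Cons.IH[OF xs Cons.prems(2) tsr ts' s' l'] obtain t' where t': "lruns K (LWhile r ?body) ?ts t'
        (\<lambda>q. if q = r then tape_of xs else if q \<in> ?R then tape_of (?F ys (sem ?c s) q) else ?ts q)"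
      "t' + ?f l None + 2 * length ys \<le> Suc ((?f ^^ length ys) (?f l) None)" by blast
    have eq: "(\<lambda>q. if q = r then tape_of xs else if q \<in> ?R then tape_of (?F ys (sem ?c s) q) else ?ts q) =
       (\<lambda>q. if q = r then tape_of xs else if q \<in> ?R then tape_of (?F (b # ys) s q) else ts q)"
      by (auto simp: updated_def fun_eq_iff)
    have "lruns K (LWhile r ?body) ts (Suc (Suc (Suc t + 1) + t'))
       (\<lambda>q. if q = r then tape_of xs else if q \<in> ?R then tape_of (?F (b # ys) s q) else ts q)"
      using lruns_While_step[OF r(1) _ lruns_Seq[OF 1 2] t'(1)[unfolded eq]] rd b0 by simp
    moreover have "Suc (Suc (Suc t + 1) + t') + l None + 2 * length (b # ys) \<le> Suc ((?f ^^ length (b # ys)) l None)"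
      using t(2) t'(2) by (simp only: length_Cons funpow_Suc_start) (simp add: bump_def)
    ultimately show ?case by blast
  qed
  have tsr: "ts r = tape_of (s r)" and nz: "0 \<notin> set (s r)" using For.prems by auto
  let ?ts = "ts(r := (cells (s r), 0))"
  obtain t where t: "lruns K (LWhile r ?body) ?ts t
        (\<lambda>q. if q = r then tape_of (s r) else if q \<in> ?R then tape_of (?F (s r) s q) else ?ts q)"
      "t + l None + 2 * length (s r) \<le> Suc ((?f ^^ length (s r)) l None)"
    using loop[of "s r" "[]" "s r" ?ts s l] For.prems r by fastforce
  have "?F xs s r = s r" for xs s
    using r(2) by (induction xs arbitrary: s) (auto simp: sem_unchanged)
  then have "(\<lambda>q. if q = r then tape_of (s r) else if q \<in> ?R then tape_of (?F (s r) s q) else ?ts q) =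
     updated (For r c1 c2) s ts" by (auto simp: updated_def fun_eq_iff)
  with lruns_Seq[OF lruns_rewind[of r K "s r" ts, OF r(1) nz tsr] t(1)]
  have 1: "lruns K (compile (For r c1 c2)) ts (Suc (Suc (Suc (Suc (Suc (Suc (2 * length (s r))))))  + t)) (updated (For r c1 c2) s ts)"
    by simp
  have "(?f ^^ length (s r)) l \<le> (?f ^^ l (Some r)) l"
    using For.prems(4) by (intro funpow_incr loop_body_incr) blast
  then have "(?f ^^ length (s r)) l None \<le> (?f ^^ l (Some r)) l None"
    by (rule le_funD)
  \<comment> \<open>The constant 7 of the bound consists of the 5 fixed steps of the rewind, one
    step of sequencing and the final test of the loop.\<close>
  then have "Suc (Suc (Suc (Suc (Suc (Suc (2 * length (s r))))))  + t) + l None \<le> ub (For r c1 c2) l None"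
    using t(2) by (simp add: bump_def)
  with 1 show ?case by blast
qed


section \<open>Polynomial bounds\<close>

text \<open>A level discipline in the style of ramified recursion: \<open>Push r\<close> may only occur inside loops over
  registers of smaller level. The clock \<open>None\<close> has the highest level.\<close>

fun lvok :: "(nat option \<Rightarrow> nat) \<Rightarrow> nat \<Rightarrow> com \<Rightarrow> bool" where
  "lvok lv m Skip \<longleftrightarrow> True"
| "lvok lv m (Push r a) \<longleftrightarrow> m \<le> lv (Some r)"
| "lvok lv m (Pop r) \<longleftrightarrow> True"
| "lvok lv m (c1 ;; c2) \<longleftrightarrow> lvok lv m c1 \<and> lvok lv m c2"
| "lvok lv m (IfTop r a c1 c2) \<longleftrightarrow> lvok lv m c1 \<and> lvok lv m c2"
| "lvok lv m (For r c1 c2) \<longleftrightarrow> lv (Some r) < lv None \<and>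
     lvok lv (max m (Suc (lv (Some r)))) c1 \<and> lvok lv (max m (Suc (lv (Some r)))) c2"

lemma lvok_Loop [simp]:
  "lvok lv m (Loop r c) \<longleftrightarrow> lv (Some r) < lv None \<and> lvok lv (max m (Suc (lv (Some r)))) c"
  by (auto simp: Loop_def)

lemma funpow_invariant:
  assumes "\<And>l. f l q = l q"
  shows "(f ^^ n) l q = (l q :: nat)"
  using assms by (induction n) auto

text \<open>A push to \<open>q\<close> would need a level of at least \<open>m\<close>, and this
  threshold only rises inside loops. Hence entries of small level are constant during a
  loop.\<close>

lemma ub_below_level:
  "lvok lv m c \<Longrightarrow> m \<le> lv None \<Longrightarrow> lv q < m \<Longrightarrow> ub c l q = l q"
proof (induction c arbitrary: l m)
  case (For r c1 c2)
  let ?f = "\<lambda>l. bump 6 (ub c2 (ub c1 l))"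
  have "?f l q = l q" for l
    using For.IH[of "max m (Suc (lv (Some r)))"] For.prems by (auto simp: bump_def)
  then have "(?f ^^ l (Some r)) l q = l q" by (rule funpow_invariant)
  then show ?case using For.prems by (auto simp: bump_def)
qed (cases q; force simp: bump_def)+

text \<open>The old value \<open>l q\<close> enters with coefficient 1 and everything else is
  polynomial in the entries of \<open>P\<close>. Iterating such a map adds increments instead of
  multiplying values, which keeps loops polynomial. The base \<open>N + 2\<close> is at least 2, so
  that sums of powers can be absorbed by a larger exponent.\<close>

definition grows :: "'a set \<Rightarrow> 'a set \<Rightarrow> (('a \<Rightarrow> nat) \<Rightarrow> 'a \<Rightarrow> nat) \<Rightarrow> bool" where
  "grows P Q f \<longleftrightarrow> (\<exists>k. \<forall>N l q. (\<forall>q\<in>P. l q \<le> N) \<longrightarrow> q \<in> Q \<longrightarrow> f l q \<le> l q + (N + 2) ^ k)"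

lemma growsE:
  assumes "grows P Q f"
  obtains k where "\<And>N l q. (\<And>q. q \<in> P \<Longrightarrow> l q \<le> N) \<Longrightarrow> q \<in> Q \<Longrightarrow> f l q \<le> l q + (N + 2) ^ k"
  using assms unfolding grows_def by blast

text \<open>The increment of an entry of level \<open>h\<close> depends on entries of strictly
  smaller level only.\<close>

definition poly_growth :: "(nat option \<Rightarrow> nat) \<Rightarrow> ((nat option \<Rightarrow> nat) \<Rightarrow> nat option \<Rightarrow> nat) \<Rightarrow> bool" where
  "poly_growth lv f \<longleftrightarrow> (\<forall>h. grows {q. lv q < h} {q. lv q \<le> h} f)"

lemma pow_sum_le: "(N + 2) ^ a + (N + 2) ^ b \<le> (N + 2 :: nat) ^ (a + b + 1)"
proof -
  have "(N + 2) ^ a \<le> (N + 2) ^ (a + b)" "(N + 2) ^ b \<le> (N + 2) ^ (a + b)"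
    by (auto intro: power_increasing)
  then have "(N + 2) ^ a + (N + 2) ^ b \<le> 2 * (N + 2) ^ (a + b)" by linarith
  also have "\<dots> \<le> (N + 2) * (N + 2) ^ (a + b)" by (rule mult_right_mono) auto
  finally show ?thesis by simp
qed

lemma pow_sum_le': "N + (N + 2) ^ k + 2 \<le> (N + 2 :: nat) ^ (k + 2)"
  using pow_sum_le[of N k 1] by simp

text \<open>Because of \<open>P \<subseteq> Q\<close>, the entries of \<open>P\<close> are at most
  \<open>N + (N + 2) ^ k1\<close> after \<open>f\<close>; inserting this into the bound for
  \<open>g\<close> composes the two polynomials.\<close>

lemma grows_comp:
  assumes "grows P Q f" "grows P Q g" "P \<subseteq> Q"
  shows "grows P Q (\<lambda>l. g (f l))"
proof -
  obtain k1 where k1: "\<And>N l q. (\<forall>q\<in>P. l q \<le> N) \<Longrightarrow> q \<in> Q \<Longrightarrow> f l q \<le> l q + (N + 2) ^ k1"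
    using assms(1) unfolding grows_def by meson
  obtain k2 where k2: "\<And>N l q. (\<forall>q\<in>P. l q \<le> N) \<Longrightarrow> q \<in> Q \<Longrightarrow> g l q \<le> l q + (N + 2) ^ k2"
    using assms(2) unfolding grows_def by meson
  have "g (f l) q \<le> l q + (N + 2) ^ (k1 + (k1 + 2) * k2 + 1)"
    if l: "\<forall>q\<in>P. l q \<le> N" and q: "q \<in> Q" for N l q
  proof -
    have "f l q \<le> N + (N + 2) ^ k1" if "q \<in> P" for q
      using k1[OF l, of q] l that assms(3) by (meson add_right_mono le_trans subsetD)
    then have "\<forall>q\<in>P. f l q \<le> N + (N + 2) ^ k1" by blast
    from k2[OF this q] have "g (f l) q \<le> f l q + (N + (N + 2) ^ k1 + 2) ^ k2" .
    also have "\<dots> \<le> l q + (N + 2) ^ k1 + ((N + 2) ^ (k1 + 2)) ^ k2"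
      using k1[OF l q] power_mono[OF pow_sum_le', of N k1 k2] by auto
    also have "\<dots> \<le> l q + (N + 2) ^ (k1 + (k1 + 2) * k2 + 1)"
      using pow_sum_le[of N k1 "(k1 + 2) * k2"] by (simp only: power_mult)
    finally show ?thesis .
  qed
  then show ?thesis unfolding grows_def by blast
qed

lemma poly_growth_comp:
  "poly_growth lv f \<Longrightarrow> poly_growth lv g \<Longrightarrow> poly_growth lv (\<lambda>l. g (f l))"
  unfolding poly_growth_def by (intro allI grows_comp[of _ _ f g]) auto

lemma grows_const:
  assumes "\<And>l q. f l q \<le> l q + n"
  shows "grows P Q f"
  unfolding grows_def
proof (intro allI exI impI)
  fix N l q
  have "n \<le> 2 ^ n" by (simp add: less_imp_le)
  also have "\<dots> \<le> (N + 2 :: nat) ^ n" by (rule power_mono) auto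
  finally show "f l q \<le> l q + (N + 2) ^ n" using assms[of l q] by linarith
qed

lemma poly_growth_const: "(\<And>l q. f l q \<le> l q + n) \<Longrightarrow> poly_growth lv f"
  unfolding poly_growth_def by (intro allI grows_const[of f n])

lemma poly_growth_bump: "poly_growth lv (bump n)"
  by (rule poly_growth_const[of _ n]) (simp add: bump_def)

text \<open>Induction on the level. Entries up to the level of \<open>r\<close> do not change. For
  an entry above it, the number of rounds is an entry of smaller level, and so is everything that
  determines the increment of a round.\<close>

lemma poly_growth_iterate:
  assumes f: "poly_growth lv f" "\<And>l. l \<le> f l" "\<And>l q. lv q \<le> lv (Some r) \<Longrightarrow> f l q = l q"
  shows "poly_growth lv (\<lambda>l. (f ^^ l (Some r)) l)"
  unfolding poly_growth_def
proof
  fix h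
  show "grows {q. lv q < h} {q. lv q \<le> h} (\<lambda>l. (f ^^ l (Some r)) l)"
  proof (induction h)
    case 0
    have "(f ^^ l (Some r)) l q = l q" if "lv q \<le> 0" for l q
      using f(3) that by (intro funpow_invariant) auto
    then show ?case by (auto simp: grows_def)
  next
    case (Suc h)
    from growsE[OF Suc] obtain k1 where k1: "\<And>N l q. (\<And>q. q \<in> {q. lv q < h} \<Longrightarrow> l q \<le> N) \<Longrightarrow>
      q \<in> {q. lv q \<le> h} \<Longrightarrow> (f ^^ l (Some r)) l q \<le> l q + (N + 2) ^ k1" by blast
    from growsE[OF f(1)[unfolded poly_growth_def, THEN spec, of "Suc h"]]
    obtain k2 where k2: "\<And>N l q. (\<And>q. q \<in> {q. lv q < Suc h} \<Longrightarrow> l q \<le> N) \<Longrightarrow>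
      q \<in> {q. lv q \<le> Suc h} \<Longrightarrow> f l q \<le> l q + (N + 2) ^ k2" by blast
    have "(f ^^ l (Some r)) l q \<le> l q + (N + 2) ^ (1 + (k1 + 2) * k2)"
      if l: "\<forall>q. lv q < Suc h \<longrightarrow> l q \<le> N" and q: "lv q \<le> Suc h" for N l q
    proof (cases "lv (Some r) \<le> h")
      case True
      \<comment> \<open>As \<open>f\<close> is inflationary, each intermediate value is at most the
        final one, which the induction hypothesis on the level bounds.\<close>
      have inv: "(f ^^ i) l q \<le> N + (N + 2) ^ k1" if "i \<le> l (Some r)" "lv q < Suc h" for i q
      proof -
        have "(f ^^ i) l q \<le> (f ^^ l (Some r)) l q"
          using funpow_incr[OF f(2) that(1)] by (rule le_funD)
        also have "\<dots> \<le> l q + (N + 2) ^ k1" using l that by (intro k1) auto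
        finally show ?thesis using l that(2) by (meson add_mono le_trans order_refl)
      qed
      \<comment> \<open>One bound on the smaller levels serves all rounds, so every round adds at
        most the same amount.\<close>
      have "(f ^^ i) l q \<le> l q + i * ((N + 2) ^ (k1 + 2)) ^ k2" if "i \<le> l (Some r)" for i
        using that
      proof (induction i)
        case (Suc i)
        have "(f ^^ Suc i) l q \<le> (f ^^ i) l q + (N + (N + 2) ^ k1 + 2) ^ k2"
          using k2[of "(f ^^ i) l" "N + (N + 2) ^ k1" q] inv[of i] Suc.prems q by simp
        also have "\<dots> \<le> (f ^^ i) l q + ((N + 2) ^ (k1 + 2)) ^ k2"
          using power_mono[OF pow_sum_le', of N k1 k2] by auto
        finally show ?case using Suc by simp
      qed simp
      from this[of "l (Some r)"] have "(f ^^ l (Some r)) l q \<le> l q + l (Some r) * ((N + 2) ^ (k1 + 2)) ^ k2"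
        by simp
      also have "\<dots> \<le> l q + (N + 2) * ((N + 2) ^ (k1 + 2)) ^ k2"
        using l True by (intro add_left_mono mult_right_mono) (auto simp: less_Suc_eq_le intro: le_trans)
      finally show ?thesis by (simp only: power_add power_mult power_one_right)
    next
      case False
      then have "(f ^^ l (Some r)) l q = l q" using q f(3) by (intro funpow_invariant) auto
      then show ?thesis by simp
    qed
    then show ?case unfolding grows_def by blast
  qed
qed

lemma poly_growth_ub: "lvok lv m c \<Longrightarrow> m \<le> lv None \<Longrightarrow> poly_growth lv (ub c)"
proof (induction c arbitrary: m)
  case (Push r a)
  then show ?case by (intro poly_growth_const[of _ 1]) (simp add: bump_def)
next
  case (Seq c1 c2)
  have "poly_growth lv (\<lambda>l. bump 1 (ub c2 (ub c1 l)))"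
    by (rule poly_growth_comp[OF poly_growth_comp[OF Seq.IH(1) Seq.IH(2)] poly_growth_bump]) (use Seq.prems in auto)
  then show ?case by simp
next
  case (IfTop r a c1 c2)
  have "poly_growth lv (\<lambda>l. bump 5 (ub c2 (ub c1 l)))"
    by (rule poly_growth_comp[OF poly_growth_comp[OF IfTop.IH(1) IfTop.IH(2)] poly_growth_bump]) (use IfTop.prems in auto)
  then show ?case by simp
next
  case (For r c1 c2)
  let ?m = "max m (Suc (lv (Some r)))" and ?f = "\<lambda>l. bump 6 (ub c2 (ub c1 l))"
  have wf: "lvok lv ?m c1" "lvok lv ?m c2" "?m \<le> lv None" using For.prems by auto
  have "poly_growth lv ?f"
    by (rule poly_growth_comp[OF poly_growth_comp[OF For.IH(1) For.IH(2)] poly_growth_bump]) (use wf in auto)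
  moreover have "?f l q = l q" if "lv q \<le> lv (Some r)" for l q
    using ub_below_level[OF wf(1,3), of q] ub_below_level[OF wf(2,3), of q] that wf(3) by (auto simp: bump_def)
  ultimately have "poly_growth lv (\<lambda>l. (?f ^^ l (Some r)) l)"
    by (rule poly_growth_iterate[of lv ?f r, OF _ loop_body_incr])
  from poly_growth_comp[OF this poly_growth_bump[of lv 7]] show ?case by simp
qed (rule poly_growth_const[of _ 4], simp add: bump_def)+

text \<open>The bound refers to the lengths of the registers only, and the clock enters additively.
  No levels are mentioned, so stages that are checked with different levels can be put in
  sequence.\<close>

definition poly_time :: "com \<Rightarrow> bool" where
  "poly_time c \<longleftrightarrow> grows (range Some) UNIV (ub c)"

lemma poly_time_Seq: "poly_time c1 \<Longrightarrow> poly_time c2 \<Longrightarrow> poly_time (c1 ;; c2)"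
  unfolding poly_time_def ub.simps(4)[abs_def]
  by (rule grows_comp[OF grows_comp[of _ _ "ub c1" "ub c2"] grows_const[of "bump 1" 1]]) (auto simp: bump_def)

lemma poly_time_lvok:
  fixes lv :: "nat \<Rightarrow> nat"
  assumes "lvok (\<lambda>q. case q of None \<Rightarrow> L | Some r \<Rightarrow> lv r) 0 c" "\<And>r. lv r < L"
  shows "poly_time c"
proof -
  let ?lv = "\<lambda>q. case q of None \<Rightarrow> L | Some r \<Rightarrow> lv r"
  have "poly_growth ?lv (ub c)" by (rule poly_growth_ub[OF assms(1)]) simp
  then have "grows {q. ?lv q < L} {q. ?lv q \<le> L} (ub c)" unfolding poly_growth_def by blast
  moreover have "{q. ?lv q < L} = range Some" "{q. ?lv q \<le> L} = UNIV"
    using assms(2) by (auto split: option.splits intro: less_imp_le)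
  ultimately show ?thesis by (simp add: poly_time_def)
qed

section \<open>From register programs to polynomial time\<close>

definition input_store :: "bool list \<Rightarrow> store" where
  "input_store x = (\<lambda>_. [])(0 := map bit_symbol x)"

lemma compile_lwf: "wfc K S c \<Longrightarrow> 0 < S \<Longrightarrow> lwf K S (compile c)"
  by (induction c) auto

text \<open>A machine starts on the first symbol of the input, whereas the head of a register rests
  on the blank after the last symbol.\<close>

lemma lruns_skip_input:
  assumes "r < K" "0 \<notin> set xs" "xs = ys @ zs" "ts r = (cells xs, int (length ys))"
  shows "lruns K (LWhile r (Act r None Right)) ts (1 + 2 * length zs) (ts(r := tape_of xs))"
  using assms(3,4)
proof (induction zs arbitrary: ys ts)
  case Nil
  then have "ts(r := tape_of xs) = ts" by (auto simp: tape_of_def)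
  moreover have "read_tape (ts r) = 0" using Nil by (simp add: cells_def)
  ultimately show ?case using lruns_While_done[OF assms(1), of ts] by simp
next
  case (Cons a zs)
  have rd: "read_tape (ts r) \<noteq> 0" using Cons.prems assms(2) by (auto simp: cells_def)
  let ?ts = "ts(r := (cells xs, int (length (ys @ [a]))))"
  have 1: "lruns K (Act r None Right) ts 1 ?ts"
    using lruns_Act[OF assms(1), of None Right ts] Cons.prems(2) by (simp add: add.commute)
  have 2: "lruns K (LWhile r (Act r None Right)) ?ts (1 + 2 * length zs) (?ts(r := tape_of xs))"
    using Cons.prems(1) by (intro Cons.IH) auto
  show ?case by (rule lruns_cong[OF lruns_While_step[OF assms(1) rd 1 2]]) auto
qed

text \<open>The result is taken from register \<open>K - 1\<close> because the output of a machine
  is read off the last tape.\<close>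

theorem polytime_computableI:
  assumes prog: "wfc K S c" "K \<ge> 1" "S \<ge> 3" and pt: "poly_time c"
    and sem: "\<And>x. sem c (input_store x) (K - 1) = map bit_symbol (f x)" and K: "K - 1 \<in> regs c"
  shows "polytime_computable f"
proof -
  define c' where "c' = LSeq (LWhile 0 (Act 0 None Right)) (compile c)"
  obtain e where e: "bij_betw e (conts c' []) {0..<card (conts c' [])}"
    using ex_bij_betw_finite_nat[OF finite_conts] by blast
  define M where "M = \<lparr>num_tapes = K, num_states = card (conts c' []), num_symbols = S,
       start = e [c'], halt = e [],
       trans = (\<lambda>q rs. case lstep (inv_into (conts c' []) e q) (\<lambda>i. if i < K then rs ! i else 0) of
          (\<kappa>, acts) \<Rightarrow> (e \<kappa>, map acts [0..<K]))\<rparr>"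
  interpret continuation_machine K S c' e M
    using prog e M_def compile_lwf[OF prog(1)] by unfold_locales (auto simp: c'_def)
  from growsE[OF pt[unfolded poly_time_def]] obtain k where
    k': "\<And>N l q. (\<And>q. q \<in> range Some \<Longrightarrow> l q \<le> N) \<Longrightarrow> q \<in> UNIV \<Longrightarrow> ub c l q \<le> l q + (N + 2) ^ k"
    by blast
  have k: "ub c l q \<le> l q + (N + 2) ^ k" if "\<forall>r. l (Some r) \<le> N" for N l q
    using that by (intro k') auto
  \<comment> \<open>With n the length of \<open>x\<close>, the linear part 2 + 2n pays for moving
    the head past the input and for the sequencing; the power pays for the program, whose registers
    initially have length at most n.\<close>
  have "case (step M ^^ poly ([:2, 2:] + [:2, 1:] ^ k) (length x)) (init_config M x) of (q, ts) \<Rightarrow>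
        q = halt M \<and> tape_holds (last ts) (f x)" for x
  proof -
    let ?s = "input_store x"
    define ts where "ts = (\<lambda>i :: nat. if i = 0 then input_tape x else blank_tape)"
    have init: "init_config M x = (e [c'], map ts [0..<K])"
      using prog(2) by (auto simp: init_config_def M_def ts_def nth_Cons split: nat.splits intro!: nth_equalityI)
    have nz: "\<forall>r. 0 \<notin> set (?s r)" by (auto simp: input_store_def bit_symbol_def)
    have ts0: "ts 0 = (cells (map bit_symbol x), int (length []))"
      by (auto simp: ts_def input_tape_def cells_def fun_eq_iff)
    have 1: "lruns K (LWhile 0 (Act 0 None Right)) ts (1 + 2 * length (map bit_symbol x)) (ts(0 := tape_of (map bit_symbol x)))"
      using prog(2) nz[THEN spec, of 0] ts0 lruns_skip_input[of 0 K "map bit_symbol x" "[]" "map bit_symbol x" ts]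
      by (simp add: input_store_def)
    let ?l = "\<lambda>q. case q of None \<Rightarrow> 0 | Some r \<Rightarrow> length (?s r)"
    have ts: "\<forall>r\<in>regs c. (ts(0 := tape_of (map bit_symbol x))) r = tape_of (?s r)"
      by (auto simp: input_store_def ts_def blank_tape_def tape_of_def cells_def)
    have l: "\<forall>r. length (?s r) \<le> ?l (Some r)" by simp
    from compile_correct[OF prog(1) ts nz l] obtain t where t: "lruns K (compile c) (ts(0 := tape_of (map bit_symbol x))) t (updated c ?s (ts(0 := tape_of (map bit_symbol x))))"
      "t + ?l None \<le> ub c ?l None" by blast
    let ?ts = "updated c ?s (ts(0 := tape_of (map bit_symbol x)))"
    let ?t = "Suc (1 + 2 * length (map bit_symbol x) + t)"
    have "(cstep K ^^ ?t) ([c'], ts) = ([], ?ts)"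
      using lruns_Seq[OF 1 t(1)] unfolding lruns_def c'_def by blast
    from steps_csteps[OF conts_start this]
    have st: "(step M ^^ ?t) (init_config M x) = (e [], map ?ts [0..<K])" by (simp add: init)
    have "ub c ?l None \<le> ?l None + (length x + 2) ^ k"
      by (rule k) (auto simp: input_store_def)
    then have "?t \<le> poly ([:2, 2:] + [:2, 1:] ^ k) (length x)"
      using t(2) by (simp add: poly_power add.commute)
    then obtain d where d: "poly ([:2, 2:] + [:2, 1:] ^ k) (length x) = d + ?t"
      by (metis le_Suc_ex add.commute)
    have "step M (e [], map ?ts [0..<K]) = (e [], map ?ts [0..<K])" by (simp add: M_def)
    then have "(step M ^^ poly ([:2, 2:] + [:2, 1:] ^ k) (length x)) (init_config M x) = (e [], map ?ts [0..<K])"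
      unfolding d funpow_add o_apply st by (rule funpow_fixpoint)
    moreover have "last (map ?ts [0..<K]) = tape_of (map bit_symbol (f x))"
      using prog(2) K sem[of x] by (simp add: last_map updated_def)
    ultimately show ?thesis
      by (auto simp: M_def tape_holds_def tape_of_def cells_def)
  qed
  then show ?thesis
    unfolding polytime_computable_def computes_in_time_def using wf_tm by blast
qed

section \<open>Affine functions\<close>

lemma nth_map2_add:
  "length y = length z \<Longrightarrow> i < length z \<Longrightarrow> map2 (+) y z ! i = y ! i + (z ! i :: bit)"
  by simp

text \<open>The right-hand side says that \<open>f\<close> minus its value at 0 is additive, and
  over the two-element field additive functions are linear. A violation is witnessed by two points,
  which is why non-affinity has short certificates.\<close>

lemma affine_iff_additive:
  "affine n f \<longleftrightarrow> (\<forall>y z. length y = n \<longrightarrow> length z = n \<longrightarrow>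
     f (replicate n 0) + f y + f z + f (map2 (+) y z) = 0)" (is "?L \<longleftrightarrow> ?R")
proof
  assume ?L
  then obtain a c where f: "\<And>x. length x = n \<Longrightarrow> f x = (\<Sum>i<n. a ! i * x ! i) + c"
    unfolding affine_def by blast
  show ?R
  proof (intro allI impI)
    fix y z :: "bit list" assume l: "length y = n" "length z = n"
    define Y Z where "Y = (\<Sum>i<n. a ! i * y ! i)" and "Z = (\<Sum>i<n. a ! i * z ! i)"
    have "(\<Sum>i<n. a ! i * map2 (+) y z ! i) = Y + Z"
      unfolding Y_def Z_def sum.distrib[symmetric]
      using l by (intro sum.cong refl) (simp only: lessThan_iff nth_map2_add distrib_left)
    then have "f (map2 (+) y z) = Y + Z + c" using l f[of "map2 (+) y z"] by (simp only: length_map length_zip min.idem)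
    moreover have "f y = Y + c" "f z = Z + c" using l f by (simp_all only: Y_def Z_def)
    moreover have "f (replicate n 0) = c" using f[of "replicate n 0"] by simp
    ultimately show "f (replicate n 0) + f y + f z + f (map2 (+) y z) = 0"
      by (cases Y; cases Z; cases c) simp_all
  qed
next
  assume R: ?R
  define o0 where "o0 = f (replicate n 0)"
  define e where "e = (\<lambda>k. (replicate n 0)[k := 1 :: bit])"
  define a where "a = map (\<lambda>k. f (e k) + o0) [0..<n]"
  \<comment> \<open>Induction on the length \<open>k\<close> of a prefix outside of which
    \<open>x\<close> vanishes. Clearing the last coordinate of the prefix splits off a unit vector,
    and additivity yields its contribution.\<close>
  have *: "f x = (\<Sum>i<k. a ! i * x ! i) + o0"
    if "k \<le> n" "length x = n" "\<forall>i. k \<le> i \<and> i < n \<longrightarrow> x ! i = 0" for k x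
    using that
  proof (induction k arbitrary: x)
    case 0
    then have "x = replicate n 0" by (intro nth_equalityI) auto
    then show ?case by (simp add: o0_def)
  next
    case (Suc k)
    show ?case
    proof (cases "x ! k = 0")
      case True
      then have "\<forall>i. k \<le> i \<and> i < n \<longrightarrow> x ! i = 0"
        using Suc.prems(3) by (metis Suc_leI le_neq_implies_less)
      then have "f x = (\<Sum>i<k. a ! i * x ! i) + o0" using Suc.prems by (intro Suc.IH) auto
      then show ?thesis by (simp only: sum.lessThan_Suc True mult_zero_right add_0_right)
    next
      case False
      let ?x = "x[k := 0]"
      have "map2 (+) ?x (e k) = x"
        using Suc.prems False by (intro nth_equalityI) (auto simp: e_def nth_list_update)
      then have "o0 + f ?x + f (e k) + f x = 0"
        using R[rule_format, of ?x "e k"] Suc.prems(2)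
        by (simp only: e_def o0_def length_list_update length_replicate)
      then have fx: "f x = f ?x + (f (e k) + o0)"
        by (cases "f x"; cases "f ?x"; cases "f (e k)"; cases o0) auto
      have "f ?x = (\<Sum>i<k. a ! i * ?x ! i) + o0"
        using Suc.prems by (intro Suc.IH) (auto simp: nth_list_update Suc_le_eq)
      also have "(\<Sum>i<k. a ! i * ?x ! i) = (\<Sum>i<k. a ! i * x ! i)"
        by (intro sum.cong) auto
      finally have "f ?x = (\<Sum>i<k. a ! i * x ! i) + o0" .
      moreover have "a ! k * x ! k = f (e k) + o0"
        using Suc.prems False by (simp only: bit_not_zero_iff mult_1_right) (simp add: a_def)
      ultimately show ?thesis unfolding fx sum.lessThan_Suc by (simp only: ac_simps)
    qed
  qed
  have "f x = (\<Sum>i<n. a ! i * x ! i) + o0" if "length x = n" for x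
    using that by (intro *) auto
  moreover have "length a = n" by (simp add: a_def)
  ultimately show ?L unfolding affine_def by blast
qed

section \<open>Evaluating a circuit at four points in parallel\<close>

text \<open>A symbol between 1 and 16 holds the values of a node at four points.\<close>

definition lane :: "nat \<Rightarrow> nat \<Rightarrow> bit" where
  "lane k c = of_bool (odd ((c - 1) div 2 ^ k))"

definition bit_num :: "bit \<Rightarrow> nat" where
  "bit_num b = (if b = 0 then 0 else 1)"

text \<open>The summand 1 keeps the codes away from the blank 0.\<close>

definition pack :: "(nat \<Rightarrow> bit) \<Rightarrow> nat" where
  "pack f = 1 + bit_num (f 0) + 2 * bit_num (f 1) + 4 * bit_num (f 2) + 8 * bit_num (f 3)"

lemma less_4_cases: "k < 4 \<Longrightarrow> k = 0 \<or> k = 1 \<or> k = 2 \<or> k = (3::nat)"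
  by auto

lemma lane_pack: "k < 4 \<Longrightarrow> lane k (pack f) = f k"
  by (drule less_4_cases) (cases "f 0"; cases "f 1"; cases "f 2"; cases "f 3"; auto simp: lane_def pack_def bit_num_def)

lemma pack_range: "0 < pack f" "pack f \<le> 16"
  by (auto simp: pack_def bit_num_def)

text \<open>The operator code is the \<open>bit_symbol\<close> of the second tag bit of a gate: 1
  for \<open>Xor_Gate\<close> and 2 for \<open>And_Gate\<close>.\<close>

definition packed_op :: "nat \<Rightarrow> nat \<Rightarrow> nat \<Rightarrow> nat" where
  "packed_op q a b = pack (\<lambda>k. if q = 1 then lane k a + lane k b else lane k a * lane k b)"

fun packed_gate :: "nat list \<Rightarrow> gate \<Rightarrow> nat" where
  "packed_gate vs One_Gate = pack (\<lambda>_. 1)"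
| "packed_gate vs (Xor_Gate i j) = packed_op 1 (vs ! i) (vs ! j)"
| "packed_gate vs (And_Gate i j) = packed_op 2 (vs ! i) (vs ! j)"

definition packed_values :: "nat list \<Rightarrow> gate list \<Rightarrow> nat list" where
  "packed_values vs gs = foldl (\<lambda>vs g. vs @ [packed_gate vs g]) vs gs"

definition wf_gates :: "nat \<Rightarrow> gate list \<Rightarrow> bool" where
  "wf_gates n gs \<longleftrightarrow> (\<forall>k<length gs. wf_gate (n + k) (gs ! k))"

lemma wf_gates_snoc: "wf_gates n (gs @ [g]) \<longleftrightarrow> wf_gates n gs \<and> wf_gate (n + length gs) g"
  by (auto simp: wf_gates_def nth_append less_Suc_eq)

lemma packed_values_Nil [simp]: "packed_values vs [] = vs"
  by (simp add: packed_values_def)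

lemma packed_values_snoc [simp]:
  "packed_values vs (gs @ [g]) = packed_values vs gs @ [packed_gate (packed_values vs gs) g]"
  by (simp add: packed_values_def)

lemma length_packed_values [simp]: "length (packed_values vs gs) = length vs + length gs"
  by (induction gs rule: rev_induct) auto

lemma lane_packed_values:
  "k < 4 \<Longrightarrow> wf_gates (length vs) gs \<Longrightarrow>
   map (lane k) (packed_values vs gs) = foldl (\<lambda>vs g. vs @ [gate_value vs g]) (map (lane k) vs) gs"
proof (induction gs rule: rev_induct)
  case (snoc g gs)
  then have "map (lane k) (packed_values vs gs) = foldl (\<lambda>vs g. vs @ [gate_value vs g]) (map (lane k) vs) gs"
    and g: "wf_gate (length vs + length gs) g" by (auto simp: wf_gates_snoc)
  from this(1)[symmetric] g show ?case
    using snoc.prems(1) by (cases g) (auto simp: lane_pack packed_op_def)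
qed simp

text \<open>Input \<open>i\<close> uses the pair number \<open>i\<close> of symbols counted from the
  end of the witness, where a register is popped; within a pair the bit of \<open>y\<close> comes
  off before that of \<open>z\<close>. The lanes 0 to 3 receive 0, \<open>y\<close>,
  \<open>z\<close> and \<open>y + z\<close>. An exhausted witness reads as 0.\<close>

definition input_code :: "nat list \<Rightarrow> nat \<Rightarrow> nat" where
  "input_code us i = pack (\<lambda>k. of_bool (odd k \<and> top_of (take (length us - 2 * i) us) = 2) +
     of_bool (2 \<le> k \<and> top_of (take (length us - 2 * i - 1) us) = 2))"

definition inputs :: "nat list \<Rightarrow> nat \<Rightarrow> nat list" where
  "inputs us n = map (input_code us) [0..<n]"

section \<open>A parsing automaton for circuits\<close>

text \<open>The components of a state: the mode, the values of the nodes, the position in this list, the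
  operator and the first operand of the current gate, and the unread part of the witness. In mode 1 the
  number of inputs is read, modes 2 and 3 read the two bits of a tag, mode 4 the operator, modes 5 and 6
  the operands, mode 8 the output node; mode 9 means success and mode 10 failure.\<close>

type_synonym pstate = "nat \<times> nat list \<times> nat \<times> nat list \<times> nat list \<times> nat list"

definition read_code :: "nat list \<Rightarrow> nat" where
  "read_code us = pack (\<lambda>k. of_bool (odd k \<and> top_of us = 2) + of_bool (2 \<le> k \<and> top_of (butlast us) = 2))"

fun pstep :: "bool \<Rightarrow> pstate \<Rightarrow> pstate" where
  "pstep b (m, vs, p, q, a, us) =
    (if m = 1 then
       if b then (1, vs @ [read_code us], Suc p, q, a, butlast (butlast us)) else (2, vs, 0, q, a, us)
     else if m = 2 then (if b then 4 else 3, vs, p, q, a, us)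
     else if m = 3 then
       if b then (2, vs @ [pack (\<lambda>_. 1)], 0, q, a, us) else (8, vs, p, q, a, us)
     else if m = 4 then (5, vs, p, q @ [if b then 2 else 1], a, us)
     else if m = 5 \<or> m = 6 \<or> m = 8 then
       if length vs \<le> p then (10, vs, p, q, a, us)
       else if b then (m, vs, Suc p, q, a, us)
       else if m = 5 then (6, vs, 0, q, a @ [vs ! p], us)
       else if m = 6 then (2, vs @ [packed_op (top_of q) (top_of a) (vs ! p)], 0, butlast q, butlast a, us)
       else (9, vs, p, q, a @ [vs ! p], us)
     else (10, vs, p, q, a, us))"

abbreviation header :: "nat \<Rightarrow> gate list \<Rightarrow> bool list" where
  "header n gs \<equiv> encode_nat n @ concat (map encode_gate gs)"

fun pinv_body :: "nat \<Rightarrow> gate list \<Rightarrow> bool list \<Rightarrow> pstate \<Rightarrow> bool" where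
  "pinv_body n gs w (m, vs, p, q, a, us) \<longleftrightarrow>
      (m = 2 \<and> w = header n gs \<and> p = 0 \<and> q = [] \<and> a = [] \<or>
       m = 3 \<and> w = header n gs @ [False] \<and> p = 0 \<and> q = [] \<and> a = [] \<or>
       m = 4 \<and> w = header n gs @ [True] \<and> p = 0 \<and> q = [] \<and> a = [] \<or>
       m = 5 \<and> p \<le> length vs \<and> a = [] \<and>
         (\<exists>b. w = header n gs @ [True, b] @ replicate p True \<and> q = [if b then 2 else 1]) \<or>
       m = 6 \<and> p \<le> length vs \<and>
         (\<exists>b i. i < length vs \<and> w = header n gs @ [True, b] @ encode_nat i @ replicate p True \<and>
            q = [if b then 2 else 1] \<and> a = [vs ! i]) \<or>
       m = 8 \<and> p \<le> length vs \<and> w = header n gs @ [False, False] @ replicate p True \<and> q = [] \<and> a = [] \<or>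
       m = 9 \<and> (\<exists>i<length vs. w = header n gs @ [False, False] @ encode_nat i \<and> a = [vs ! i]))"

text \<open>The mode determines the shape of the word read so far. In mode 9 this word is a complete
  encoding, which gives soundness of the parser: a further bit leads to mode 10, about which nothing
  is claimed.\<close>

fun pinv :: "nat list \<Rightarrow> bool list \<Rightarrow> pstate \<Rightarrow> bool" where
  "pinv us w (m, vs, p, q, a, us') \<longleftrightarrow>
    (m = 1 \<and> (\<exists>n. w = replicate n True \<and> vs = inputs us n \<and> p = n \<and>
       us' = take (length us - 2 * n) us \<and> q = [] \<and> a = [])) \<or>
    (\<exists>n gs. wf_gates n gs \<and> vs = packed_values (inputs us n) gs \<and> pinv_body n gs w (m, vs, p, q, a, us')) \<or>
    m = 10"

lemma pinvI:
  "wf_gates n gs \<Longrightarrow> vs = packed_values (inputs us n) gs \<Longrightarrow> pinv_body n gs w (m, vs, p, q, a, us') \<Longrightarrow>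
   pinv us w (m, vs, p, q, a, us')"
  unfolding pinv.simps by blast

lemma replicate_True_snoc: "replicate n True @ [True] = replicate (Suc n) True"
  by (simp add: replicate_append_same)

lemma read_code_take: "read_code (take (length us - 2 * n) us) = input_code us n"
  by (simp add: read_code_def input_code_def butlast_take)

lemma inputs_Suc: "inputs us (Suc n) = inputs us n @ [input_code us n]"
  by (simp add: inputs_def)

lemma length_inputs [simp]: "length (inputs us n) = n"
  by (simp add: inputs_def)

lemma butlast_butlast_take: "butlast (butlast (take (length us - 2 * n) us)) = take (length us - 2 * Suc n) us"
  by (simp add: butlast_take numeral_2_eq_2)

lemma top_of_Nil [simp]: "top_of [] = 0"
  by (simp add: top_of_def)

lemma top_of_single [simp]: "top_of [x] = x"
  by (simp add: top_of_def)

lemma pinv_step: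
  assumes "pinv us w (m, vs, p, q, a, us')"
  shows "pinv us (w @ [b]) (pstep b (m, vs, p, q, a, us'))"
proof -
  consider (1) n where "m = 1" "w = replicate n True" "vs = inputs us n" "p = n"
       "us' = take (length us - 2 * n) us" "q = []" "a = []"
    | (2) n gs where "wf_gates n gs" "vs = packed_values (inputs us n) gs" "pinv_body n gs w (m, vs, p, q, a, us')"
    | (3) "m = 10"
    using assms unfolding pinv.simps by blast
  then show ?thesis
  proof cases
    case 1
    show ?thesis
    proof (cases b)
      case True
      then show ?thesis using 1
        by (auto simp: replicate_True_snoc read_code_take inputs_Suc butlast_butlast_take simp del: replicate_Suc)
    next
      case False
      then show ?thesis using 1
        by (auto simp: encode_nat_def wf_gates_def intro!: exI[of _ n] exI[of _ "[]"])
    qed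
  next
    case 2
    note wf = 2(1) and vs = 2(2)
    have len: "length vs = n + length gs" by (simp add: vs)
    from 2(3)[unfolded pinv_body.simps] show ?thesis
    proof (elim disjE conjE)
      assume "m = 2" "w = header n gs" "p = 0" "q = []" "a = []"
      then show ?thesis
        by (cases b) (simp del: pinv.simps, intro pinvI[OF wf vs], (auto)[1])+
    next
      assume m: "m = 3" "w = header n gs @ [False]" "p = 0" "q = []" "a = []"
      show ?thesis
      proof (cases b)
        case True
        then show ?thesis using m wf vs
          by (simp del: pinv.simps, intro pinvI[where n = n and gs = "gs @ [One_Gate]"]) (auto simp: wf_gates_snoc)
      next
        case False
        then show ?thesis using m by (simp del: pinv.simps, intro pinvI[OF wf vs]) auto
      qed
    next
      assume "m = 4" "w = header n gs @ [True]" "p = 0" "q = []" "a = []"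
      then show ?thesis
        by (cases b) (simp del: pinv.simps, intro pinvI[OF wf vs], (auto)[1])+
    next
      assume m: "m = 5" "p \<le> length vs" "a = []"
        and "\<exists>b. w = header n gs @ [True, b] @ replicate p True \<and> q = [if b then 2 else 1]"
      then obtain c where c: "w = header n gs @ [True, c] @ replicate p True" "q = [if c then 2 else 1]" by blast
      consider "length vs \<le> p" | "p < length vs" b | "p < length vs" "\<not> b" by linarith
      then show ?thesis
      proof cases
        case 1
        then show ?thesis using m by simp
      next
        case 2
        then have "pstep b (m, vs, p, q, a, us') = (5, vs, Suc p, q, a, us')" using m by simp
        moreover have "w @ [b] = header n gs @ [True, c] @ replicate (Suc p) True"
          using 2 c by (simp add: replicate_append_same)
        ultimately show ?thesis using c(2) m 2(1) by (simp only:, intro pinvI[OF wf vs]) auto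
      next
        case 3
        then have "pstep b (m, vs, p, q, a, us') = (6, vs, 0, q, [vs ! p], us')" using m by simp
        moreover have "w @ [b] = header n gs @ [True, c] @ encode_nat p @ replicate 0 True"
          using 3 c by (simp add: encode_nat_def)
        ultimately show ?thesis using c(2) m 3(1) by (simp only:, intro pinvI[OF wf vs]) auto
      qed
    next
      assume m: "m = 6" "p \<le> length vs"
        and "\<exists>b i. i < length vs \<and> w = header n gs @ [True, b] @ encode_nat i @ replicate p True \<and>
            q = [if b then 2 else 1] \<and> a = [vs ! i]"
      then obtain c i where c: "i < length vs" "w = header n gs @ [True, c] @ encode_nat i @ replicate p True"
        "q = [if c then 2 else 1]" "a = [vs ! i]" by blast
      consider "length vs \<le> p" | "p < length vs" b | "p < length vs" "\<not> b" by linarith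
      then show ?thesis
      proof cases
        case 1
        then show ?thesis using m by simp
      next
        case 2
        then have "pstep b (m, vs, p, q, a, us') = (6, vs, Suc p, q, a, us')" using m by simp
        moreover have "w @ [b] = header n gs @ [True, c] @ encode_nat i @ replicate (Suc p) True"
          using 2 c by (simp add: replicate_append_same)
        ultimately show ?thesis using c m 2(1) by (simp only:, intro pinvI[OF wf vs]) auto
      next
        case 3
        \<comment> \<open>The 0 that ends the second operand completes this gate, so the description
          of the word absorbs it into the gate list.\<close>
        let ?g = "if c then And_Gate i p else Xor_Gate i p"
        have "pstep b (m, vs, p, q, a, us') = (2, packed_values (inputs us n) (gs @ [?g]), 0, [], [], us')"
          using m 3 c vs by simp
        moreover have "w @ [b] = header n (gs @ [?g])"
          using 3 c by (simp add: encode_nat_def)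
        moreover have "wf_gates n (gs @ [?g])" using wf c(1) 3(1) len by (simp add: wf_gates_snoc)
        ultimately show ?thesis by (simp only:, intro pinvI[OF _ refl]) auto
      qed
    next
      assume m: "m = 8" "p \<le> length vs" "w = header n gs @ [False, False] @ replicate p True" "q = []" "a = []"
      consider "length vs \<le> p" | "p < length vs" b | "p < length vs" "\<not> b" by linarith
      then show ?thesis
      proof cases
        case 1
        then show ?thesis using m by simp
      next
        case 2
        then have "pstep b (m, vs, p, q, a, us') = (8, vs, Suc p, q, a, us')" using m by simp
        moreover have "w @ [b] = header n gs @ [False, False] @ replicate (Suc p) True"
          using 2 m by (simp add: replicate_append_same)
        ultimately show ?thesis using m 2(1) by (simp only:, intro pinvI[OF wf vs]) auto
      next
        case 3
        then have "pstep b (m, vs, p, q, a, us') = (9, vs, p, q, [vs ! p], us')" using m by simp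
        moreover have "w @ [b] = header n gs @ [False, False] @ encode_nat p"
          using 3 m by (simp add: encode_nat_def)
        ultimately show ?thesis using m 3(1) by (simp only:, intro pinvI[OF wf vs]) auto
      qed
    qed simp
  next
    case 3
    then show ?thesis by simp
  qed
qed

definition pinit :: "nat list \<Rightarrow> pstate" where
  "pinit us = (1, [], 0, [], [], us)"

lemma pinv_fold: "pinv us w (fold pstep w (pinit us))"
proof (induction w rule: rev_induct)
  case Nil
  show ?case by (auto simp: pinit_def inputs_def)
next
  case (snoc b w)
  obtain m vs p q a us' where st: "fold pstep w (pinit us) = (m, vs, p, q, a, us')"
    using prod_cases6 by blast
  show ?case using pinv_step[of us w m vs p q a us' b] snoc by (simp add: st del: pinv.simps pstep.simps)
qed

lemma pstep_index:
  "m \<in> {5, 6, 8} \<Longrightarrow> p + i \<le> length vs \<Longrightarrow>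
   fold pstep (replicate i True) (m, vs, p, q, a, us) = (m, vs, p + i, q, a, us)"
  by (induction i arbitrary: p) (auto simp del: fold_replicate)

lemma pstep_gate:
  assumes "wf_gate (length vs) g"
  shows "fold pstep (encode_gate g) (2, vs, 0, [], [], us) = (2, vs @ [packed_gate vs g], 0, [], [], us)"
  using assms
  by (cases g) (simp_all add: encode_nat_def pstep_index[where p = 0] del: fold_replicate)

lemma pstep_gates:
  "wf_gates (length vs) gs \<Longrightarrow>
   fold pstep (concat (map encode_gate gs)) (2, vs, 0, [], [], us) = (2, packed_values vs gs, 0, [], [], us)"
  by (induction gs rule: rev_induct) (simp_all add: wf_gates_snoc pstep_gate)

lemma pstep_inputs:
  "fold pstep (replicate n True) (pinit us) = (1, inputs us n, n, [], [], take (length us - 2 * n) us)"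
proof (induction n)
  case (Suc n)
  then show ?case
    by (simp only: replicate_True_snoc[symmetric] fold_append o_apply)
       (simp add: read_code_take inputs_Suc butlast_butlast_take)
qed (simp add: pinit_def inputs_def)

text \<open>Completeness, the counterpart of \<open>pinv_fold\<close>: every encoding of a
  well-formed circuit reaches mode 9, with the value of the output node as the remaining
  operand.\<close>

lemma pstep_circuit:
  assumes "wf_circuit C"
  shows "fold pstep (encode_circuit C) (pinit us) =
    (let vs = packed_values (inputs us (num_inputs C)) (gates C) in
      (9, vs, output_node C, [], [vs ! output_node C], take (length us - 2 * num_inputs C) us))"
  using assms
  by (simp add: encode_circuit_def wf_circuit_def encode_nat_def pstep_inputs Let_def wf_gates_def
      pstep_gates pstep_index[where p = 0] del: fold_replicate)

section \<open>The verifier\<close>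

text \<open>Symbols can be tested but not copied by a single command. Branching over all possible
  symbols moves the top symbol into the control, where an arbitrary function of it can be
  hard-wired.\<close>

fun case_top :: "nat \<Rightarrow> (nat \<Rightarrow> com) \<Rightarrow> nat \<Rightarrow> com" where
  "case_top r f 0 = f 0"
| "case_top r f (Suc n) = IfTop r (Suc n) (f (Suc n)) (case_top r f n)"

lemma sem_case_top: "top_of (s r) \<le> n \<Longrightarrow> sem (case_top r f n) s = sem (f (top_of (s r))) s"
  by (induction n) (auto simp: le_Suc_eq)

lemma regs_case_topI: "r \<in> A \<Longrightarrow> (\<And>i. regs (f i) \<subseteq> A) \<Longrightarrow> regs (case_top r f n) \<subseteq> A"
  by (induction n) auto

lemma writes_case_topI: "(\<And>i. writes (f i) \<subseteq> A) \<Longrightarrow> writes (case_top r f n) \<subseteq> A"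
  by (induction n) auto

lemma wfc_case_top: "r < K \<Longrightarrow> (\<And>i. i \<le> n \<Longrightarrow> wfc K S (f i)) \<Longrightarrow> wfc K S (case_top r f n)"
  by (induction n) auto

lemma lvok_case_top: "(\<And>i. i \<le> n \<Longrightarrow> lvok lv m (f i)) \<Longrightarrow> lvok lv m (case_top r f n)"
  by (induction n) auto

definition move_top :: "nat \<Rightarrow> nat \<Rightarrow> com" where
  "move_top r q = case_top r (\<lambda>a. if a = 0 then Skip else Pop r ;; Push q a) 16"

text \<open>Register 3 has at least as many symbols as there are values to be moved; once
  \<open>r\<close> is empty, further rounds do nothing.\<close>

definition move_all :: "nat \<Rightarrow> nat \<Rightarrow> com" where
  "move_all r q = Loop 3 (move_top r q)"

lemma top_of_le: "set xs \<subseteq> {1..n} \<Longrightarrow> top_of xs \<le> n"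
  using subsetD[of "set xs" "{1..n}" "last xs"] by (auto simp: top_of_def)

lemma top_of_pos: "set xs \<subseteq> {1..n} \<Longrightarrow> top_of xs = 0 \<longleftrightarrow> xs = []"
  using subsetD[of "set xs" "{1..n}" "last xs"] by (auto simp: top_of_def)

lemma sem_move_top:
  assumes "set (s r) \<subseteq> {1..16}"
  shows "sem (move_top r q) s =
    (if s r = [] then s else (s(r := butlast (s r)))(q := (s(r := butlast (s r))) q @ [last (s r)]))"
  using assms top_of_le[OF assms] top_of_pos[OF assms]
  by (auto simp: move_top_def sem_case_top) (auto simp: top_of_def)

lemma sem_move_all:
  assumes "set (s r) \<subseteq> {1..16}" "r \<noteq> q" "length (s r) \<le> length (s 3)"
  shows "sem (move_all r q) s = s(r := [], q := s q @ rev (s r))"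
proof -
  have "(sem (move_top r q) ^^ n) s = s(r := [], q := s q @ rev (s r))"
    if "set (s r) \<subseteq> {1..16}" "length (s r) \<le> n" for n s
    using that
  proof (induction n arbitrary: s)
    case 0
    then show ?case using assms(2) by (auto simp: fun_eq_iff)
  next
    case (Suc n)
    show ?case
    proof (cases "s r = []")
      case True
      then have "sem (move_top r q) s = s" using Suc.prems(1) by (simp add: sem_move_top)
      then have "(sem (move_top r q) ^^ Suc n) s = s" by (rule funpow_fixpoint)
      then show ?thesis using True by (simp add: fun_upd_idem)
    next
      case False
      let ?s = "s(r := butlast (s r), q := s q @ [last (s r)])"
      have 1: "sem (move_top r q) s = ?s" using False Suc.prems(1) assms(2) by (simp add: sem_move_top)
      have "(sem (move_top r q) ^^ n) ?s = ?s(r := [], q := ?s q @ rev (?s r))"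
        using Suc.prems assms(2) by (intro Suc.IH) (auto dest: in_set_butlastD)
      also have "\<dots> = s(r := [], q := s q @ rev (s r))"
        using assms(2) False by (cases "s r" rule: rev_cases) (auto simp: fun_eq_iff)
      finally show ?thesis by (simp only: funpow_Suc_start 1)
    qed
  qed
  then show ?thesis using assms by (simp add: move_all_def sem_Loop)
qed

text \<open>Registers of the verifier: 0 input, 1 the circuit, 2 the witness, 3 a copy of 1 that bounds inner
  loops, 4 and 5 two stacks that together hold the values of the nodes, 6 mode, 7 operator,
  8 first operand or result, 9 mode of the decoder for pairs, 10 output.\<close>

definition set_mode :: "nat \<Rightarrow> com" where
  "set_mode m = Pop 6 ;; Push 6 m"

text \<open>The two stacks form a zipper: register 4 holds the values before the current position
  and register 5 the others in reverse, so the addressed value is on top of register 5. In mode 6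
  the result is first parked on top of the operand in register 8, appended once all values are in
  register 4, and then both symbols of register 8 are dropped.\<close>

definition read_operand :: "bool \<Rightarrow> nat \<Rightarrow> com" where
  "read_operand b m =
     (if b then move_top 5 4
      else if m = 5 then
        case_top 5 (\<lambda>v. if v = 0 then Skip else Push 8 v) 16 ;; move_all 4 5 ;; set_mode 6
      else if m = 6 then
        case_top 5 (\<lambda>v. case_top 8 (\<lambda>a. IfTop 7 1 (Push 8 (packed_op 1 a v)) (Push 8 (packed_op 2 a v))) 16) 16 ;;
        move_all 5 4 ;; case_top 8 (\<lambda>v. if v = 0 then Skip else Push 4 v) 16 ;; move_all 4 5 ;;
        Pop 8 ;; Pop 8 ;; Pop 7 ;; set_mode 2
      else case_top 5 (\<lambda>v. if v = 0 then Skip else Push 8 v) 16 ;; set_mode 9)"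

definition read_input :: com where
  "read_input = case_top 2 (\<lambda>y. Pop 2 ;;
     case_top 2 (\<lambda>z. Pop 2 ;; Push 4 (pack (\<lambda>k. of_bool (odd k \<and> y = 2) + of_bool (2 \<le> k \<and> z = 2)))) 2) 2"

definition parser_body :: "bool \<Rightarrow> com" where
  "parser_body b = case_top 6 (\<lambda>m.
     if m = 1 then if b then read_input else move_all 4 5 ;; set_mode 2
     else if m = 2 then set_mode (if b then 4 else 3)
     else if m = 3 then
       if b then move_all 5 4 ;; Push 4 (pack (\<lambda>_. 1)) ;; move_all 4 5 ;; set_mode 2 else set_mode 8
     else if m = 4 then Push 7 (if b then 2 else 1) ;; set_mode 5
     else if m = 5 \<or> m = 6 \<or> m = 8 then IfTop 5 0 (set_mode 10) (read_operand b m)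
     else set_mode 10) 10"

fun represents :: "store \<Rightarrow> pstate \<Rightarrow> bool" where
  "represents s (m, vs, p, q, a, us) \<longleftrightarrow>
     s 4 = take p vs \<and> s 5 = rev (drop p vs) \<and> s 6 = [m] \<and> s 7 = q \<and> s 8 = a \<and> s 2 = us \<and>
     p \<le> length vs \<and> (m = 1 \<longrightarrow> p = length vs) \<and> (m \<in> {2, 3, 4} \<longrightarrow> p = 0) \<and> m \<le> 10 \<and>
     set vs \<subseteq> {1..16} \<and> set a \<subseteq> {1..16} \<and> set us \<subseteq> {1..2}"

lemma sem_set_mode: "s 6 = [m'] \<Longrightarrow> sem (set_mode m) s = s(6 := [m])"
  by (simp add: set_mode_def)

lemma pack_in: "pack f \<in> {1..16}"
  using pack_range[of f] by simp

lemma set_butlast_subset: "set xs \<subseteq> A \<Longrightarrow> set (butlast xs) \<subseteq> A"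
  by (auto dest: in_set_butlastD)

lemma top_of_rev_drop: "top_of (rev (drop p vs)) = (if p < length vs then vs ! p else 0)"
  by (auto simp: top_of_def last_rev hd_drop_conv_nth)

lemma packed_op_other: "q \<noteq> 1 \<Longrightarrow> packed_op q = packed_op 2"
  by (simp add: packed_op_def fun_eq_iff)

lemma sem_read_input:
  assumes "set (s 2) \<subseteq> {1..2}"
  shows "sem read_input s = s(2 := butlast (butlast (s 2)), 4 := s 4 @ [read_code (s 2)])"
  using top_of_le[OF assms] top_of_le[OF set_butlast_subset[OF assms]]
  by (simp add: read_input_def sem_case_top read_code_def)

lemma sem_push_top:
  assumes "set (s r) \<subseteq> {1..16}" "s r \<noteq> []"
  shows "sem (case_top r (\<lambda>v. if v = 0 then Skip else Push q v) 16) s = s(q := s q @ [top_of (s r)])"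
  using top_of_le[OF assms(1)] top_of_pos[OF assms(1)] assms(2) by (simp add: sem_case_top)

text \<open>The strict inequality on \<open>length vs\<close> leaves room for one more value: in
  mode 6 the stacks are moved back together with the new result, and register 3 has to be long
  enough for this move.\<close>

lemma represents_read_operand:
  assumes R: "represents s (m, vs, p, q, a, us)" and len: "length vs < length (s 3)"
    and m: "m \<in> {5, 6, 8}" and p: "p < length vs"
  shows "represents (sem (read_operand b m) s) (pstep b (m, vs, p, q, a, us))"
proof -
  have s: "s 4 = take p vs" "s 5 = rev (drop p vs)" "s 6 = [m]" "s 7 = q" "s 8 = a" "s 2 = us"
    and vs: "set vs \<subseteq> {1..16}" and a: "set a \<subseteq> {1..16}" and us: "set us \<subseteq> {1..2}" using R by auto
  have s5: "set (s 5) \<subseteq> {1..16}" "s 5 \<noteq> []" "top_of (s 5) = vs ! p" "last (s 5) = vs ! p" "butlast (s 5) = rev (drop (Suc p) vs)"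
    using vs p by (auto simp: s top_of_rev_drop last_rev hd_drop_conv_nth drop_Suc drop_tl butlast_rev dest: in_set_dropD)
  have s4: "set (s 4) \<subseteq> {1..16}" using vs by (auto simp: s dest: in_set_takeD)
  have vp: "vs ! p \<in> {1..16}" using nth_mem[OF p] vs by blast
  have rest: "rev (drop p vs) @ rev (take p vs) = rev vs" "take p vs @ drop p vs = vs"
    by (simp_all flip: rev_append)
  consider "b" | "\<not> b" "m = 5" | "\<not> b" "m = 6" | "\<not> b" "m = 8" using m by blast
  then show ?thesis
  proof cases
    case 1
    then have "sem (read_operand b m) s = s(5 := rev (drop (Suc p) vs), 4 := take p vs @ [vs ! p])"
      using s5 by (simp add: read_operand_def sem_move_top s)
    then show ?thesis using R m p 1 by (auto simp: take_Suc_conv_app_nth)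
  next
    case 2
    have "sem (read_operand b m) s = s(8 := a @ [vs ! p], 4 := [], 5 := rev vs, 6 := [6])"
      using 2 s5 s4 len p rest by (simp add: read_operand_def sem_push_top sem_move_all sem_set_mode s)
    then show ?thesis using R 2 p vp by auto
  next
    case 3
    let ?v = "packed_op (top_of q) (top_of a) (vs ! p)"
    have v: "?v \<in> {1..16}" unfolding packed_op_def by (rule pack_in)
    have "sem (case_top 5 (\<lambda>v. case_top 8 (\<lambda>a. IfTop 7 1 (Push 8 (packed_op 1 a v)) (Push 8 (packed_op 2 a v))) 16) 16) s
        = s(8 := a @ [?v])"
      using top_of_le[OF s5(1)] top_of_le[OF a] packed_op_other[of "top_of q"] s5(3)
      by (auto simp: sem_case_top s)
    then have "sem (read_operand b m) s = s(8 := butlast a, 4 := [], 5 := rev (vs @ [?v]), 7 := butlast q, 6 := [2])"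
      using 3 s5(1) s4 len p rest v a vs
      by (simp add: read_operand_def sem_push_top sem_move_all sem_set_mode s top_of_def[of "_ @ _"] butlast_append fun_eq_iff)
    then show ?thesis using R 3 p v by (auto dest: in_set_butlastD)
  next
    case 4
    have "sem (read_operand b m) s = s(8 := a @ [vs ! p], 6 := [9])"
      using 4 s5 by (simp add: read_operand_def sem_push_top sem_set_mode s)
    then show ?thesis using R 4 p vp by auto
  qed
qed

lemma represents_step:
  assumes R: "represents s (m, vs, p, q, a, us)" and len: "length vs < length (s 3)"
  shows "represents (sem (parser_body b) s) (pstep b (m, vs, p, q, a, us))"
proof -
  have s: "s 4 = take p vs" "s 5 = rev (drop p vs)" "s 6 = [m]" "s 7 = q" "s 8 = a" "s 2 = us"
    and m: "m \<le> 10" and vs: "set vs \<subseteq> {1..16}" and us: "set us \<subseteq> {1..2}" using R by auto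
  have pb: "sem (parser_body b) s = sem (
     if m = 1 then if b then read_input else move_all 4 5 ;; set_mode 2
     else if m = 2 then set_mode (if b then 4 else 3)
     else if m = 3 then
       if b then move_all 5 4 ;; Push 4 (pack (\<lambda>_. 1)) ;; move_all 4 5 ;; set_mode 2 else set_mode 8
     else if m = 4 then Push 7 (if b then 2 else 1) ;; set_mode 5
     else if m = 5 \<or> m = 6 \<or> m = 8 then IfTop 5 0 (set_mode 10) (read_operand b m)
     else set_mode 10) s" for b
    unfolding parser_body_def using m by (subst sem_case_top) (simp_all add: s)
  consider "m = 1" | "m = 2" | "m = 3" | "m = 4" | "m \<in> {5, 6, 8}" "p < length vs" |
     "m \<in> {5, 6, 8}" "length vs \<le> p" | "m \<notin> {1, 2, 3, 4, 5, 6, 8}"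
    using linorder_not_less[of p "length vs"] by blast
  then show ?thesis
  proof cases
    case 1
    then have p: "p = length vs" using R by simp
    show ?thesis
    proof (cases b)
      case True
      have "read_code us \<in> {1..16}" unfolding read_code_def by (rule pack_in)
      moreover have "sem (parser_body b) s = s(2 := butlast (butlast us), 4 := take p vs @ [read_code us])"
        unfolding pb using 1 True us by (simp add: sem_read_input s)
      moreover have "set (butlast (butlast us)) \<subseteq> {1..2}" using us by (intro set_butlast_subset)
      ultimately show ?thesis using R 1 p True by auto
    next
      case False
      then have "sem (parser_body b) s = s(4 := [], 5 := rev vs, 6 := [2])"
        using 1 p vs len by (simp add: pb sem_move_all sem_set_mode s)
      then show ?thesis using R 1 p False by auto
    qed
  next
    case 2
    then show ?thesis using R by (auto simp: pb sem_set_mode s)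
  next
    case 3
    then have p: "p = 0" using R by simp
    show ?thesis
    proof (cases b)
      case True
      have "sem (parser_body b) s = s(4 := [], 5 := rev (vs @ [pack (\<lambda>_. 1)]), 6 := [2])"
        using 3 p vs len True pack_in[of "\<lambda>_. 1"] by (simp add: pb sem_move_all sem_set_mode s fun_eq_iff)
      then show ?thesis using R 3 p True pack_in[of "\<lambda>_. 1"] by auto
    next
      case False
      then show ?thesis using R 3 by (auto simp: pb sem_set_mode s)
    qed
  next
    case 4
    then show ?thesis using R by (auto simp: pb sem_set_mode s)
  next
    case 5
    have "vs ! p \<noteq> 0" using nth_mem[OF 5(2)] vs by force
    then have "sem (parser_body b) s = sem (read_operand b m) s"
      using 5 by (auto simp: pb s top_of_rev_drop)
    then show ?thesis using represents_read_operand[OF R len 5] by simp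
  next
    case 6
    then have "sem (parser_body b) s = s(6 := [10])" by (auto simp: pb s top_of_rev_drop sem_set_mode)
    then show ?thesis using R 6 by auto
  next
    case 7
    then have "sem (parser_body b) s = s(6 := [10])" by (auto simp: pb sem_set_mode s)
    then show ?thesis using R 7 by auto
  qed
qed

text \<open>Register 9 is empty when a flag is due. A flag 1 puts 1 there, so the next bit belongs
  to the first component and the register is emptied again; the flag 0 puts 2 there, and all
  remaining bits belong to the witness.\<close>

definition decode_body :: "nat \<Rightarrow> com" where
  "decode_body b = IfTop 9 0 (Push 9 (3 - b))
     (IfTop 9 1 (Push 1 b ;; Push 3 b ;; Pop 9) (Push 2 b))"

definition decode_pair :: com where
  "decode_pair = For 0 (decode_body 1) (decode_body 2)"

definition sum_lanes :: "nat \<Rightarrow> bit" where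
  "sum_lanes a = lane 0 a + lane 1 a + lane 2 a + lane 3 a"

definition verdict :: com where
  "verdict = IfTop 6 9 (case_top 8 (\<lambda>a. Push 10 (if sum_lanes a = 1 then 2 else 1)) 16) (Push 10 2)"

definition verifier :: com where
  "verifier = decode_pair ;; Push 6 1 ;; For 1 (parser_body False) (parser_body True) ;; verdict"

section \<open>Well-formedness and running time of the verifier\<close>

lemma pack_less: "pack f < 17"
  using pack_range(2)[of f] by simp

lemma packed_op_range: "0 < packed_op q a b" "packed_op q a b < 17"
  unfolding packed_op_def by (rule pack_range pack_less)+

lemma regs_move_top: "regs (move_top r q) \<subseteq> {r, q}"
  unfolding move_top_def by (rule regs_case_topI) auto

lemma regs_move_all: "regs (move_all r q) \<subseteq> {3, r, q}"
  unfolding move_all_def using regs_move_top[of r q] by auto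

lemma regs_read_input: "regs read_input \<subseteq> {2, 4}"
proof -
  have "regs (case_top 2 (\<lambda>z. Pop 2 ;; Push 4 (f z)) 2) \<subseteq> {2, 4}" for f
    by (rule regs_case_topI) auto
  then show ?thesis unfolding read_input_def by (intro regs_case_topI) auto
qed

lemma regs_read_operand: "regs (read_operand b m) \<subseteq> {3, 4, 5, 6, 7, 8}"
proof -
  have "regs (case_top r (\<lambda>v. if v = 0 then Skip else Push q v) 16) \<subseteq> {r, q}" for r q
    by (rule regs_case_topI) auto
  moreover have "regs (case_top 5 (\<lambda>v. case_top 8
      (\<lambda>a. IfTop 7 1 (Push 8 (packed_op 1 a v)) (Push 8 (packed_op 2 a v))) 16) 16) \<subseteq> {5, 7, 8}"
    by (intro regs_case_topI) auto
  ultimately show ?thesis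
    unfolding read_operand_def set_mode_def using regs_move_top regs_move_all by auto blast+
qed

lemma regs_parser_body: "regs (parser_body b) \<subseteq> {2, 3, 4, 5, 6, 7, 8}"
proof -
  have "regs (read_operand b m) \<subseteq> {2, 3, 4, 5, 6, 7, 8}" for m
    using regs_read_operand[of b m] by auto
  then show ?thesis
    unfolding parser_body_def
    using regs_move_all[of 4 5] regs_move_all[of 5 4] regs_read_input
    by (intro regs_case_topI) (auto simp: set_mode_def subset_iff)
qed

lemma not_in_regs_parser_body: "r \<notin> {2, 3, 4, 5, 6, 7, 8} \<Longrightarrow> r \<notin> regs (parser_body b)"
  using regs_parser_body[of b] by blast

text \<open>Register 3 occurs in the parser only as a loop bound; its absence here guarantees that
  it keeps its length throughout.\<close>

lemma writes_parser_body: "writes (parser_body b) \<subseteq> {2, 4, 5, 6, 7, 8}"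
proof -
  have mt: "writes (move_top r q) \<subseteq> {r, q}" for r q
    using writes_subset_regs[of "move_top r q"] regs_move_top[of r q] by blast
  have ma: "writes (move_all r q) \<subseteq> {r, q}" for r q
    using mt[of r q] by (simp add: move_all_def Loop_def)
  have ct: "writes (case_top r (\<lambda>v. if v = 0 then Skip else Push q v) 16) \<subseteq> {q}" for r q
    by (rule writes_case_topI) auto
  have op: "writes (case_top 5 (\<lambda>v. case_top 8
      (\<lambda>a. IfTop 7 1 (Push 8 (packed_op 1 a v)) (Push 8 (packed_op 2 a v))) 16) 16) \<subseteq> {8}"
    by (intro writes_case_topI) auto
  have ri: "writes read_input \<subseteq> {2, 4}"
    using writes_subset_regs[of read_input] regs_read_input by blast
  have ro: "writes (read_operand b m) \<subseteq> {2, 4, 5, 6, 7, 8}" for m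
    unfolding read_operand_def set_mode_def
    using mt[of 5 4] ma[of 4 5] ma[of 5 4] ct[of 5 8] ct[of 8 4] op by auto
  show ?thesis
    unfolding parser_body_def set_mode_def
    using ma[of 4 5] ma[of 5 4] ri ro
    by (intro writes_case_topI) (auto simp: subset_iff)
qed

lemma wfc_verifier: "wfc 11 17 verifier"
proof -
  have mt: "wfc 11 17 (move_top r q)" if "r < 11" "q < 11" for r q
    unfolding move_top_def using that by (intro wfc_case_top) auto
  have ma: "wfc 11 17 (move_all r q)" if "r < 11" "q < 11" "r \<noteq> 3" "q \<noteq> 3" for r q
    using that mt regs_move_top[of r q] by (auto simp: move_all_def)
  have ct: "wfc 11 17 (case_top r (\<lambda>v. if v = 0 then Skip else Push q v) 16)" if "r < 11" "q < 11" for r q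
    using that by (intro wfc_case_top) auto
  have op: "wfc 11 17 (case_top 5 (\<lambda>v. case_top 8
      (\<lambda>a. IfTop 7 1 (Push 8 (packed_op 1 a v)) (Push 8 (packed_op 2 a v))) 16) 16)"
    by (intro wfc_case_top) (simp_all add: packed_op_range)
  have ri: "wfc 11 17 (case_top 2 (\<lambda>z. Pop 2 ;; Push 4 (pack (f z))) 2)" for f
    by (intro wfc_case_top) (simp_all add: pack_range pack_less)
  have ri: "wfc 11 17 read_input"
    unfolding read_input_def by (intro wfc_case_top) (simp_all add: ri)
  have ro: "wfc 11 17 (read_operand b m)" for b m
    unfolding read_operand_def set_mode_def using mt ma ct op by simp
  have pb: "wfc 11 17 (parser_body b)" for b
    unfolding parser_body_def using ma ri ro
    by (intro wfc_case_top) (simp_all add: set_mode_def pack_range pack_less)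
  have v: "wfc 11 17 verdict"
    unfolding verdict_def by (simp, intro wfc_case_top) simp_all
  show ?thesis using pb v
    by (simp add: verifier_def decode_pair_def decode_body_def not_in_regs_parser_body)
qed

lemma poly_time_verifier: "poly_time verifier"
\<comment> \<open>Each phase pushes one level above the registers that it loops over: the decoder
  loops over the input and fills the registers 1, 2, 3 and 9; the parser loops over 1 and 3 and
  fills the others.\<close>
proof (rule poly_time_lvok[where L = 3 and
        lv = "\<lambda>r. if r = 0 then 0 else if r \<in> {1, 2, 3, 9} then 1 else 2"])
  define lv where "lv = (\<lambda>q :: nat option. case q of None \<Rightarrow> 3 | Some r \<Rightarrow>
    (if r = 0 then 0 else if r \<in> {1, 2, 3, 9} then 1 else (2 :: nat)))"
  have lv: "lv None = Suc (Suc (Suc 0))" "lv (Some 0) = 0" "lv (Some (Suc 0)) = Suc 0" "lv (Some 2) = Suc 0"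
    "lv (Some 3) = Suc 0" "lv (Some 9) = Suc 0" "lv (Some 4) = Suc (Suc 0)" "lv (Some 5) = Suc (Suc 0)"
    "lv (Some 6) = Suc (Suc 0)" "lv (Some 7) = Suc (Suc 0)" "lv (Some 8) = Suc (Suc 0)" "lv (Some 10) = Suc (Suc 0)"
    by (simp_all add: lv_def)
  have mt: "lvok lv (Suc (Suc 0)) (move_top 4 5)" "lvok lv (Suc (Suc 0)) (move_top 5 4)"
    unfolding move_top_def by (rule lvok_case_top, simp add: lv)+
  have ma: "lvok lv (Suc (Suc 0)) (move_all 4 5)" "lvok lv (Suc (Suc 0)) (move_all 5 4)"
    unfolding move_all_def using mt by (simp_all add: lv)
  have ct: "lvok lv (Suc (Suc 0)) (case_top 5 (\<lambda>v. if v = 0 then Skip else Push 8 v) 16)"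
    "lvok lv (Suc (Suc 0)) (case_top 8 (\<lambda>v. if v = 0 then Skip else Push 4 v) 16)"
    "lvok lv (Suc (Suc 0)) (case_top 5 (\<lambda>v. case_top 8
      (\<lambda>a. IfTop 7 1 (Push 8 (packed_op 1 a v)) (Push 8 (packed_op 2 a v))) 16) 16)"
    by (intro lvok_case_top, simp add: lv)+
  have ri: "lvok lv (Suc (Suc 0)) (case_top 2 (\<lambda>z. Pop 2 ;; Push 4 (f z)) 2)" for f
    by (intro lvok_case_top) (simp add: lv)
  have ri: "lvok lv (Suc (Suc 0)) read_input"
    unfolding read_input_def by (intro lvok_case_top) (simp add: ri)
  have ro: "lvok lv (Suc (Suc 0)) (read_operand b m)" for b m
    unfolding read_operand_def set_mode_def using mt ma ct by (simp add: lv)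
  have "lvok lv (Suc (Suc 0)) (parser_body b)" for b
    unfolding parser_body_def using ri ro ma by (intro lvok_case_top) (simp add: set_mode_def lv)
  moreover have "lvok lv 0 verdict"
    unfolding verdict_def by (simp, intro conjI lvok_case_top) (simp_all add: lv)
  ultimately have "lvok lv 0 verifier"
    by (simp add: verifier_def decode_pair_def decode_body_def lv)
  then show "lvok (\<lambda>q. case q of None \<Rightarrow> 3 | Some r \<Rightarrow> (if r = 0 then 0 else if r \<in> {1, 2, 3, 9} then 1 else 2)) 0 verifier"
    by (simp only: lv_def)
qed auto

section \<open>What the verifier computes\<close>

lemma sweep_decode_u:
  "s 9 = [2] \<Longrightarrow> sweep (decode_body 1) (decode_body 2) (map bit_symbol u) s = s(2 := s 2 @ map bit_symbol u)"
  by (induction u arbitrary: s) (auto simp: decode_body_def top_of_def bit_symbol_def)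

lemma sweep_decode_x:
  "s 9 = [] \<Longrightarrow>
   sweep (decode_body 1) (decode_body 2) (map bit_symbol (concat (map (\<lambda>b. [True, b]) x))) s =
   s(1 := s 1 @ map bit_symbol x, 3 := s 3 @ map bit_symbol x)"
  by (induction x arbitrary: s) (auto simp: decode_body_def top_of_def bit_symbol_def fun_eq_iff)

lemma sem_decode_pair:
  "sem decode_pair (input_store (pair_string x u)) =
   (input_store (pair_string x u))(1 := map bit_symbol x, 3 := map bit_symbol x, 2 := map bit_symbol u, 9 := [2])"
proof -
  let ?s = "input_store (pair_string x u)"
  have "sem decode_pair ?s = sweep (decode_body 1) (decode_body 2) (map bit_symbol u)
     (sem (decode_body 1) (sweep (decode_body 1) (decode_body 2) (map bit_symbol (concat (map (\<lambda>b. [True, b]) x))) ?s))"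
    by (simp add: decode_pair_def input_store_def pair_string_def bit_symbol_def del: One_nat_def)
  also have "\<dots> = ?s(1 := map bit_symbol x, 3 := map bit_symbol x, 2 := map bit_symbol u, 9 := [2])"
    by (subst sweep_decode_x) (auto simp: input_store_def decode_body_def top_of_def sweep_decode_u fun_eq_iff
        simp del: One_nat_def)
  finally show ?thesis .
qed

lemma input_store_other: "r \<noteq> 0 \<Longrightarrow> input_store x r = []"
  by (simp add: input_store_def)

lemma length_pstep: "length (fst (snd (pstep b st))) \<le> Suc (length (fst (snd st)))"
  by (cases st) auto

text \<open>A bit adds at most one node, and register 3 contains a symbol for every bit of the
  circuit, so it always exceeds the number of nodes found before the current bit.\<close>

lemma represents_fold:
  assumes "represents s st" "length (fst (snd st)) + length w \<le> length (s 3)"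
  shows "represents (sweep (parser_body False) (parser_body True) (map bit_symbol w) s) (fold pstep w st)"
  using assms
proof (induction w arbitrary: s st)
  case (Cons b w)
  obtain m vs p q a us where st: "st = (m, vs, p, q, a, us)" using prod_cases6 by blast
  have 1: "represents (sem (parser_body b) s) (pstep b st)"
    using represents_step[of s m vs p q a us b] Cons.prems by (simp add: st del: represents.simps pstep.simps)
  have 2: "sem (parser_body b) s 3 = s 3" for b
    using writes_parser_body[of b] by (intro sem_unwritten) auto
  have "length (fst (snd (pstep b st))) + length w \<le> length (sem (parser_body b) s 3)"
    using length_pstep[of b st] Cons.prems(2) by (simp add: 2)
  from Cons.IH[OF 1 this] show ?case by (cases b) (simp_all add: bit_symbol_def)
qed simp

lemma sem_verdict:
  assumes "s 6 = [m]" "s 8 = a" "set a \<subseteq> {1..16}" "s 10 = []"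
  shows "sem verdict s 10 = (if m = 9 then [if sum_lanes (top_of a) = 1 then 2 else 1] else [2])"
  using top_of_le[OF assms(3)] assms by (simp add: verdict_def sem_case_top)

lemma sem_verifier:
  assumes "length u = 2 * length x"
  shows "sem verifier (input_store (pair_string x u)) 10 = [2] \<longleftrightarrow>
    (case fold pstep x (pinit (map bit_symbol u)) of (m, vs, p, q, a, us) \<Rightarrow>
       m = 9 \<longrightarrow> sum_lanes (top_of a) = 1)"
proof -
  let ?s = "((input_store (pair_string x u))(1 := map bit_symbol x, 3 := map bit_symbol x, 2 := map bit_symbol u, 9 := [2]))
     (6 := [1])"
  let ?t = "sweep (parser_body False) (parser_body True) (map bit_symbol x) ?s"
  obtain m vs p q a us where st: "fold pstep x (pinit (map bit_symbol u)) = (m, vs, p, q, a, us)"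
    using prod_cases6 by blast
  have "represents ?s (pinit (map bit_symbol u))"
    by (auto simp: pinit_def input_store_def bit_symbol_def)
  then have R: "represents ?t (m, vs, p, q, a, us)"
    unfolding st[symmetric] by (rule represents_fold) (simp add: pinit_def)
  have t10: "?t 10 = []"
  proof -
    have "sweep (parser_body False) (parser_body True) ys s 10 = s 10" for ys s
      by (induction ys arbitrary: s) (auto simp: sem_unchanged not_in_regs_parser_body)
    then show ?thesis by (simp add: input_store_def)
  qed
  have "sem verifier (input_store (pair_string x u)) 10 = sem verdict ?t 10"
    by (simp add: verifier_def sem_decode_pair input_store_other del: One_nat_def)
  also have "\<dots> = (if m = 9 then [if sum_lanes (top_of a) = 1 then 2 else 1] else [2])"
    by (rule sem_verdict) (use R t10 in \<open>simp_all only: represents.simps\<close>)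
  finally show ?thesis by (simp add: st)
qed

text \<open>Membership in \<open>class_P\<close> asks for a one-bit answer on every string,
  including those that are not pairs.\<close>

lemma verifier_output: "sem verifier (input_store w) 10 \<in> {[1], [2]}"
proof -
  have "sem verdict s 10 \<in> {s 10 @ [1], s 10 @ [2]}" for s
  proof -
    have "sem (case_top 8 (\<lambda>a. Push 10 (f a)) n) s 10 \<in> (\<lambda>a. s 10 @ [f a]) ` UNIV" for f n
      by (induction n) auto
    from this[of "\<lambda>a. if sum_lanes a = 1 then 2 else 1" 16] show ?thesis
      unfolding verdict_def by (auto split: if_splits)
  qed
  note v = this
  let ?c = "decode_pair ;; Push 6 1 ;; For 1 (parser_body False) (parser_body True)"
  have "sem ?c (input_store w) 10 = []"
    by (subst sem_unchanged)
       (auto simp: decode_pair_def decode_body_def input_store_def not_in_regs_parser_body)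
  moreover have "sem verifier (input_store w) = sem verdict (sem ?c (input_store w))"
    by (simp only: verifier_def sem.simps(4))
  ultimately show ?thesis using v[of "sem ?c (input_store w)"] by (simp only: append_Nil)
qed

lemma verifier_in_P: "{w. sem verifier (input_store w) 10 = [2]} \<in> class_P"
  unfolding class_P_def mem_Collect_eq
proof (rule polytime_computableI[OF wfc_verifier _ _ poly_time_verifier])
  show "11 - 1 \<in> regs verifier" by (simp add: verifier_def verdict_def)
next
  fix x
  show "sem verifier (input_store x) (11 - 1) = map bit_symbol [sem verifier (input_store x) 10 = [2]]"
    using verifier_output[of x] by (auto simp: bit_symbol_def)
qed simp_all

section \<open>AFFINE is in coNP\<close>

lemma lane_input_code:
  assumes "i < n" "n \<le> N" "length u = 2 * N"
  shows "k < 4 \<Longrightarrow> lane k (input_code (map bit_symbol u) i) =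
    of_bool (odd k \<and> u ! (2 * N - 2 * i - 1)) + of_bool (2 \<le> k \<and> u ! (2 * N - 2 * i - 2))"
proof -
  have "top_of (take (Suc j) (map bit_symbol u)) = bit_symbol (u ! j)" if "j < 2 * N" for j
    using that assms(3) by (simp add: top_of_def take_Suc_conv_app_nth)
  from this[of "2 * N - 2 * i - 1"] this[of "2 * N - 2 * i - 2"] show ?thesis if "k < 4"
    using that assms by (simp add: input_code_def lane_pack Suc_diff_Suc bit_symbol_def)
qed

lemma sum_lanes_packed_values:
  assumes "wf_circuit C" "length us' = num_inputs C"
  shows "sum_lanes (packed_values us' (gates C) ! output_node C) =
    circuit_fun C (map (lane 0) us') + circuit_fun C (map (lane 1) us') +
    circuit_fun C (map (lane 2) us') + circuit_fun C (map (lane 3) us')"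
proof -
  have "lane k (packed_values us' (gates C) ! output_node C) = circuit_fun C (map (lane k) us')" if "k < 4" for k
    using lane_packed_values[OF that, of us' "gates C"] assms
    unfolding circuit_fun_def node_values_def
    by (simp add: wf_circuit_def wf_gates_def flip: nth_map)
  then show ?thesis by (simp add: sum_lanes_def)
qed

text \<open>The four lanes are exactly the points of the additivity test, with \<open>y\<close> and
  \<open>z\<close> interleaved from the end of the witness.\<close>

lemma map_lane_inputs:
  assumes "n \<le> N" "length u = 2 * N" "length y = n" "length z = n"
    and y: "\<And>i. i < n \<Longrightarrow> u ! (2 * N - 2 * i - 1) \<longleftrightarrow> y ! i = 1"
    and z: "\<And>i. i < n \<Longrightarrow> u ! (2 * N - 2 * i - 2) \<longleftrightarrow> z ! i = 1"
  shows "map (lane 0) (inputs (map bit_symbol u) n) = replicate n 0"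
    "map (lane 1) (inputs (map bit_symbol u) n) = y"
    "map (lane 2) (inputs (map bit_symbol u) n) = z"
    "map (lane 3) (inputs (map bit_symbol u) n) = map2 (+) y z"
  using assms lane_input_code[OF _ assms(1,2)] by (auto simp: inputs_def intro!: nth_equalityI)

lemma verifier_complement:
  "x \<in> - AFFINE \<longleftrightarrow> (\<exists>u. length u = 2 * length x \<and> sem verifier (input_store (pair_string x u)) 10 = [2])"
proof
  assume "x \<in> - AFFINE"
  then have nA: "x \<notin> AFFINE" by simp
  show "\<exists>u. length u = 2 * length x \<and> sem verifier (input_store (pair_string x u)) 10 = [2]"
  proof (cases "\<exists>C. wf_circuit C \<and> x = encode_circuit C")
    case True
    then obtain C where C: "wf_circuit C" "x = encode_circuit C" by blast
    let ?n = "num_inputs C" and ?f = "circuit_fun C"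
    have "\<not> affine ?n ?f" using nA C by (auto simp: AFFINE_def)
    then obtain y z where yz: "length y = ?n" "length z = ?n"
      and sum: "?f (replicate ?n 0) + ?f y + ?f z + ?f (map2 (+) y z) = 1"
      unfolding affine_iff_additive not_all not_imp bit_not_zero_iff by blast
    define N where "N = length x"
    \<comment> \<open>The number of inputs is written in unary inside \<open>x\<close>, so the
      witness is long enough for two points.\<close>
    have nN: "?n \<le> N" by (simp add: N_def C(2) encode_circuit_def encode_nat_def)
    \<comment> \<open>Counted from the end of the witness, even places carry \<open>y\<close> and
      odd places carry \<open>z\<close>, in the order in which the parser pops them.\<close>
    define u where "u = map (\<lambda>j. let r = 2 * N - 1 - j in
      if even r then y ! (r div 2) = 1 else z ! (r div 2) = 1) [0..<2 * N]"
    have u: "length u = 2 * N" by (simp add: u_def)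
    have uy: "u ! (2 * N - 2 * i - 1) \<longleftrightarrow> y ! i = 1" if "i < ?n" for i
    proof -
      have "2 * N - 1 - (2 * N - 2 * i - 1) = 2 * i" using that nN by simp
      then show ?thesis using that nN by (simp add: u_def Let_def)
    qed
    have uz: "u ! (2 * N - 2 * i - 2) \<longleftrightarrow> z ! i = 1" if "i < ?n" for i
    proof -
      have "2 * N - 1 - (2 * N - 2 * i - 2) = Suc (2 * i)" using that nN by simp
      then show ?thesis using that nN by (simp add: u_def Let_def)
    qed
    have "sum_lanes (packed_values (inputs (map bit_symbol u) ?n) (gates C) ! output_node C) = 1"
      using sum sum_lanes_packed_values[OF C(1), of "inputs (map bit_symbol u) ?n"]
        map_lane_inputs[OF nN u yz uy uz] by (simp only: length_inputs)
    then have "sem verifier (input_store (pair_string x u)) 10 = [2]"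
      using sem_verifier[of u x] u pstep_circuit[OF C(1), of "map bit_symbol u"]
      by (simp add: N_def C(2)[symmetric] Let_def)
    then show ?thesis using u N_def by blast
  next
    case False
    let ?u = "replicate (2 * length x) False"
    obtain m vs p q a us where st: "fold pstep x (pinit (map bit_symbol ?u)) = (m, vs, p, q, a, us)"
      using prod_cases6 by blast
    \<comment> \<open>By the parser invariant, mode 9 would exhibit a well-formed circuit with
      encoding \<open>x\<close>.\<close>
    have "m \<noteq> 9"
    proof
      assume "m = 9"
      then obtain n gs i where gs: "wf_gates n gs" "i < n + length gs"
        "x = header n gs @ [False, False] @ encode_nat i"
        using pinv_fold[of "map bit_symbol ?u" x] unfolding st by auto
      let ?C = "\<lparr>num_inputs = n, gates = gs, output_node = i\<rparr>"
      have "wf_circuit ?C" "x = encode_circuit ?C"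
        using gs by (simp_all add: wf_circuit_def wf_gates_def encode_circuit_def)
      then show False using False by blast
    qed
    then have "sem verifier (input_store (pair_string x ?u)) 10 = [2]"
      using sem_verifier[of ?u x] st by simp
    then show ?thesis by (intro exI[of _ ?u]) simp
  qed
next
  assume "\<exists>u. length u = 2 * length x \<and> sem verifier (input_store (pair_string x u)) 10 = [2]"
  then obtain u where u: "length u = 2 * length x" "sem verifier (input_store (pair_string x u)) 10 = [2]" by blast
  show "x \<in> - AFFINE"
  proof
    assume "x \<in> AFFINE"
    then obtain C where C: "wf_circuit C" "x = encode_circuit C" "affine (num_inputs C) (circuit_fun C)"
      by (auto simp: AFFINE_def)
    let ?n = "num_inputs C" and ?f = "circuit_fun C" and ?N = "length x"
    define y z where "y = map (\<lambda>i. of_bool (u ! (2 * ?N - 2 * i - 1)) :: bit) [0..<?n]"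
      and "z = map (\<lambda>i. of_bool (u ! (2 * ?N - 2 * i - 2)) :: bit) [0..<?n]"
    have nN: "?n \<le> ?N" by (simp add: C(2) encode_circuit_def encode_nat_def)
    have yz: "length y = ?n" "length z = ?n" by (simp_all add: y_def z_def)
    have uy: "u ! (2 * ?N - 2 * i - 1) \<longleftrightarrow> y ! i = 1" if "i < ?n" for i
      using that by (simp add: y_def)
    have uz: "u ! (2 * ?N - 2 * i - 2) \<longleftrightarrow> z ! i = 1" if "i < ?n" for i
      using that by (simp add: z_def)
    have "?f (replicate ?n 0) + ?f y + ?f z + ?f (map2 (+) y z) = 0"
      using C(3) yz unfolding affine_iff_additive by blast
    then have "sum_lanes (packed_values (inputs (map bit_symbol u) ?n) (gates C) ! output_node C) = 0"
      using sum_lanes_packed_values[OF C(1), of "inputs (map bit_symbol u) ?n"]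
        map_lane_inputs[OF nN u(1) yz uy uz] by (simp only: length_inputs)
    then show False
      using sem_verifier[OF u(1)] u(2) pstep_circuit[OF C(1), of "map bit_symbol u"]
      by (simp add: C(2)[symmetric] Let_def)
  qed
qed

theorem AFFINE_in_coNP: "AFFINE \<in> class_coNP"
proof -
  have "x \<in> - AFFINE \<longleftrightarrow> (\<exists>u. length u = poly [:0, 2:] (length x) \<and>
      pair_string x u \<in> {w. sem verifier (input_store w) 10 = [2]})" for x
    using verifier_complement[of x] by (simp add: mult.commute)
  then show ?thesis
    unfolding class_coNP_def class_NP_def using verifier_in_P by blast
qed

section \<open>Circuits for polynomials over the two-element field\<close>

definition vals :: "gate list \<Rightarrow> bit list \<Rightarrow> bit list" where
  "vals gs v = foldl (\<lambda>vs g. vs @ [gate_value vs g]) v gs"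

lemma vals_Nil [simp]: "vals [] v = v"
  by (simp add: vals_def)

lemma vals_Cons [simp]: "vals (g # gs) v = vals gs (v @ [gate_value v g])"
  by (simp add: vals_def)

lemma vals_append [simp]: "vals (gs @ hs) v = vals hs (vals gs v)"
  by (simp add: vals_def)

lemma length_vals [simp]: "length (vals gs v) = length v + length gs"
  by (induction gs arbitrary: v) auto

lemma vals_nth: "i < length v \<Longrightarrow> vals gs v ! i = v ! i"
  by (induction gs arbitrary: v) (auto simp: nth_append)

lemma wf_gates_Nil [simp]: "wf_gates n []"
  by (simp add: wf_gates_def)

lemma wf_gates_append [simp]: "wf_gates n (gs @ hs) \<longleftrightarrow> wf_gates n gs \<and> wf_gates (n + length gs) hs"
proof (induction hs rule: rev_induct)
  case (snoc h hs)
  then show ?case by (simp only: append_assoc[symmetric] wf_gates_snoc) (auto simp: add.assoc)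
qed simp

lemma wf_gates_Cons [simp]: "wf_gates n (g # gs) \<longleftrightarrow> wf_gate n g \<and> wf_gates (Suc n) gs"
  using wf_gates_append[of n "[g]" gs] by (simp add: wf_gates_def)

text \<open>A polynomial is a list of monomials and a monomial is a list of nodes. The gates of \<open>monomial c m\<close>
  multiply node \<open>c\<close>, the last one before them, by the nodes in \<open>m\<close>. Likewise \<open>polynomial c ms\<close> adds
  the value of \<open>ms\<close> to node \<open>c\<close>.\<close>

definition poly_value :: "bit list \<Rightarrow> nat list list \<Rightarrow> bit" where
  "poly_value v ms = (\<Sum>m\<leftarrow>ms. \<Prod>i\<leftarrow>m. v ! i)"

fun monomial :: "nat \<Rightarrow> nat list \<Rightarrow> gate list" where
  "monomial c [] = []"
| "monomial c (i # m) = And_Gate c i # monomial (Suc c) m"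

fun polynomial :: "nat \<Rightarrow> nat list list \<Rightarrow> gate list" where
  "polynomial c [] = []"
| "polynomial c (m # ms) = One_Gate # monomial (Suc c) m @
     Xor_Gate c (Suc c + length m) # polynomial (c + 2 + length m) ms"

definition psize :: "'a list list \<Rightarrow> nat" where
  "psize ms = (\<Sum>m\<leftarrow>ms. length m + 2)"

text \<open>The padding stands in front, so that the value is always at the last of the
  \<open>G\<close> gates. \<open>Xor_Gate 0 0\<close> produces the zero with which the summation
  starts, since the basis has no gate for it.\<close>

definition block :: "nat \<Rightarrow> nat \<Rightarrow> nat list list \<Rightarrow> gate list" where
  "block G a ms = replicate (G - Suc (psize ms)) One_Gate @
     Xor_Gate 0 0 # polynomial (a + (G - Suc (psize ms))) ms"

lemma length_monomial [simp]: "length (monomial c m) = length m"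
  by (induction m arbitrary: c) auto

lemma length_polynomial [simp]: "length (polynomial c ms) = psize ms"
  by (induction ms arbitrary: c) (auto simp: psize_def)

lemma length_block: "psize ms < G \<Longrightarrow> length (block G a ms) = G"
  by (simp add: block_def)

lemma map_nth_append: "\<forall>i\<in>set m. i < length v \<Longrightarrow> map ((!) (v @ w)) m = map ((!) v) m"
  by (auto simp: nth_append)

lemma poly_value_append:
  "\<forall>m\<in>set ms. \<forall>i\<in>set m. i < length v \<Longrightarrow> poly_value (v @ w) ms = poly_value v ms"
  unfolding poly_value_def by (intro arg_cong[of _ _ sum_list] map_cong refl arg_cong[of _ _ prod_list]) (auto simp: nth_append)

lemma vals_prefix: "\<exists>w. vals gs v = v @ w \<and> length w = length gs"
proof (induction gs arbitrary: v)
  case (Cons g gs)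
  from Cons.IH[of "v @ [gate_value v g]"] show ?case by auto
qed simp

lemma last_vals_monomial:
  assumes "length v = Suc c" "\<forall>i\<in>set m. i \<le> c"
  shows "last (vals (monomial c m) v) = v ! c * (\<Prod>i\<leftarrow>m. v ! i)"
  using assms
proof (induction m arbitrary: c v)
  case Nil
  then show ?case by (cases v rule: rev_cases) auto
next
  case (Cons i m)
  let ?v = "v @ [v ! c * v ! i]"
  have "last (vals (monomial (Suc c) m) ?v) = ?v ! Suc c * (\<Prod>i\<leftarrow>m. ?v ! i)"
    using Cons.prems by (intro Cons.IH) auto
  moreover have "map ((!) ?v) m = map ((!) v) m"
    using Cons.prems by (intro map_nth_append) auto
  moreover have "?v ! Suc c = v ! c * v ! i" using Cons.prems(1) by (simp add: nth_append)
  ultimately show ?case by (simp only: monomial.simps vals_Cons gate_value.simps list.map prod_list.Cons mult.assoc)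
qed

lemma last_vals_polynomial:
  assumes "length v = Suc c" "\<forall>m\<in>set ms. \<forall>i\<in>set m. i \<le> c"
  shows "last (vals (polynomial c ms) v) = v ! c + poly_value v ms"
  using assms
proof (induction ms arbitrary: c v)
  case Nil
  then show ?case by (cases v rule: rev_cases) (auto simp: poly_value_def)
next
  case (Cons m ms)
  obtain w where w: "vals (monomial (Suc c) m) (v @ [1]) = (v @ [1]) @ w" "length w = length m"
    using vals_prefix[of "monomial (Suc c) m" "v @ [1]"] by auto
  have "last (vals (monomial (Suc c) m) (v @ [1])) = (v @ [1]) ! Suc c * (\<Prod>i\<leftarrow>m. (v @ [1]) ! i)"
    using Cons.prems by (intro last_vals_monomial) (auto intro: le_SucI)
  moreover have "map ((!) (v @ [1])) m = map ((!) v) m"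
    using Cons.prems by (intro map_nth_append) auto
  ultimately have 1: "last ((v @ [1]) @ w) = (\<Prod>i\<leftarrow>m. v ! i)"
    using Cons.prems(1) w(1) by (simp only:) (simp add: nth_append)
  have 2: "((v @ [1]) @ w) ! (Suc c + length m) = last ((v @ [1]) @ w)"
    using Cons.prems(1) w(2) by (subst last_conv_nth) auto
  have 3: "((v @ [1]) @ w) ! c = v ! c" using Cons.prems(1) by (simp add: nth_append)
  let ?v = "((v @ [1]) @ w) @ [v ! c + (\<Prod>i\<leftarrow>m. v ! i)]"
  have "vals (polynomial c (m # ms)) v = vals (polynomial (c + 2 + length m) ms) ?v"
    by (simp only: polynomial.simps vals_Cons vals_append gate_value.simps w(1) 1 2 3)
  also have "last \<dots> = ?v ! (c + 2 + length m) + poly_value ?v ms"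
  proof (rule Cons.IH)
    show "length ?v = Suc (c + 2 + length m)" using Cons.prems(1) w(2) by simp
    show "\<forall>m'\<in>set ms. \<forall>i\<in>set m'. i \<le> c + 2 + length m" using Cons.prems(2) by force
  qed
  also have "?v ! (c + 2 + length m) = v ! c + (\<Prod>i\<leftarrow>m. v ! i)"
    using Cons.prems(1) w(2) by (simp add: nth_append)
  also have "poly_value ?v ms = poly_value v ms"
    using Cons.prems unfolding append_assoc by (intro poly_value_append) (auto simp: less_Suc_eq_le)
  finally show ?case by (simp only: poly_value_def list.map sum_list.Cons add.assoc)
qed

lemma last_vals_block:
  assumes "psize ms < G" "length v = a" "0 < a" "\<forall>m\<in>set ms. \<forall>i\<in>set m. i < a"
  shows "vals (block G a ms) v ! (a + G - 1) = poly_value v ms"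
proof -
  let ?k = "G - Suc (psize ms)"
  obtain w where w: "vals (replicate ?k One_Gate) v = v @ w" "length w = ?k"
    using vals_prefix[of "replicate ?k One_Gate" v] by auto
  let ?v = "(v @ w) @ [(v @ w) ! 0 + (v @ w) ! 0]"
  have "vals (block G a ms) v = vals (polynomial (a + ?k) ms) ?v"
    by (simp only: block_def vals_append vals_Cons gate_value.simps w(1))
  moreover have "last (vals (polynomial (a + ?k) ms) ?v) = ?v ! (a + ?k) + poly_value ?v ms"
  proof (rule last_vals_polynomial)
    show "\<forall>m\<in>set ms. \<forall>i\<in>set m. i \<le> a + ?k" using assms(4) by (meson less_imp_le trans_le_add1)
  qed (use assms(2) w(2) in simp)
  moreover have "?v ! (a + ?k) = 0" using assms(2) w(2) by (simp add: nth_append)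
  moreover have "poly_value ?v ms = poly_value v ms"
    using assms unfolding append_assoc by (intro poly_value_append) auto
  moreover have "last (vals (block G a ms) v) = vals (block G a ms) v ! (a + G - 1)"
  proof (subst last_conv_nth)
    have l: "length (vals (block G a ms) v) = a + G" using assms(2) length_block[OF assms(1), of a] by simp
    show "vals (block G a ms) v \<noteq> []"
    proof
      assume "vals (block G a ms) v = []"
      then show False using l assms(3) by (simp del: length_vals)
    qed
    show "vals (block G a ms) v ! (length (vals (block G a ms) v) - 1) = vals (block G a ms) v ! (a + G - 1)"
      by (simp only: l)
  qed
  ultimately show ?thesis by (metis add_0)
qed

lemma wf_monomial: "\<forall>i\<in>set m. i \<le> c \<Longrightarrow> wf_gates (Suc c) (monomial c m)"
  by (induction m arbitrary: c) (auto intro: le_SucI simp: less_Suc_eq_le)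

lemma wf_polynomial: "\<forall>m\<in>set ms. \<forall>i\<in>set m. i \<le> c \<Longrightarrow> wf_gates (Suc c) (polynomial c ms)"
proof (induction ms arbitrary: c)
  case (Cons m ms)
  have "wf_gates (Suc (Suc c)) (monomial (Suc c) m)"
    using Cons.prems by (intro wf_monomial) (auto intro: le_SucI)
  moreover have "wf_gates (Suc (c + 2 + length m)) (polynomial (c + 2 + length m) ms)"
    using Cons.prems by (intro Cons.IH) (force)
  ultimately show ?case by simp
qed simp

lemma wf_block:
  assumes "0 < a" "\<forall>m\<in>set ms. \<forall>i\<in>set m. i < a"
  shows "wf_gates a (block G a ms)"
proof -
  have "wf_gates n (replicate k One_Gate)" for n k
    by (simp add: wf_gates_def)
  moreover have "wf_gates (Suc (a + k)) (polynomial (a + k) ms)" for k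
    using assms by (intro wf_polynomial) force
  ultimately show ?thesis using assms(1) by (simp add: block_def)
qed

section \<open>Programs that emit circuits\<close>

definition pushes :: "nat \<Rightarrow> nat list \<Rightarrow> com" where
  "pushes r xs = foldr (\<lambda>a c. Push r a ;; c) xs Skip"

lemma sem_pushes: "sem (pushes r xs) s = s(r := s r @ xs)"
  by (induction xs arbitrary: s) (auto simp: pushes_def)

lemma regs_pushes: "regs (pushes r xs) \<subseteq> {r}"
  by (induction xs) (auto simp: pushes_def)

lemma in_regs_pushes: "q \<in> regs (pushes r xs) \<Longrightarrow> q = r"
  using regs_pushes by blast

lemma wfc_pushes: "r < K \<Longrightarrow> \<forall>a\<in>set xs. 0 < a \<and> a < S \<Longrightarrow> wfc K S (pushes r xs)"
  by (induction xs) (auto simp: pushes_def)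

lemma lvok_pushes: "m \<le> lv (Some r) \<Longrightarrow> lvok lv m (pushes r xs)"
  by (induction xs) (auto simp: pushes_def)

lemma writes_pushes: "writes (pushes r xs) \<subseteq> {r}"
  using writes_subset_regs regs_pushes by blast

text \<open>A node number that depends on the input is split into the length of a register and an
  offset that is fixed in the program.\<close>

type_synonym ref = "nat \<times> nat"

definition addr :: "store \<Rightarrow> ref \<Rightarrow> nat" where
  "addr s x = length (s (fst x)) + snd x"

definition encode_gates :: "gate list \<Rightarrow> nat list" where
  "encode_gates gs = map bit_symbol (concat (map encode_gate gs))"

lemma encode_gates_append [simp]: "encode_gates (gs @ hs) = encode_gates gs @ encode_gates hs"
  by (simp add: encode_gates_def)

lemma encode_gates_Nil [simp]: "encode_gates [] = []"
  by (simp add: encode_gates_def)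

text \<open>The registers in \<open>R\<close> hold node numbers. The output register is not among
  them, so writing output does not change any address.\<close>

locale emitter =
  fixes out :: nat and R :: "nat set"
  assumes out_notin: "out \<notin> R"
begin

definition emit_ref :: "ref \<Rightarrow> com" where
  "emit_ref x = Loop (fst x) (Push out 2) ;; pushes out (replicate (snd x) 2 @ [1])"

text \<open>Independence of \<open>f\<close> from the output register makes the appended texts of
  consecutive commands simply concatenate, all computed from the initial store.\<close>

definition appends :: "com \<Rightarrow> (store \<Rightarrow> nat list) \<Rightarrow> bool" where
  "appends c f \<longleftrightarrow> (\<forall>s. sem c s = s(out := s out @ f s)) \<and> (\<forall>s y. f (s(out := y)) = f s)"

lemma appends_Skip: "appends Skip (\<lambda>_. [])"
  by (simp add: appends_def)

lemma appends_pushes: "appends (pushes out xs) (\<lambda>_. xs)"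
  by (simp add: appends_def sem_pushes)

lemma appends_Seq:
  assumes "appends c f" "appends d g"
  shows "appends (c ;; d) (\<lambda>s. f s @ g s)"
proof -
  have "sem (c ;; d) s = s(out := s out @ f s @ g s)" for s
  proof
    fix r
    have "sem (c ;; d) s r = ((s(out := s out @ f s))(out := (s(out := s out @ f s)) out @ g (s(out := s out @ f s)))) r"
      using assms by (simp add: appends_def)
    also have "\<dots> = (s(out := s out @ f s @ g s)) r"
      using assms(2) by (simp add: appends_def)
    finally show "sem (c ;; d) s r = (s(out := s out @ f s @ g s)) r" .
  qed
  then show ?thesis using assms by (simp add: appends_def)
qed

lemma appends_cong: "appends c f \<Longrightarrow> (\<And>s. f s = g s) \<Longrightarrow> appends c g"
  by (simp add: appends_def)

lemma addr_out: "fst x \<in> R \<Longrightarrow> addr (s(out := y)) x = addr s x"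
  using out_notin by (auto simp: addr_def)

lemma appends_emit_ref:
  assumes "fst x \<in> R"
  shows "appends (emit_ref x) (\<lambda>s. map bit_symbol (encode_nat (addr s x)))"
proof -
  have "(sem (Push out 2) ^^ n) s = s(out := s out @ replicate n 2)" for n s
    by (induction n) (auto simp: replicate_append_same)
  moreover have "fst x \<noteq> out" using assms out_notin by auto
  ultimately have "sem (emit_ref x) s = s(out := s out @ map bit_symbol (encode_nat (addr s x)))" for s
    by (simp add: emit_ref_def sem_Loop sem_pushes addr_def encode_nat_def bit_symbol_def replicate_add)
  then show ?thesis using assms by (simp add: appends_def addr_out)
qed

fun emit_monomial :: "ref \<Rightarrow> ref list \<Rightarrow> com" where
  "emit_monomial (F, c) [] = Skip"
| "emit_monomial (F, c) (x # m) =
     (pushes out [2, 2] ;; emit_ref (F, c) ;; emit_ref x) ;; emit_monomial (F, Suc c) m"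

fun emit_polynomial :: "ref \<Rightarrow> ref list list \<Rightarrow> com" where
  "emit_polynomial (F, c) [] = Skip"
| "emit_polynomial (F, c) (m # ms) = pushes out [1, 2] ;; emit_monomial (F, Suc c) m ;;
     (pushes out [2, 1] ;; emit_ref (F, c) ;; emit_ref (F, Suc c + length m)) ;;
     emit_polynomial (F, c + 2 + length m) ms"

definition emit_block :: "nat \<Rightarrow> ref \<Rightarrow> ref \<Rightarrow> ref list list \<Rightarrow> com" where
  "emit_block G z x ms = pushes out (concat (replicate (G - Suc (psize ms)) [1, 2]) @ [2, 1]) ;;
     emit_ref z ;; emit_ref z ;; emit_polynomial (fst x, snd x + (G - Suc (psize ms))) ms"

fun emit_blocks :: "nat \<Rightarrow> ref \<Rightarrow> ref \<Rightarrow> ref list list list \<Rightarrow> com" where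
  "emit_blocks G z x [] = Skip"
| "emit_blocks G z x (ms # mss) = emit_block G z x ms ;; emit_blocks G z (fst x, snd x + G) mss"

lemma addr_add: "addr s (F, c + k) = addr s (F, c) + k"
  by (simp add: addr_def)

lemma appends_emit_monomial:
  assumes "F \<in> R" "\<forall>x\<in>set m. fst x \<in> R"
  shows "appends (emit_monomial (F, c) m)
    (\<lambda>s. encode_gates (monomial (addr s (F, c)) (map (addr s) m)))"
  using assms(2)
proof (induction m arbitrary: c)
  case Nil
  then show ?case using appends_Skip by simp
next
  case (Cons x m)
  have "appends (emit_monomial (F, Suc c) m)
    (\<lambda>s. encode_gates (monomial (addr s (F, Suc c)) (map (addr s) m)))"
    using Cons by auto
  note appends_Seq[OF appends_Seq[OF appends_pushes appends_Seq[OF appends_emit_ref appends_emit_ref]] this,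
      of "(F, c)" x "[2, 2]"]
  then show ?case
    using assms(1) Cons.prems addr_add[of _ F c 1]
    by (simp, elim appends_cong) (simp add: encode_gates_def bit_symbol_def)
qed

lemma appends_emit_polynomial:
  assumes "F \<in> R" "\<forall>m\<in>set ms. \<forall>x\<in>set m. fst x \<in> R"
  shows "appends (emit_polynomial (F, c) ms)
    (\<lambda>s. encode_gates (polynomial (addr s (F, c)) (map (map (addr s)) ms)))"
  using assms(2)
proof (induction ms arbitrary: c)
  case Nil
  then show ?case using appends_Skip by simp
next
  case (Cons m ms)
  have 1: "appends (emit_polynomial (F, c + 2 + length m) ms)
    (\<lambda>s. encode_gates (polynomial (addr s (F, c + 2 + length m)) (map (map (addr s)) ms)))"
    using Cons by auto
  have 2: "appends (emit_monomial (F, Suc c) m)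
    (\<lambda>s. encode_gates (monomial (addr s (F, Suc c)) (map (addr s) m)))"
    using Cons.prems assms(1) by (intro appends_emit_monomial) auto
  have 3: "appends (pushes out [2, 1] ;; emit_ref (F, c) ;; emit_ref (F, Suc c + length m))
    (\<lambda>s. [2, 1] @ map bit_symbol (encode_nat (addr s (F, c))) @
       map bit_symbol (encode_nat (addr s (F, Suc c + length m))))"
    using assms(1) by (intro appends_Seq appends_pushes appends_emit_ref) auto
  have "appends (emit_polynomial (F, c) (m # ms))
    (\<lambda>s. [1, 2] @ encode_gates (monomial (addr s (F, Suc c)) (map (addr s) m)) @
      ([2, 1] @ map bit_symbol (encode_nat (addr s (F, c))) @
       map bit_symbol (encode_nat (addr s (F, Suc c + length m)))) @
      encode_gates (polynomial (addr s (F, c + 2 + length m)) (map (map (addr s)) ms)))"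
    unfolding emit_polynomial.simps by (intro appends_Seq appends_pushes 1 2 3)
  then show ?case
    using addr_add[of _ F c 1] addr_add[of _ F c "1 + length m"] addr_add[of _ F c "2 + length m"]
    by (elim appends_cong) (simp add: encode_gates_def bit_symbol_def)
qed

lemma appends_emit_block:
  assumes "fst x \<in> R" "fst z \<in> R" "\<forall>m\<in>set ms. \<forall>x\<in>set m. fst x \<in> R"
  shows "appends (emit_block G z x ms)
    (\<lambda>s. concat (replicate (G - Suc (psize ms)) [1, 2]) @ [2, 1] @
      map bit_symbol (encode_nat (addr s z)) @ map bit_symbol (encode_nat (addr s z)) @
      encode_gates (polynomial (addr s x + (G - Suc (psize ms))) (map (map (addr s)) ms)))"
proof -
  have "appends (emit_polynomial (fst x, snd x + (G - Suc (psize ms))) ms)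
    (\<lambda>s. encode_gates (polynomial (addr s (fst x, snd x + (G - Suc (psize ms)))) (map (map (addr s)) ms)))"
    using assms by (intro appends_emit_polynomial) auto
  note appends_Seq[OF appends_pushes appends_Seq[OF appends_emit_ref[OF assms(2)] appends_Seq[OF appends_emit_ref[OF assms(2)] this]],
      of "concat (replicate (G - Suc (psize ms)) [1, 2]) @ [2, 1]"]
  then show ?thesis unfolding emit_block_def
    by (elim appends_cong) (simp add: addr_add)
qed

lemma sem_emit_block:
  assumes "fst x \<in> R" "fst z \<in> R" "addr s z = 0" "\<forall>m\<in>set ms. \<forall>x\<in>set m. fst x \<in> R"
  shows "sem (emit_block G z x ms) s =
    s(out := s out @ encode_gates (block G (addr s x) (map (map (addr s)) ms)))"
proof -
  have 3: "psize (map (map f) ms) = psize ms" for f by (simp add: psize_def o_def)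
  have 5: "map bit_symbol (concat (map encode_gate (replicate n One_Gate))) = concat (replicate n [1, 2])" for n
    by (induction n) (auto simp: bit_symbol_def)
  have "concat (replicate (G - Suc (psize ms)) [1, 2]) @ [2, 1] @
      map bit_symbol (encode_nat (addr s z)) @ map bit_symbol (encode_nat (addr s z)) @
      encode_gates (polynomial (addr s x + (G - Suc (psize ms))) (map (map (addr s)) ms)) =
    encode_gates (block G (addr s x) (map (map (addr s)) ms))"
    unfolding block_def encode_gates_append 3 assms(3)
    unfolding encode_gates_def 5 by (simp add: bit_symbol_def)
  then show ?thesis using appends_emit_block[OF assms(1,2,4)] by (simp add: appends_def)
qed

definition emitted :: "nat list \<Rightarrow> nat \<Rightarrow> gate list \<Rightarrow> store \<Rightarrow> bool" where
  "emitted h n gs s \<longleftrightarrow> s out = h @ encode_gates gs \<and> wf_gates n gs"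

text \<open>The bound on the references of block \<open>i\<close> grows with \<open>i\<close>, so a
  block may use the results of earlier blocks in the same list. The values are stated for the whole
  list of gates, as later gates do not alter earlier nodes.\<close>

theorem sem_emit_blocks:
  assumes "emitted h n gs s" "fst x \<in> R" "fst z \<in> R" "addr s z = 0" "0 < n"
    "\<forall>ms\<in>set mss. \<forall>m\<in>set ms. \<forall>x\<in>set m. fst x \<in> R"
    "addr s x = n + length gs" "\<forall>ms\<in>set mss. psize ms < G"
    "\<And>i m y. i < length mss \<Longrightarrow> m \<in> set (mss ! i) \<Longrightarrow> y \<in> set m \<Longrightarrow> addr s y < addr s x + i * G"
  shows "\<exists>gs'. emitted h n (gs @ gs') (sem (emit_blocks G z x mss) s) \<and> length gs' = length mss * G \<and>
    (\<forall>r. r \<noteq> out \<longrightarrow> sem (emit_blocks G z x mss) s r = s r) \<and>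
    (\<forall>u i. length u = n \<longrightarrow> i < length mss \<longrightarrow>
       vals (gs @ gs') u ! (addr s x + i * G + (G - 1)) =
       poly_value (vals (gs @ gs') u) (map (map (addr s)) (mss ! i)))"
  using assms
proof (induction mss arbitrary: x gs s)
  case Nil
  then show ?case by (intro exI[of _ "[]"]) simp
next
  case (Cons ms mss)
  let ?a = "n + length gs" and ?ms = "map (map (addr s)) ms"
  let ?s = "sem (emit_block G z x ms) s"
  define b where "b = block G ?a ?ms"
  have s: "?s = s(out := s out @ encode_gates b)"
    using sem_emit_block[of x z s ms G] Cons.prems by (simp add: b_def)
  have G: "psize ms < G" using Cons.prems(8) by simp
  have "psize ?ms = psize ms" by (simp add: psize_def o_def)
  then have lb: "length b = G" using G unfolding b_def by (subst length_block) auto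
  have ms: "\<forall>m\<in>set ?ms. \<forall>i\<in>set m. i < ?a" using Cons.prems(9)[of 0] Cons.prems(7) by auto
  have wb: "wf_gates ?a b" using Cons.prems(5) ms unfolding b_def by (intro wf_block) auto
  have addr: "addr ?s y = addr s y" if "fst y \<in> R" for y unfolding s using that by (rule addr_out)
  have x: "addr s (fst x, snd x + G) = addr s x + G" by (simp add: addr_def)
  have nz: "0 < G" using G by simp
  have "emitted h n (gs @ b) ?s" using Cons.prems(1) wb by (simp add: emitted_def s)
  moreover have "addr ?s (fst x, snd x + G) = n + length (gs @ b)"
    using addr[of "(fst x, snd x + G)"] Cons.prems(2,7) lb by (simp add: x)
  moreover have "addr ?s y < addr ?s (fst x, snd x + G) + i * G"
    if "i < length mss" "m \<in> set (mss ! i)" "y \<in> set m" for i m y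
  proof -
    have "fst y \<in> R" using Cons.prems(6) nth_mem[OF that(1)] that(2,3) by auto
    then show ?thesis
      using Cons.prems(9)[of "Suc i" m y] that addr[of y] addr[of "(fst x, snd x + G)"] Cons.prems(2)
      by (simp add: x)
  qed
  ultimately obtain gs' where gs': "emitted h n ((gs @ b) @ gs') (sem (emit_blocks G z (fst x, snd x + G) mss) ?s)"
    "length gs' = length mss * G"
    "\<forall>r. r \<noteq> out \<longrightarrow> sem (emit_blocks G z (fst x, snd x + G) mss) ?s r = ?s r"
    "\<forall>u i. length u = n \<longrightarrow> i < length mss \<longrightarrow>
       vals ((gs @ b) @ gs') u ! (addr ?s (fst x, snd x + G) + i * G + (G - 1)) =
       poly_value (vals ((gs @ b) @ gs') u) (map (map (addr ?s)) (mss ! i))"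
    using Cons.IH[of "gs @ b" ?s "(fst x, snd x + G)"] Cons.prems addr[of z] by auto
  have 1: "vals ((gs @ b) @ gs') u ! (addr s x + i * G + (G - 1)) =
       poly_value (vals ((gs @ b) @ gs') u) (map (map (addr s)) ((ms # mss) ! i))"
    if "length u = n" "i < length (ms # mss)" for u i
  proof (cases i)
    case 0
    obtain w where w: "vals b (vals gs u) = vals gs u @ w" "length w = G"
      using vals_prefix[of b "vals gs u"] lb by auto
    obtain w' where w': "vals ((gs @ b) @ gs') u = (vals gs u @ w) @ w'"
      using vals_prefix[of gs' "vals (gs @ b) u"] w by auto
    have "vals b (vals gs u) ! (?a + G - 1) = poly_value (vals gs u) ?ms"
      unfolding b_def using that ms Cons.prems(5) G
      by (intro last_vals_block) (auto simp: psize_def o_def)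
    moreover have "vals ((gs @ b) @ gs') u ! (?a + G - 1) = vals b (vals gs u) ! (?a + G - 1)"
      using w w' that(1) nz by (simp add: nth_append)
    moreover have "poly_value (vals ((gs @ b) @ gs') u) ?ms = poly_value (vals gs u) ?ms"
      unfolding w' unfolding append_assoc using ms that(1) by (intro poly_value_append) simp
    ultimately show ?thesis using 0 nz Cons.prems(7) by (simp only:) (simp add: add.assoc)
  next
    case (Suc i')
    have eq: "map (map (addr ?s)) (mss ! i') = map (map (addr s)) (mss ! i')"
    proof (intro map_cong refl addr)
      fix m y assume "m \<in> set (mss ! i')" "y \<in> set m"
      moreover have "mss ! i' \<in> set mss" using that Suc by simp
      ultimately show "fst y \<in> R" using Cons.prems(6) by (meson list.set_intros(2))
    qed
    show ?thesis
      using gs'(4)[rule_format, of u i', unfolded eq] that Suc addr[of "(fst x, snd x + G)"] Cons.prems(2)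
      by (simp add: x add.assoc)
  qed
  show ?case
  proof (intro exI[of _ "b @ gs'"] conjI allI impI)
    show "emitted h n (gs @ b @ gs') (sem (emit_blocks G z x (ms # mss)) s)" using gs'(1) by simp
    show "length (b @ gs') = length (ms # mss) * G" using gs'(2) lb by simp
    show "sem (emit_blocks G z x (ms # mss)) s r = s r" if "r \<noteq> out" for r
      using gs'(3) that by (simp add: s)
  qed (use 1 in simp)
qed

section \<open>Well-formedness and levels of the emitting programs\<close>

definition refs_in :: "nat set \<Rightarrow> ref list list list \<Rightarrow> bool" where
  "refs_in A mss \<longleftrightarrow> (\<forall>ms\<in>set mss. \<forall>m\<in>set ms. \<forall>y\<in>set m. fst y \<in> A)"

lemma regs_emit_ref: "fst y \<in> R \<Longrightarrow> regs (emit_ref y) \<subseteq> insert out R"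
  using regs_pushes[of out] by (auto simp: emit_ref_def)

lemma regs_emit_monomial: "F \<in> R \<Longrightarrow> \<forall>y\<in>set m. fst y \<in> R \<Longrightarrow> regs (emit_monomial (F, c) m) \<subseteq> insert out R"
proof (induction m arbitrary: c)
  case (Cons y m)
  then show ?case using regs_emit_ref[of "(F, c)"] regs_emit_ref[of y] regs_pushes[of out "[2, 2]"] by auto
qed simp

lemma regs_emit_polynomial:
  "F \<in> R \<Longrightarrow> \<forall>m\<in>set ms. \<forall>y\<in>set m. fst y \<in> R \<Longrightarrow> regs (emit_polynomial (F, c) ms) \<subseteq> insert out R"
proof (induction ms arbitrary: c)
  case (Cons m ms)
  then show ?case using regs_emit_ref[of "(F, c)"] regs_emit_ref[of "(F, Suc c + length m)"]
      regs_emit_monomial[of F m "Suc c"] by (auto dest!: in_regs_pushes)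
qed simp

lemma regs_emit_blocks:
  "fst x \<in> R \<Longrightarrow> fst z \<in> R \<Longrightarrow> refs_in R mss \<Longrightarrow> regs (emit_blocks G z x mss) \<subseteq> insert out R"
proof (induction mss arbitrary: x)
  case (Cons ms mss)
  then have "regs (emit_block G z x ms) \<subseteq> insert out R"
    using regs_emit_ref[of z] regs_emit_polynomial[of "fst x" ms]
    unfolding emit_block_def regs.simps refs_in_def by (auto dest!: in_regs_pushes)
  then show ?case using Cons by (auto simp: refs_in_def)
qed simp

context
  fixes K S :: nat
  assumes KS: "out < K" "3 \<le> S" "\<And>r. r \<in> R \<Longrightarrow> r < K"
begin

lemma wfc_emit_ref: "fst y \<in> R \<Longrightarrow> wfc K S (emit_ref y)"
  using KS out_notin wfc_pushes[of out K] by (auto simp: emit_ref_def)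

lemma wfc_out: "\<forall>a\<in>set xs. a = 1 \<or> a = 2 \<Longrightarrow> wfc K S (pushes out xs)"
  using KS by (intro wfc_pushes) auto

lemma wfc_emit_monomial: "F \<in> R \<Longrightarrow> \<forall>y\<in>set m. fst y \<in> R \<Longrightarrow> wfc K S (emit_monomial (F, c) m)"
  by (induction m arbitrary: c) (auto intro!: wfc_emit_ref wfc_out)

lemma wfc_emit_polynomial:
  "F \<in> R \<Longrightarrow> \<forall>m\<in>set ms. \<forall>y\<in>set m. fst y \<in> R \<Longrightarrow> wfc K S (emit_polynomial (F, c) ms)"
  by (induction ms arbitrary: c) (auto intro!: wfc_emit_ref wfc_out wfc_emit_monomial)

lemma wfc_emit_blocks:
  "fst x \<in> R \<Longrightarrow> fst z \<in> R \<Longrightarrow> refs_in R mss \<Longrightarrow> wfc K S (emit_blocks G z x mss)"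
  by (induction mss arbitrary: x)
     (auto simp: emit_block_def refs_in_def intro!: wfc_emit_ref wfc_out wfc_emit_polynomial split: if_splits)

end

context
  fixes lv :: "nat option \<Rightarrow> nat" and l :: nat
  assumes lv: "l \<le> lv (Some out)" "lv (Some out) < lv None" "\<And>r. r \<in> R \<Longrightarrow> lv (Some r) < lv (Some out)"
begin

lemma lvok_emit_ref: "fst y \<in> R \<Longrightarrow> lvok lv l (emit_ref y)"
  using lv(1,2) lv(3)[of "fst y"] by (auto simp: emit_ref_def intro!: lvok_pushes)

lemma lvok_out: "lvok lv l (pushes out xs)"
  using lv by (intro lvok_pushes)

lemma lvok_emit_monomial: "F \<in> R \<Longrightarrow> \<forall>y\<in>set m. fst y \<in> R \<Longrightarrow> lvok lv l (emit_monomial (F, c) m)"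
  by (induction m arbitrary: c) (auto intro!: lvok_emit_ref lvok_out)

lemma lvok_emit_polynomial:
  "F \<in> R \<Longrightarrow> \<forall>m\<in>set ms. \<forall>y\<in>set m. fst y \<in> R \<Longrightarrow> lvok lv l (emit_polynomial (F, c) ms)"
  by (induction ms arbitrary: c) (auto intro!: lvok_emit_ref lvok_out lvok_emit_monomial)

lemma lvok_emit_blocks:
  "fst x \<in> R \<Longrightarrow> fst z \<in> R \<Longrightarrow> refs_in R mss \<Longrightarrow> lvok lv l (emit_blocks G z x mss)"
  by (induction mss arbitrary: x)
     (auto simp: emit_block_def refs_in_def intro!: lvok_emit_ref lvok_out lvok_emit_polynomial)

end

end

section \<open>Turing machine configurations\<close>

text \<open>The machine gets a new start state \<open>num_states M\<close>, in which all heads move from cell \<open>-1\<close> to cell 0.\<close>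

locale verifier_machine =
  fixes M :: tm
  assumes wf: "wf_tm M"
begin

abbreviation "k \<equiv> num_tapes M"
abbreviation "Sy \<equiv> num_symbols M"
abbreviation "Q \<equiv> Suc (num_states M)"

text \<open>The new start state and the halting state have ordinary transitions here, so one rule
  describes every step of the tableau.\<close>

definition delta :: "nat \<Rightarrow> nat list \<Rightarrow> nat \<times> (nat \<times> move) list" where
  "delta q rs = (if q = num_states M then (start M, map (\<lambda>r. (r, Right)) rs)
     else if q = halt M then (q, map (\<lambda>r. (r, Stay)) rs) else trans M q rs)"

fun gstep :: "config \<Rightarrow> config" where
  "gstep (q, ts) = (case delta q (map read_tape ts) of (q', acts) \<Rightarrow> (q', map2 act_tape acts ts))"

definition valid :: "config \<Rightarrow> bool" where
  "valid c \<longleftrightarrow> fst c < Q \<and> length (snd c) = k \<and> (\<forall>t\<in>set (snd c). \<forall>i. fst t i < Sy)"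

definition symbols_ok :: "nat list \<Rightarrow> bool" where
  "symbols_ok rs \<longleftrightarrow> length rs = k \<and> (\<forall>r\<in>set rs. r < Sy)"

lemma k_pos: "1 \<le> k" and Sy_ge: "3 \<le> Sy" and start_less: "start M < num_states M" and halt_less: "halt M < num_states M"
  using wf by (auto simp: wf_tm_def)

lemma delta_wf:
  assumes "q < Q" "symbols_ok rs" "delta q rs = (q', acts)"
  shows "q' < num_states M \<and> length acts = k \<and> (\<forall>(s, d)\<in>set acts. s < Sy)"
proof -
  have "case trans M q rs of (q', acts) \<Rightarrow> q' < num_states M \<and> length acts = k \<and> (\<forall>(s, d)\<in>set acts. s < Sy)"
    if "q < num_states M"
  proof -
    have "\<forall>q rs. q < num_states M \<and> length rs = k \<and> (\<forall>r\<in>set rs. r < Sy) \<longrightarrow> (case trans M q rs of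
        (q', acts) \<Rightarrow> q' < num_states M \<and> length acts = k \<and> (\<forall>(s, d)\<in>set acts. s < Sy))"
      using wf unfolding wf_tm_def by (elim conjE) assumption
    from this[THEN spec, THEN spec, of q rs] show ?thesis using that assms(2) by (simp add: symbols_ok_def)
  qed
  then show ?thesis
    using assms start_less halt_less by (auto simp: delta_def symbols_ok_def split: if_splits)
qed

lemma read_symbols_ok: "valid (q, ts) \<Longrightarrow> symbols_ok (map read_tape ts)"
  by (auto simp: valid_def symbols_ok_def)

lemma valid_gstep:
  assumes "valid c"
  shows "valid (gstep c)"
proof -
  obtain q ts where c: "c = (q, ts)" by fastforce
  obtain q' acts where d: "delta q (map read_tape ts) = (q', acts)" by fastforce
  have w: "q' < num_states M" "length acts = k" "\<forall>(s, d)\<in>set acts. s < Sy"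
    using delta_wf[OF _ read_symbols_ok d] assms by (auto simp: c valid_def)
  have "fst (act_tape a t) i < Sy" if "(a, t) \<in> set (zip acts ts)" for a t i
  proof -
    have "fst a < Sy" "\<forall>i. fst t i < Sy"
      using set_zip_leftD[OF that] set_zip_rightD[OF that] w(3) assms by (auto simp: c valid_def)
    then show ?thesis by (cases a; cases t) auto
  qed
  then show ?thesis using w assms by (auto simp: c d valid_def less_SucI)
qed

lemma gstep_step: "q \<noteq> num_states M \<Longrightarrow> gstep (q, ts) = step M (q, ts)"
proof (cases "q = halt M")
  case True
  assume "q \<noteq> num_states M"
  moreover have "map2 act_tape (map (\<lambda>r. (r, Stay)) (map read_tape ts)) ts = ts"
    by (induction ts) (auto simp: act_tape_idle)
  ultimately show ?thesis using True by (simp add: delta_def)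
qed (simp add: delta_def)

text \<open>Cell -1 is blank on every tape. With the heads there, the head cell of the first row is
  a fixed cell separate from those that carry the input.\<close>

definition start_config :: "bool list \<Rightarrow> config" where
  "start_config w = (num_states M, (fst (input_tape w), -1) # replicate (k - 1) (\<lambda>_. 0, -1))"

lemma gstep_start: "gstep (start_config w) = init_config M w"
proof -
  have "map2 act_tape (map (\<lambda>r. (r, Right)) (map read_tape ts)) ts =
      map (\<lambda>t. act_tape (read_tape t, Right) t) ts" for ts
    by (induction ts) auto
  moreover have "map (\<lambda>t. act_tape (read_tape t, Right) t) ((c, -1) # replicate m (d, -1)) =
      (c, 0) # replicate m (d, 0)" for c d :: "int \<Rightarrow> nat" and m
    by simp
  ultimately have "gstep (start_config w) = (start M, (fst (input_tape w), 0) # replicate (k - 1) (\<lambda>_. 0, 0))"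
    unfolding start_config_def gstep.simps delta_def by (simp only: simp_thms if_True case_prod_conv)
  then show ?thesis by (simp add: init_config_def blank_tape_def input_tape_def)
qed

lemma gsteps_steps: "valid c \<Longrightarrow> fst c \<noteq> num_states M \<Longrightarrow> (gstep ^^ t) c = (step M ^^ t) c"
proof (induction t arbitrary: c)
  case (Suc t)
  obtain q ts where c: "c = (q, ts)" by fastforce
  have 1: "gstep c = step M c" using Suc.prems by (simp add: c gstep_step del: gstep.simps step.simps)
  obtain q' acts where d: "delta q (map read_tape ts) = (q', acts)" by fastforce
  have "fst (gstep c) \<noteq> num_states M"
    using delta_wf[OF _ read_symbols_ok d] Suc.prems by (auto simp: c valid_def d)
  from Suc.IH[OF valid_gstep[OF Suc.prems(1)] this] show ?case
    by (simp only: funpow_Suc_start 1)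
qed simp

lemma valid_start: "valid (start_config w)"
  using k_pos Sy_ge by (auto simp: valid_def start_config_def input_tape_def bit_symbol_def)

lemma valid_gsteps: "valid ((gstep ^^ t) (start_config w))"
  by (induction t) (simp_all add: valid_start valid_gstep del: gstep.simps)

lemma gsteps_Suc_steps: "(gstep ^^ Suc t) (start_config w) = (step M ^^ t) (init_config M w)"
proof -
  have "valid (init_config M w)" using valid_gstep[OF valid_start[of w]] by (simp only: gstep_start)
  moreover have "fst (init_config M w) \<noteq> num_states M" using start_less by (simp add: init_config_def)
  ultimately show ?thesis unfolding funpow_Suc_start gstep_start by (rule gsteps_steps)
qed

lemma snd_act_tape: "snd (act_tape a t) = move_head (snd a) (snd t)"
  by (cases a; cases t) auto

text \<open>A head moves by at most one cell per step from cell -1; this determines how much of the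
  tapes the rows have to cover.\<close>

lemma head_gsteps:
  "j < k \<Longrightarrow> \<bar>snd (snd ((gstep ^^ t) (start_config w)) ! j) + 1\<bar> \<le> int t"
proof (induction t)
  case 0
  then show ?case by (cases j) (auto simp: start_config_def)
next
  case (Suc t)
  obtain q ts where c: "(gstep ^^ t) (start_config w) = (q, ts)" by fastforce
  have v: "valid (q, ts)" using valid_gsteps[of t w] by (simp add: c)
  obtain q' acts where d: "delta q (map read_tape ts) = (q', acts)" by fastforce
  have "length acts = k" "length ts = k"
    using delta_wf[OF _ read_symbols_ok[OF v] d] v by (auto simp: valid_def)
  then have "snd (snd ((gstep ^^ Suc t) (start_config w)) ! j) = move_head (snd (acts ! j)) (snd (ts ! j))"
    using Suc.prems by (simp add: c d snd_act_tape)
  moreover have "\<bar>move_head m h - h\<bar> \<le> 1" for m h by (cases m) auto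
  note this[of "snd (acts ! j)" "snd (ts ! j)"]
  moreover have "\<bar>snd (ts ! j) + 1\<bar> \<le> int t" using Suc.IH[OF Suc.prems] by (simp add: c)
  ultimately show ?case by linarith
qed

end

section \<open>The tableau\<close>

lemma prod_list_of_bool: "(\<Prod>x\<leftarrow>xs. of_bool (P x) :: bit) = of_bool (\<forall>x\<in>set xs. P x)"
  by (induction xs) auto

lemma sum_list_select:
  assumes "distinct zs" "z0 \<in> set zs"
  shows "(\<Sum>z\<leftarrow>zs. of_bool (z = z0) * f z :: bit) = f z0"
proof -
  have "(\<Sum>z\<leftarrow>zs. of_bool (z = z0) * f z :: bit) = (\<Sum>z\<in>set zs. of_bool (z = z0) * f z)"
    using assms(1) by (rule sum_list_distinct_conv_sum_set)
  also have "\<dots> = (\<Sum>z\<in>set zs. if z = z0 then f z else 0)"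
    by (intro sum.cong) simp_all
  also have "\<dots> = f z0" using assms(2) by (simp only: sum.delta' List.finite_set if_True sum.delta)
  finally show ?thesis .
qed

lemma sum_list_filter_select:
  assumes "distinct zs" "z0 \<in> set zs"
  shows "(\<Sum>z\<leftarrow>filter R zs. of_bool (z = z0) * f z :: bit) = (if R z0 then f z0 else 0)"
proof (cases "R z0")
  case True
  then show ?thesis using sum_list_select[of "filter R zs" z0 f] assms by (simp only: distinct_filter if_True set_filter mem_Collect_eq simp_thms)
next
  case False
  then have "map (\<lambda>z. of_bool (z = z0) * f z) (filter R zs) = map (\<lambda>_. 0) (filter R zs)"
    by (intro map_cong) auto
  then have "(\<Sum>z\<leftarrow>filter R zs. of_bool (z = z0) * f z :: bit) = (\<Sum>z\<leftarrow>filter R zs. 0)" by (simp only:)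
  then show ?thesis using False by (simp only: sum_list_0 if_False)
qed

text \<open>In unary, \<open>MM\<close> holds the length of the witness and \<open>TT\<close> the
  number of steps; \<open>out\<close> receives the circuit. The numbers below 8 are reserved: 0
  holds the input \<open>x\<close>, 1 to 4 hold node numbers, 5 stays empty so that its offsets are
  absolute node numbers, 6 holds the length of the paired string and 7 the number of cells of a
  row.\<close>

locale tableau = verifier_machine M for M :: tm +
  fixes out MM TT :: nat
  assumes regs_distinct: "8 \<le> MM" "8 \<le> TT" "8 \<le> out" "MM \<noteq> TT" "MM \<noteq> out" "TT \<noteq> out"
begin

sublocale emitter out "{1, 2, 3, 4, 5}"
  using regs_distinct by unfold_locales auto

text \<open>The bits of a cell for tape \<open>j\<close>: \<open>hb j\<close> tells whether the head is here, \<open>sb j a\<close> whether the symbol is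
  \<open>a\<close>, and \<open>ab j a\<close> whether the head is here or further left and reads \<open>a\<close>. Thus the last cell of a
  row knows the symbols that are read.\<close>

definition "w = 2 * Sy + 1"
definition "B = k * w"
definition "hb j = j * w"
definition "sb j a = j * w + 1 + a"
definition "ab j a = j * w + 1 + Sy + a"
definition "zs = List.product [0..<Q] (List.n_lists k [0..<Sy])"
text \<open>A polynomial has at most \<open>length zs + 2\<close> monomials of at most
  \<open>k + 2\<close> factors, and \<open>psize\<close> charges a monomial two gates beyond its
  factors. The last summand makes the inequality strict and leaves room for the initial
  zero.\<close>

definition "G = (length zs + 2) * (k + 4) + 2"

text \<open>A node is referred to by the register that holds the number of the first node of a cell and by the
  number of its block counted from there. Register 1 points to the left neighbour of the cell in the
  previous row, register 2 to the left neighbour in the current row, and register 3 to the last cell of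
  the previous row.\<close>

definition bref :: "nat \<Rightarrow> nat \<Rightarrow> ref" where
  "bref r i = (r, i * G + (G - 1))"

text \<open>The product of these bits is the indicator of state and symbols read being
  \<open>z\<close>. The state bits come after the last cell and one border cell, hence the offset
  \<open>2 * B\<close>.\<close>

definition select :: "nat \<times> nat list \<Rightarrow> ref list" where
  "select z = bref 3 (2 * B + fst z) # map (\<lambda>j. bref 3 (ab j (snd z ! j))) [0..<k]"

definition act :: "nat \<times> nat list \<Rightarrow> nat \<Rightarrow> nat \<times> move" where
  "act z j = snd (delta (fst z) (snd z)) ! j"

text \<open>Where the head came from, relative to the left neighbour: a head that moves right was
  there, one that stays was in the cell itself, one that moves left was in the right
  neighbour.\<close>

definition shift :: "move \<Rightarrow> nat" where
  "shift d = (case d of Left \<Rightarrow> 2 * B | Stay \<Rightarrow> B | Right \<Rightarrow> 0)"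

definition next_head :: "nat \<Rightarrow> ref list list" where
  "next_head j = map (\<lambda>z. select z @ [bref 1 (shift (snd (act z j)) + hb j)]) zs"

text \<open>With h the head bit and s the old symbol bit this is s + hs +
  h[\<open>a\<close> is written], that is (1 + h)s + h[\<open>a\<close> is written]: keep the symbol
  without the head, replace it under the head.\<close>

definition next_symbol :: "nat \<Rightarrow> nat \<Rightarrow> ref list list" where
  "next_symbol j a = [bref 1 (B + sb j a)] # [bref 1 (B + hb j), bref 1 (B + sb j a)] #
     map (\<lambda>z. select z @ [bref 1 (B + hb j)]) (filter (\<lambda>z. fst (act z j) = a) zs)"

text \<open>Register 2 points to the left neighbour, so offset \<open>B\<close> is the cell itself.
  The head is in at most one cell, so the sum never has two summands equal to 1 and works as a
  disjunction.\<close>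

definition accumulate :: "nat \<Rightarrow> nat \<Rightarrow> ref list list" where
  "accumulate j a = [[bref 2 (ab j a)], [bref 2 (B + hb j), bref 2 (B + sb j a)]]"

definition next_state :: "nat \<Rightarrow> ref list list" where
  "next_state q = map select (filter (\<lambda>z. fst (delta (fst z) (snd z)) = q) zs)"

definition cell :: "(nat \<Rightarrow> ref list list) \<Rightarrow> (nat \<Rightarrow> nat \<Rightarrow> ref list list) \<Rightarrow> ref list list list" where
  "cell hf sf = map (\<lambda>i. if i mod w = 0 then hf (i div w)
     else if i mod w \<le> Sy then sf (i div w) (i mod w - 1)
     else accumulate (i div w) (i mod w - 1 - Sy)) [0..<B]"

definition emit_at :: "nat \<Rightarrow> ref list list list \<Rightarrow> com" where
  "emit_at i mss = emit_blocks G (5, 0) (2, i * G) mss"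

definition advance :: "nat \<Rightarrow> nat \<Rightarrow> com" where
  "advance r i = pushes r (replicate (i * G) 1)"

definition emit_cell :: "(nat \<Rightarrow> ref list list) \<Rightarrow> (nat \<Rightarrow> nat \<Rightarrow> ref list list) \<Rightarrow> com" where
  "emit_cell hf sf = emit_at B (cell hf sf) ;; advance 2 B"

definition row_start :: com where
  "row_start = emit_at 0 (replicate B [])"

text \<open>A row is framed by a border cell of zeros on each side, so every proper cell has
  neighbours to refer to; the state bits follow the right border. Afterwards register 2 points to
  the first node of the next row.\<close>

definition row_end :: "(nat \<Rightarrow> ref list list) \<Rightarrow> com" where
  "row_end qf = emit_at B (replicate B []) ;; emit_at (2 * B) (map qf [0..<Q]) ;; advance 2 (2 * B + Q)"

text \<open>Registers 1 and 3 are each moved by one full row: 1 cell by cell while it accompanies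
  the construction, 3 only at the end because it has to stay at the last cell of the old
  row.\<close>

definition next_row :: com where
  "next_row = row_start ;; Loop 7 (emit_cell next_head next_symbol ;; advance 1 B) ;; row_end next_state ;;
     advance 1 (2 * B + Q) ;; Loop 7 (advance 3 B) ;; advance 3 (2 * B + Q)"

definition const_poly :: "bool \<Rightarrow> ref list list" where
  "const_poly b = (if b then [[]] else [])"

definition fixed_symbol :: "nat \<Rightarrow> nat \<Rightarrow> nat \<Rightarrow> ref list list" where
  "fixed_symbol c j a = const_poly (a = (if j = 0 then c else 0))"

text \<open>Register 4 refers to the witness bit u at this cell: symbol 2 is present iff u, symbol 1
  iff 1 + u.\<close>

definition input_symbol :: "nat \<Rightarrow> nat \<Rightarrow> ref list list" where
  "input_symbol j a = (if j = 0 then if a = 2 then [[(4, 0)]] else if a = 1 then [[], [(4, 0)]] else []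
     else const_poly (a = 0))"

definition fixed_cell :: "bool \<Rightarrow> nat \<Rightarrow> com" where
  "fixed_cell b c = emit_cell (\<lambda>_. const_poly b) (fixed_symbol c)"

definition input_cell :: com where
  "input_cell = emit_cell (\<lambda>_. const_poly False) input_symbol ;; Push 4 1"

text \<open>The cells spell the paired string: each bit of \<open>x\<close> after a 1, the
  separating 0, then the witness inputs. The head cell -1 precedes it, and blanks on both sides
  leave space for the head movements.\<close>

definition first_row :: com where
  "first_row = row_start ;; Loop TT (fixed_cell False 0) ;; fixed_cell True 0 ;;
     For 0 (fixed_cell False 2 ;; fixed_cell False 1) (fixed_cell False 2 ;; fixed_cell False 2) ;;
     fixed_cell False 1 ;; Loop MM input_cell ;; Loop TT (fixed_cell False 0) ;;
     row_end (\<lambda>q. const_poly (q = num_states M))"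

text \<open>Nodes 0 and 1 are the inputs \<open>y\<^sub>1\<close> and \<open>y\<^sub>2\<close>, on which the tableau does not depend.\<close>

definition finish :: com where
  "finish = Loop TT (advance 1 B) ;; emit_at 0 [[[bref 1 (2 * B + sb (k - 1) 2), (5, 0), (5, 1)]]] ;;
     pushes out [1, 1] ;; emit_ref (2, G - 1)"

definition emit_tableau :: com where
  "emit_tableau = first_row ;; Loop TT next_row ;; finish"

lemma Sy_pos: "0 < Sy" using Sy_ge by simp

lemma w_pos: "0 < w" by (simp add: w_def)

lemma G_pos: "0 < G" by (simp add: G_def)

lemma index_less_B: "j < k \<Longrightarrow> r < w \<Longrightarrow> j * w + r < B"
proof -
  assume "j < k" "r < w"
  then have "j * w + r < Suc j * w" by simp
  also have "\<dots> \<le> k * w" using \<open>j < k\<close> by (intro mult_right_mono) auto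
  finally show ?thesis by (simp add: B_def)
qed

lemma bit_less_B: "j < k \<Longrightarrow> hb j < B" "j < k \<Longrightarrow> a < Sy \<Longrightarrow> sb j a < B" "j < k \<Longrightarrow> a < Sy \<Longrightarrow> ab j a < B"
  using index_less_B[of j 0] index_less_B[of j "1 + a"] index_less_B[of j "1 + Sy + a"]
  by (auto simp: hb_def sb_def ab_def w_def add.assoc)

lemma length_cell [simp]: "length (cell hf sf) = B"
  by (simp add: cell_def)

lemma mod_div_index: "r < w \<Longrightarrow> (j * w + r) mod w = r \<and> (j * w + r) div w = j"
  using w_pos by simp

lemma cell_nth_eq: "i < B \<Longrightarrow> cell hf sf ! i = (if i mod w = 0 then hf (i div w)
     else if i mod w \<le> Sy then sf (i div w) (i mod w - 1)
     else accumulate (i div w) (i mod w - 1 - Sy))"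
  by (simp add: cell_def cong: if_cong)

lemma cell_nth:
  assumes "j < k"
  shows "cell hf sf ! hb j = hf j"
    "a < Sy \<Longrightarrow> cell hf sf ! sb j a = sf j a"
    "a < Sy \<Longrightarrow> cell hf sf ! ab j a = accumulate j a"
  using bit_less_B[OF assms] mod_div_index[of 0 j] mod_div_index[of "1 + a" j] mod_div_index[of "1 + Sy + a" j] w_pos
  by (auto simp: cell_def hb_def sb_def ab_def w_def add.assoc)

lemma zs_iff: "z \<in> set zs \<longleftrightarrow> fst z < Q \<and> symbols_ok (snd z)"
  by (cases z) (auto simp: zs_def set_n_lists symbols_ok_def)

lemma distinct_zs: "distinct zs"
  unfolding zs_def by (intro distinct_product distinct_n_lists) auto

lemma psize_le: "(\<And>m. m \<in> set ms \<Longrightarrow> length m \<le> l) \<Longrightarrow> psize ms \<le> length ms * (l + 2)"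
proof (induction ms)
  case (Cons m ms)
  have "length m \<le> l" "psize ms \<le> length ms * (l + 2)" using Cons by auto
  then show ?case by (simp add: psize_def)
qed (simp add: psize_def)

lemma psize_less_G: "length ms \<le> length zs + 2 \<Longrightarrow> (\<And>m. m \<in> set ms \<Longrightarrow> length m \<le> k + 2) \<Longrightarrow> psize ms < G"
proof -
  assume l: "length ms \<le> length zs + 2" and "\<And>m. m \<in> set ms \<Longrightarrow> length m \<le> k + 2"
  then have "psize ms \<le> length ms * (k + 2 + 2)" by (intro psize_le)
  also have "\<dots> \<le> (length zs + 2) * (k + 2 + 2)" using l by (rule mult_right_mono) simp
  also have "k + 2 + 2 = k + 4" by simp
  finally show ?thesis unfolding G_def by linarith
qed

lemma length_select [simp]: "length (select z) = k + 1"
  by (simp add: select_def)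

lemma psize_next_head: "psize (next_head j) < G"
  by (rule psize_less_G) (auto simp: next_head_def)

lemma psize_next_symbol: "psize (next_symbol j a) < G"
  by (rule psize_less_G) (auto simp: next_symbol_def)

lemma psize_accumulate: "psize (accumulate j a) < G"
  by (rule psize_less_G) (auto simp: accumulate_def)

lemma psize_next_state: "psize (next_state q) < G"
  by (rule psize_less_G) (auto simp: next_state_def intro: le_trans[OF length_filter_le])

lemma psize_constant: "psize ([] :: ref list list) < G" "psize ([[]] :: ref list list) < G"
  "psize [[y :: ref]] < G" "psize [[], [y :: ref]] < G"
  by (rule psize_less_G; auto)+

end

section \<open>Correctness of the rows\<close>

locale tableau_run = tableau M out MM TT for M :: tm and out MM TT :: nat +
  fixes x :: "bool list" and m T :: nat
begin

text \<open>The inputs are the \<open>m\<close> witness bits and two further ones; \<open>T'\<close>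
  includes the step out of the new start state; \<open>ell\<close> is the length of the paired
  string; cells 1 to \<open>P\<close> cover all cells that a head can reach; \<open>W\<close> is the
  number of nodes in a row.\<close>

definition "n0 = m + 2"
definition "T' = Suc T"
definition "ell = 2 * length x + 1 + m"
definition "P = 2 * T' + 1 + ell"
definition "W = ((P + 2) * B + Q) * G"

definition pos :: "nat \<Rightarrow> int" where
  "pos i = int i - int T' - 2"

definition word :: "bit list \<Rightarrow> bool list" where
  "word u = pair_string x (map (\<lambda>b. b = 1) (drop 2 u))"

definition cfg :: "nat \<Rightarrow> bit list \<Rightarrow> config" where
  "cfg t u = (gstep ^^ t) (start_config (word u))"

definition bv :: "bit list \<Rightarrow> nat \<Rightarrow> nat \<Rightarrow> bit" where
  "bv v L i = v ! (L + i * G + (G - 1))"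

definition pv :: "store \<Rightarrow> bit list \<Rightarrow> ref list list \<Rightarrow> bit" where
  "pv s v ms = (\<Sum>m\<leftarrow>ms. \<Prod>y\<leftarrow>m. v ! addr s y)"

text \<open>In the left border, cell 0, all bits are 0. This is right for the bits about heads,
  which never get that far, but symbols are not represented there; hence the guard
  \<open>1 \<le> i\<close>.\<close>

definition cell_ok :: "bit list \<Rightarrow> nat \<Rightarrow> config \<Rightarrow> nat \<Rightarrow> bool" where
  "cell_ok v L c i \<longleftrightarrow> (\<forall>j<k.
     bv v L (i * B + hb j) = of_bool (snd (snd c ! j) = pos i) \<and>
     (\<forall>a<Sy. bv v L (i * B + ab j a) = of_bool (snd (snd c ! j) \<le> pos i \<and> read_tape (snd c ! j) = a)) \<and>
     (1 \<le> i \<longrightarrow> (\<forall>a<Sy. bv v L (i * B + sb j a) = of_bool (fst (snd c ! j) (pos i) = a))))"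

definition row_ok :: "bit list \<Rightarrow> nat \<Rightarrow> config \<Rightarrow> bool" where
  "row_ok v L c \<longleftrightarrow> (\<forall>i\<le>P. cell_ok v L c i) \<and> (\<forall>j<k. bv v L ((P + 1) * B + hb j) = 0) \<and>
     (\<forall>q<Q. bv v L ((P + 2) * B + q) = of_bool (q = fst c))"

text \<open>The parameters \<open>a\<close>, \<open>f\<close>, \<open>d\<close> and \<open>e\<close>
  are the node numbers held by the registers 1 to 4.\<close>

definition St :: "store \<Rightarrow> gate list \<Rightarrow> nat \<Rightarrow> nat \<Rightarrow> nat \<Rightarrow> nat \<Rightarrow> bool" where
  "St s gs a f d e \<longleftrightarrow> emitted (map bit_symbol (encode_nat n0)) n0 gs s \<and>
     length (s 1) = a \<and> length (s 2) = f \<and> length (s 3) = d \<and> length (s 4) = e \<and> s 5 = [] \<and>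
     s 0 = map bit_symbol x \<and> length (s 7) = P \<and> length (s MM) = m \<and> length (s TT) = T'"

lemma head_range:
  assumes "t \<le> T'" "j < k"
  shows "pos 0 < snd (snd (cfg t u) ! j)" "snd (snd (cfg t u) ! j) \<le> pos P"
  using head_gsteps[OF assms(2), of t "word u"] assms(1) by (auto simp: cfg_def pos_def P_def ell_def)

lemma valid_cfg: "valid (cfg t u)"
  by (simp add: cfg_def valid_gsteps)

lemma pv_simps [simp]: "pv s v [] = 0" "pv s v (ms # mss) = (\<Prod>y\<leftarrow>ms. v ! addr s y) + pv s v mss"
  by (simp_all add: pv_def)

lemma nth_addr_bref: "v ! addr s (bref r i) = bv v (length (s r)) i"
  by (simp add: addr_def bref_def bv_def add.assoc)

lemma bv_shift: "bv v (L + i * B * G) b = bv v L (i * B + b)"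
  by (simp add: bv_def distrib_right mult.assoc add.assoc)

lemma bv_vals: "L + (i + 1) * G \<le> length u + length gs \<Longrightarrow> bv (vals (gs @ gs') u) L i = bv (vals gs u) L i"
  using G_pos unfolding bv_def vals_append by (intro vals_nth) simp

lemma block_bound:
  assumes "b < B"
  shows "L + (i * B + b + 1) * G \<le> L + (i + 1) * B * G"
proof -
  have "i * B + b + 1 \<le> (i + 1) * B" using assms by simp
  then show ?thesis by (intro add_left_mono mult_right_mono) auto
qed

lemma cell_ok_vals:
  assumes "cell_ok (vals gs u) L c i" "L + (i + 1) * B * G \<le> length u + length gs"
  shows "cell_ok (vals (gs @ gs') u) L c i"
proof -
  have "bv (vals (gs @ gs') u) L (i * B + b) = bv (vals gs u) L (i * B + b)" if "b < B" for b
    using block_bound[OF that, of L i] assms(2) by (intro bv_vals) linarith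
  then show ?thesis using assms(1) bit_less_B unfolding cell_ok_def by simp
qed

lemma row_ok_vals:
  assumes "row_ok (vals gs u) L c" "L + W \<le> length u + length gs"
  shows "row_ok (vals (gs @ gs') u) L c"
proof -
  have le: "(i + 1) * B * G \<le> W" if "i \<le> P + 1" for i
  proof -
    have "(i + 1) * B \<le> (P + 2) * B" using that by (intro mult_right_mono) auto
    then show ?thesis unfolding W_def by (intro mult_right_mono) auto
  qed
  have "cell_ok (vals (gs @ gs') u) L c i" if "i \<le> P" for i
  proof (rule cell_ok_vals)
    show "cell_ok (vals gs u) L c i" using assms(1) that by (simp add: row_ok_def)
    show "L + (i + 1) * B * G \<le> length u + length gs" using le[of i] that assms(2) by linarith
  qed
  moreover have "bv (vals (gs @ gs') u) L ((P + 1) * B + hb j) = bv (vals gs u) L ((P + 1) * B + hb j)" if "j < k" for j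
    using block_bound[OF bit_less_B(1)[OF that], of L "P + 1"] le[of "P + 1"] assms(2)
    by (intro bv_vals) linarith
  moreover have "bv (vals (gs @ gs') u) L ((P + 2) * B + q) = bv (vals gs u) L ((P + 2) * B + q)" if "q < Q" for q
  proof (rule bv_vals)
    have "((P + 2) * B + q + 1) * G \<le> W" unfolding W_def using that by (intro mult_right_mono) auto
    then show "L + ((P + 2) * B + q + 1) * G \<le> length u + length gs" using assms(2) by linarith
  qed
  ultimately show ?thesis using assms(1) unfolding row_ok_def by simp
qed

lemma emit_row:
  assumes St: "St s gs a f d e" and len: "n0 + length gs = f + i * G"
    and refs: "\<And>j m y. j < length mss \<Longrightarrow> m \<in> set (mss ! j) \<Longrightarrow> y \<in> set m \<Longrightarrow>
      fst y \<in> {1, 2, 3, 4, 5} \<and> addr s y < f + (i + j) * G"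
    and size: "\<And>j. j < length mss \<Longrightarrow> psize (mss ! j) < G"
  obtains gs' where "St (sem (emit_at i mss) s) (gs @ gs') a f d e" "length gs' = length mss * G"
    "\<And>u j. length u = n0 \<Longrightarrow> j < length mss \<Longrightarrow>
       bv (vals (gs @ gs') u) f (i + j) = pv s (vals (gs @ gs') u) (mss ! j)"
proof -
  have s: "length (s 2) = f" "s 5 = []" and em: "emitted (map bit_symbol (encode_nat n0)) n0 gs s"
    using St by (auto simp: St_def)
  have ax: "addr s (2, i * G) = f + i * G" by (simp add: addr_def s)
  have r: "\<forall>ms\<in>set mss. \<forall>m\<in>set ms. \<forall>y\<in>set m. fst y \<in> {1, 2, 3, 4, 5}"
    using refs by (metis in_set_conv_nth)
  have "\<exists>gs'. emitted (map bit_symbol (encode_nat n0)) n0 (gs @ gs') (sem (emit_blocks G (5, 0) (2, i * G) mss) s) \<and>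
    length gs' = length mss * G \<and>
    (\<forall>r. r \<noteq> out \<longrightarrow> sem (emit_blocks G (5, 0) (2, i * G) mss) s r = s r) \<and>
    (\<forall>u j. length u = n0 \<longrightarrow> j < length mss \<longrightarrow>
       vals (gs @ gs') u ! (addr s (2, i * G) + j * G + (G - 1)) =
       poly_value (vals (gs @ gs') u) (map (map (addr s)) (mss ! j)))"
  proof (rule sem_emit_blocks[OF em])
    show "addr s (5, 0) = 0" by (simp add: addr_def s)
    show "0 < n0" by (simp add: n0_def)
    show "addr s (2, i * G) = n0 + length gs" using len ax by simp
    show "\<forall>ms\<in>set mss. psize ms < G" using size by (metis in_set_conv_nth)
    show "addr s y < addr s (2, i * G) + j * G" if "j < length mss" "m \<in> set (mss ! j)" "y \<in> set m" for j m y
      using refs[OF that] by (simp add: ax distrib_right add.assoc)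
  qed (use r in auto)
  then obtain gs' where gs': "emitted (map bit_symbol (encode_nat n0)) n0 (gs @ gs') (sem (emit_at i mss) s)"
    "length gs' = length mss * G" "\<And>r. r \<noteq> out \<Longrightarrow> sem (emit_at i mss) s r = s r"
    "\<And>u j. length u = n0 \<Longrightarrow> j < length mss \<Longrightarrow>
       vals (gs @ gs') u ! (addr s (2, i * G) + j * G + (G - 1)) =
       poly_value (vals (gs @ gs') u) (map (map (addr s)) (mss ! j))"
    unfolding emit_at_def by blast
  show thesis
  proof (rule that[OF _ gs'(2)])
    show "St (sem (emit_at i mss) s) (gs @ gs') a f d e"
      using St gs'(1) gs'(3) regs_distinct by (simp add: St_def)
    show "bv (vals (gs @ gs') u) f (i + j) = pv s (vals (gs @ gs') u) (mss ! j)"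
      if "length u = n0" "j < length mss" for u j
      using gs'(4)[OF that] unfolding ax
      by (simp add: bv_def pv_def poly_value_def distrib_right add.assoc o_def)
  qed
qed

lemma sem_advance: "sem (advance r i) s = s(r := s r @ replicate (i * G) 1)"
  by (simp add: advance_def sem_pushes)

text \<open>The invariant in the middle of a row: cells 0 to \<open>i\<close> are finished, and
  register 2 points to the beginning of cell \<open>i\<close>, not behind it.\<close>

definition Row :: "nat \<Rightarrow> (bit list \<Rightarrow> config) \<Rightarrow> nat \<Rightarrow> store \<Rightarrow> gate list \<Rightarrow> nat \<Rightarrow> nat \<Rightarrow> nat \<Rightarrow> bool" where
  "Row L c i s gs a d e \<longleftrightarrow> St s gs a (L + i * B * G) d e \<and> n0 + length gs = L + (i + 1) * B * G \<and>
     (\<forall>u. length u = n0 \<longrightarrow> (\<forall>i'\<le>i. cell_ok (vals gs u) L (c u) i'))"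

lemma Row_start:
  assumes "St s gs a L d e" "n0 + length gs = L" "\<And>u j. j < k \<Longrightarrow> pos 0 < snd (snd (c u) ! j)"
  obtains gs' where "Row L c 0 (sem row_start s) (gs @ gs') a d e"
proof -
  have len: "n0 + length gs = L + 0 * G" using assms(2) by simp
  have refs: "fst y \<in> {1, 2, 3, 4, 5} \<and> addr s y < L + (0 + j) * G"
    if "j < length (replicate B [])" "m \<in> set (replicate B [] ! j)" "y \<in> set m" for j m y
    using that by simp
  have size: "psize (replicate B ([] :: ref list list) ! j) < G" if "j < length (replicate B ([] :: ref list list))" for j
    using that psize_constant(1) by simp
  obtain gs' where gs': "St (sem (emit_at 0 (replicate B [])) s) (gs @ gs') a L d e" "length gs' = B * G"
    "\<And>u j. length u = n0 \<Longrightarrow> j < B \<Longrightarrow> bv (vals (gs @ gs') u) L j = 0"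
    by (rule emit_row[OF assms(1) len refs size]) auto
  have "cell_ok (vals (gs @ gs') u) L (c u) 0" if "length u = n0" for u
    using gs'(3)[OF that] bit_less_B assms(3)[of _ u] unfolding cell_ok_def by fastforce
  then have "Row L c 0 (sem row_start s) (gs @ gs') a d e"
    using gs'(1,2) assms(2) by (simp add: Row_def row_start_def)
  then show thesis by (rule that)
qed

text \<open>The assumptions on \<open>hf\<close> and \<open>sf\<close> admit an arbitrary extension
  \<open>gs'\<close>, because their polynomials are evaluated in the circuit that already contains
  the blocks of the new cell.\<close>

lemma Row_cell:
  assumes R: "Row L c i s gs a d e"
    and refs: "\<And>j m y. j < k \<Longrightarrow> m \<in> set (hf j) \<Longrightarrow> y \<in> set m \<Longrightarrow>
      fst y \<in> {1, 2, 3, 4, 5} \<and> addr s y < n0 + length gs"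
      "\<And>j a m y. j < k \<Longrightarrow> a < Sy \<Longrightarrow> m \<in> set (sf j a) \<Longrightarrow> y \<in> set m \<Longrightarrow>
      fst y \<in> {1, 2, 3, 4, 5} \<and> addr s y < n0 + length gs"
    and size: "\<And>j. psize (hf j) < G" "\<And>j a. psize (sf j a) < G"
    and sem: "\<And>u gs' j. length u = n0 \<Longrightarrow> j < k \<Longrightarrow>
      pv s (vals (gs @ gs') u) (hf j) = of_bool (snd (snd (c u) ! j) = pos (Suc i))"
      "\<And>u gs' j a. length u = n0 \<Longrightarrow> j < k \<Longrightarrow> a < Sy \<Longrightarrow>
      pv s (vals (gs @ gs') u) (sf j a) = of_bool (fst (snd (c u) ! j) (pos (Suc i)) = a)"
  obtains gs' where "Row L c (Suc i) (sem (emit_cell hf sf) s) (gs @ gs') a d e"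
proof -
  let ?f = "L + i * B * G"
  have St: "St s gs a ?f d e" and len: "n0 + length gs = ?f + B * G"
    and old: "\<And>u i'. length u = n0 \<Longrightarrow> i' \<le> i \<Longrightarrow> cell_ok (vals gs u) L (c u) i'"
    using R by (auto simp: Row_def algebra_simps)
  have f: "length (s 2) = ?f" using St by (simp add: St_def)
  have addr2: "addr s (bref 2 b) < ?f + n * G" if "b < n" for b n
  proof -
    have "b * G + G \<le> n * G" using mult_right_mono[of "Suc b" n G] that by simp
    then show ?thesis using G_pos by (simp add: addr_def bref_def f)
  qed
  have size': "psize (cell hf sf ! b) < G" if "b < B" for b
    using that size psize_accumulate by (simp add: cell_def)
  have refs': "fst y \<in> {1, 2, 3, 4, 5} \<and> addr s y < ?f + (B + b) * G"
    if b: "b < length (cell hf sf)" "m \<in> set (cell hf sf ! b)" "y \<in> set m" for b m y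
  proof -
    define j r where "j = b div w" and "r = b mod w"
    have bj: "b = j * w + r" "r < w" using w_pos by (simp_all add: j_def r_def)
    have jk: "j < k" using b(1) by (simp add: j_def B_def less_mult_imp_div_less)
    have mem: "m \<in> set (if r = 0 then hf j else if r \<le> Sy then sf j (r - 1) else accumulate j (r - 1 - Sy))"
      using b(1,2) by (simp only: cell_nth_eq length_cell j_def r_def)
    have le: "n0 + length gs \<le> ?f + (B + b) * G" using len by (simp add: distrib_right)
    consider "r = 0" | "0 < r" "r \<le> Sy" | "Sy < r" by linarith
    then show ?thesis
    proof cases
      case 1
      then show ?thesis using refs(1)[OF jk, of m y] mem b(3) le by auto
    next
      case 2
      then have "r - 1 < Sy" by simp
      then show ?thesis using refs(2)[OF jk, of "r - 1" m y] mem b(3) le 2 by auto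
    next
      case 3
      then have "y \<in> {bref 2 (ab j (r - 1 - Sy)), bref 2 (B + hb j), bref 2 (B + sb j (r - 1 - Sy))}"
        using mem b(3) by (auto simp: accumulate_def)
      moreover have "r - 1 - Sy < Sy" using bj(2) 3 by (simp add: w_def)
      then have "ab j (r - 1 - Sy) < B + b" "B + hb j < B + b" "B + sb j (r - 1 - Sy) < B + b"
        using bit_less_B(3)[OF jk, of "r - 1 - Sy"] 3 Sy_pos by (auto simp: bj(1) hb_def sb_def)
      ultimately show ?thesis using addr2 by (auto simp: bref_def)
    qed
  qed
  have size'': "psize (cell hf sf ! b) < G" if "b < length (cell hf sf)" for b
    using that size' by simp
  obtain gs' where gs': "St (sem (emit_at B (cell hf sf)) s) (gs @ gs') a ?f d e" "length gs' = B * G"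
    "\<And>u b. length u = n0 \<Longrightarrow> b < B \<Longrightarrow> bv (vals (gs @ gs') u) ?f (B + b) = pv s (vals (gs @ gs') u) (cell hf sf ! b)"
  proof (rule emit_row[OF St len, where mss = "cell hf sf"])
    show "fst y \<in> {1, 2, 3, 4, 5} \<and> addr s y < ?f + (B + b) * G"
      if "b < length (cell hf sf)" "m \<in> set (cell hf sf ! b)" "y \<in> set m" for b m y
      using that by (rule refs')
  qed (use size'' in \<open>auto simp only: length_cell\<close>)
  have shift: "bv v ?f b = bv v L (i * B + b)" "Suc i * B + b = i * B + (B + b)" for v b
    using bv_shift[of v L i] by simp_all
  have "cell_ok (vals (gs @ gs') u) L (c u) (Suc i)" if u: "length u = n0" for u
  proof -
    let ?v = "vals (gs @ gs') u"
    have prev: "cell_ok ?v L (c u) i"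
      using old[OF u order_refl] len u by (intro cell_ok_vals) (auto simp: algebra_simps)
    have h: "bv ?v L (Suc i * B + hb j) = of_bool (snd (snd (c u) ! j) = pos (Suc i))" if "j < k" for j
      using gs'(3)[OF u bit_less_B(1)[OF that]] sem(1)[OF u that] by (simp only: shift cell_nth(1)[OF that])
    have sy: "bv ?v L (Suc i * B + sb j a) = of_bool (fst (snd (c u) ! j) (pos (Suc i)) = a)" if "j < k" "a < Sy" for j a
      using gs'(3)[OF u bit_less_B(2)[OF that]] sem(2)[OF u that] by (simp only: shift cell_nth(2)[OF that])
    have ac: "bv ?v L (Suc i * B + ab j a) = of_bool (snd (snd (c u) ! j) \<le> pos (Suc i) \<and> read_tape (snd (c u) ! j) = a)"
      if "j < k" "a < Sy" for j a
    proof -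
      obtain ct hd where t: "snd (c u) ! j = (ct, hd)" by fastforce
      have "bv ?v L (Suc i * B + ab j a) = pv s ?v (accumulate j a)"
        using gs'(3)[OF u bit_less_B(3)[OF that]] by (simp only: shift cell_nth(3)[OF that])
      also have "\<dots> = bv ?v L (i * B + ab j a) + bv ?v L (Suc i * B + hb j) * bv ?v L (Suc i * B + sb j a)"
        by (simp only: accumulate_def pv_simps list.map prod_list.Cons prod_list.Nil mult_1_right add_0_right nth_addr_bref f shift)
      also have "\<dots> = of_bool (hd \<le> pos i \<and> ct hd = a) + of_bool (hd = pos (Suc i)) * of_bool (ct (pos (Suc i)) = a)"
        using prev that h[OF that(1)] sy[OF that] by (simp only: cell_ok_def t) (simp add: t)
      \<comment> \<open>The head is either further left or in this very cell, and these cases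
        exclude each other, so adding the two bits decides whether one of them holds.\<close>
      also have "\<dots> = of_bool (hd \<le> pos (Suc i) \<and> ct hd = a)"
      proof -
        have "pos (Suc i) = pos i + 1" by (simp add: pos_def)
        then consider "hd \<le> pos i" "hd \<noteq> pos (Suc i)" "hd \<le> pos (Suc i)" | "hd = pos (Suc i)" "\<not> hd \<le> pos i" | "\<not> hd \<le> pos (Suc i)" "\<not> hd \<le> pos i" "hd \<noteq> pos (Suc i)"
          by linarith
        then show ?thesis by cases auto
      qed
      finally show ?thesis by (simp add: t)
    qed
    show ?thesis using h sy ac by (simp add: cell_ok_def)
  qed
  moreover have "cell_ok (vals (gs @ gs') u) L (c u) i'" if "length u = n0" "i' \<le> i" for u i'
  proof (rule cell_ok_vals[OF old[OF that]])
    have "(i' + 1) * (B * G) \<le> (i + 1) * (B * G)" using that(2) by (intro mult_right_mono) auto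
    then show "L + (i' + 1) * B * G \<le> length u + length gs" using len that(1) by (simp add: algebra_simps)
  qed
  ultimately have cells: "\<forall>u. length u = n0 \<longrightarrow> (\<forall>i'\<le>Suc i. cell_ok (vals (gs @ gs') u) L (c u) i')"
    by (auto simp: le_Suc_eq)
  have "St (sem (emit_cell hf sf) s) (gs @ gs') a (L + Suc i * B * G) d e"
    using gs'(1) regs_distinct unfolding St_def emitted_def emit_cell_def
    by (simp add: sem_advance algebra_simps)
  then have "Row L c (Suc i) (sem (emit_cell hf sf) s) (gs @ gs') a d e"
    using cells len gs'(2) unfolding Row_def by (simp add: algebra_simps)
  then show thesis by (rule that)
qed

lemma addr_St: "St s gs a f d e \<Longrightarrow> St s' gs' a f d e \<Longrightarrow> fst y \<in> {1, 2, 3, 4, 5} \<Longrightarrow> addr s' y = addr s y"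
  by (auto simp: St_def addr_def)

lemma pv_St:
  assumes "St s gs a f d e" "St s' gs' a f d e" "\<And>m y. m \<in> set ms \<Longrightarrow> y \<in> set m \<Longrightarrow> fst y \<in> {1, 2, 3, 4, 5}"
  shows "pv s' v ms = pv s v ms"
  unfolding pv_def using addr_St[OF assms(1,2)] assms(3)
  by (intro arg_cong[of _ _ sum_list] map_cong refl arg_cong[of _ _ prod_list]) auto

lemma Row_end:
  assumes R: "Row L c P s gs a d e" 
    and refs: "\<And>q m y. q < Q \<Longrightarrow> m \<in> set (qf q) \<Longrightarrow> y \<in> set m \<Longrightarrow>
      fst y \<in> {1, 2, 3, 4, 5} \<and> addr s y < n0 + length gs"
    and size: "\<And>q. psize (qf q) < G"
    and sem: "\<And>u gs' q. length u = n0 \<Longrightarrow> q < Q \<Longrightarrow>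
      pv s (vals (gs @ gs') u) (qf q) = of_bool (q = fst (c u))"
  obtains gs' where "St (sem (row_end qf) s) (gs @ gs') a (L + W) d e" "n0 + length (gs @ gs') = L + W"
    "\<And>u. length u = n0 \<Longrightarrow> row_ok (vals (gs @ gs') u) L (c u)"
proof -
  let ?f = "L + P * B * G"
  have St: "St s gs a ?f d e" and len: "n0 + length gs = ?f + B * G"
    and old: "\<And>u i'. length u = n0 \<Longrightarrow> i' \<le> P \<Longrightarrow> cell_ok (vals gs u) L (c u) i'"
    using R by (auto simp: Row_def algebra_simps)
  have refs0: "fst y \<in> {1, 2, 3, 4, 5} \<and> addr s y < ?f + (B + j) * G"
    if "j < length (replicate B [])" "m \<in> set (replicate B [] ! j)" "y \<in> set m" for j m y
    using that by simp
  have size0: "psize (replicate B ([] :: ref list list) ! j) < G" if "j < length (replicate B ([] :: ref list list))" for j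
    using that psize_constant(1) by simp
  obtain gs1 where gs1: "St (sem (emit_at B (replicate B [])) s) (gs @ gs1) a ?f d e" "length gs1 = B * G"
    "\<And>u j. length u = n0 \<Longrightarrow> j < B \<Longrightarrow> bv (vals (gs @ gs1) u) ?f (B + j) = 0"
    by (rule emit_row[OF St len refs0 size0]) auto
  let ?s = "sem (emit_at B (replicate B [])) s"
  have len1: "n0 + length (gs @ gs1) = ?f + (2 * B) * G" using len gs1(2) by simp
  obtain gs2 where gs2: "St (sem (emit_at (2 * B) (map qf [0..<Q])) ?s) ((gs @ gs1) @ gs2) a ?f d e" "length gs2 = Q * G"
    "\<And>u q. length u = n0 \<Longrightarrow> q < Q \<Longrightarrow> bv (vals ((gs @ gs1) @ gs2) u) ?f (2 * B + q) =
       pv ?s (vals ((gs @ gs1) @ gs2) u) (qf q)"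
  proof (rule emit_row[OF gs1(1) len1, where mss = "map qf [0..<Q]"])
    show "fst y \<in> {1, 2, 3, 4, 5} \<and> addr ?s y < ?f + (2 * B + q) * G"
      if q: "q < length (map qf [0..<Q])" "m \<in> set (map qf [0..<Q] ! q)" "y \<in> set m" for q m y
    proof -
      have qf: "q < Q" "m \<in> set (qf q)" using q by (simp_all del: upt_Suc)
      have "fst y \<in> {1, 2, 3, 4, 5} \<and> addr s y < n0 + length gs" using refs[OF qf q(3)] .
      moreover have "n0 + length gs \<le> ?f + (2 * B + q) * G" using len by (simp add: distrib_right)
      ultimately show ?thesis using addr_St[OF St gs1(1), of y] by auto
    qed
    show "psize (map qf [0..<Q] ! q) < G" if "q < length (map qf [0..<Q])" for q
      using that size by (simp del: upt_Suc)
  next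
    fix gs'
    assume "St (sem (emit_at (2 * B) (map qf [0..<Q])) ?s) ((gs @ gs1) @ gs') a ?f d e"
      "length gs' = length (map qf [0..<Q]) * G"
      "\<And>u j. length u = n0 \<Longrightarrow> j < length (map qf [0..<Q]) \<Longrightarrow>
       bv (vals ((gs @ gs1) @ gs') u) ?f (2 * B + j) = pv ?s (vals ((gs @ gs1) @ gs') u) (map qf [0..<Q] ! j)"
    then show thesis by (intro that) (simp_all del: upt_Suc vals_append)
  qed
  let ?gs = "gs1 @ gs2"
  have ln: "n0 + length (gs @ ?gs) = L + W"
    using len gs1(2) gs2(2) by (simp add: W_def algebra_simps)
  have shift: "bv v ?f (B + b) = bv v L ((P + 1) * B + b)" "bv v ?f (2 * B + b) = bv v L ((P + 2) * B + b)" for v b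
    unfolding bv_shift by (simp_all only: add_mult_distrib add.assoc mult_1)
  have "row_ok (vals (gs @ ?gs) u) L (c u)" if u: "length u = n0" for u
    unfolding row_ok_def
  proof (intro conjI allI impI)
    fix i assume i: "i \<le> P"
    have "(i + 1) * (B * G) \<le> (P + 1) * (B * G)" using i by (intro mult_right_mono) auto
    then show "cell_ok (vals (gs @ ?gs) u) L (c u) i"
      using u len by (intro cell_ok_vals old i) (simp_all add: algebra_simps)
  next
    fix j assume j: "j < k"
    have "bv (vals ((gs @ gs1) @ gs2) u) ?f (B + hb j) = bv (vals (gs @ gs1) u) ?f (B + hb j)"
    proof (rule bv_vals)
      have "(B + hb j + 1) * G \<le> (2 * B) * G" using bit_less_B(1)[OF j] by (intro mult_right_mono) auto
      then show "?f + (B + hb j + 1) * G \<le> length u + length (gs @ gs1)" using u len1 by linarith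
    qed
    then show "bv (vals (gs @ ?gs) u) L ((P + 1) * B + hb j) = 0"
      using gs1(3)[OF u bit_less_B(1)[OF j]] by (simp only: shift append_assoc)
  next
    fix q assume q: "q < Q"
    have "pv ?s (vals (gs @ ?gs) u) (qf q) = pv s (vals (gs @ ?gs) u) (qf q)"
      using refs[OF q] by (intro pv_St[OF St gs1(1)]) blast
    then show "bv (vals (gs @ ?gs) u) L ((P + 2) * B + q) = of_bool (q = fst (c u))"
      using gs2(3)[OF u q] sem[OF u q, of ?gs] by (simp only: shift append_assoc)
  qed
  moreover have "St (sem (row_end qf) s) (gs @ ?gs) a (L + W) d e"
    using gs2(1) regs_distinct unfolding St_def emitted_def row_end_def
    by (simp add: sem_advance W_def algebra_simps)
  ultimately show thesis using ln by (intro that)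
qed

text \<open>All heads are at the last cell or to its left, so its accumulated bits are the
  indicators of the symbols read, and the factors test each component of \<open>z\<close>.\<close>

lemma select_value:
  assumes row: "row_ok v L c" and c: "valid c" "\<And>j. j < k \<Longrightarrow> snd (snd c ! j) \<le> pos P"
    and s: "length (s 3) = L + P * B * G" and z: "z \<in> set zs"
  shows "(\<Prod>y\<leftarrow>select z. v ! addr s y) = of_bool (z = (fst c, map read_tape (snd c)))"
proof -
  obtain q rs where qrs: "z = (q, rs)" by fastforce
  have q: "q < Q" and rs: "length rs = k" "\<And>j. j < k \<Longrightarrow> rs ! j < Sy"
    using z by (auto simp: zs_iff qrs symbols_ok_def)
  have P: "cell_ok v L c P" using row by (simp add: row_ok_def)
  have "bv v (length (s 3)) (2 * B + q) = bv v L ((P + 2) * B + q)"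
    unfolding s bv_shift by (simp only: add_mult_distrib add.assoc)
  then have st: "bv v (length (s 3)) (2 * B + q) = of_bool (q = fst c)"
    using row q by (simp add: row_ok_def)
  have rd: "bv v (length (s 3)) (ab j (rs ! j)) = of_bool (read_tape (snd c ! j) = rs ! j)" if "j < k" for j
    unfolding s bv_shift using P that rs(2)[OF that] c(2)[OF that] by (simp add: cell_ok_def)
  have "map (\<lambda>y. v ! addr s y) (map (\<lambda>j. bref 3 (ab j (rs ! j))) [0..<k]) =
      map (\<lambda>j. of_bool (read_tape (snd c ! j) = rs ! j)) [0..<k]"
    using rd by (simp add: nth_addr_bref)
  then have "(\<Prod>y\<leftarrow>select z. v ! addr s y) =
      of_bool (q = fst c) * (\<Prod>j\<leftarrow>[0..<k]. of_bool (read_tape (snd c ! j) = rs ! j))"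
    using st by (simp only: select_def qrs fst_conv snd_conv list.map prod_list.Cons nth_addr_bref)
  also have "\<dots> = of_bool (q = fst c \<and> (\<forall>j\<in>set [0..<k]. read_tape (snd c ! j) = rs ! j))"
    by (simp only: prod_list_of_bool) simp
  also have "(\<forall>j\<in>set [0..<k]. read_tape (snd c ! j) = rs ! j) \<longleftrightarrow> rs = map read_tape (snd c)"
    using c(1) rs(1) by (auto simp: valid_def list_eq_iff_nth_eq)
  finally show ?thesis by (simp add: qrs)
qed

lemma gstep_nth:
  assumes "valid c" "j < k" "z0 = (fst c, map read_tape (snd c))"
  shows "snd (gstep c) ! j = act_tape (act z0 j) (snd c ! j)" "fst (gstep c) = fst (delta (fst z0) (snd z0))"
    "z0 \<in> set zs"
proof -
  obtain q ts where c: "c = (q, ts)" by fastforce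
  obtain q' acts where d: "delta q (map read_tape ts) = (q', acts)" by fastforce
  have "length acts = k" "length ts = k"
    using delta_wf[OF _ read_symbols_ok d] assms(1) by (auto simp: valid_def c)
  then show "snd (gstep c) ! j = act_tape (act z0 j) (snd c ! j)" using assms(2) by (simp add: c d act_def assms(3))
  show "fst (gstep c) = fst (delta (fst z0) (snd z0))" by (simp add: c d assms(3))
  show "z0 \<in> set zs" using assms(1) read_symbols_ok[of q ts] by (simp add: zs_iff assms(3) c valid_def)
qed

lemma addr_bref_less: "length (s r) = a \<Longrightarrow> i < n \<Longrightarrow> a + n * G \<le> l \<Longrightarrow> addr s (bref r i) < l"
proof -
  assume "length (s r) = a" "i < n" "a + n * G \<le> l"
  moreover have "Suc i * G \<le> n * G" using \<open>i < n\<close> by (intro mult_right_mono) auto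
  ultimately show ?thesis using G_pos by (simp add: addr_def bref_def)
qed

lemma three_cells_le_W: "(3 * B) * G \<le> W" "L + P * B * G + (2 * B + Q) * G = L + W"
proof -
  have "3 * B \<le> (P + 2) * B + Q" by (intro trans_le_add1 mult_right_mono) (simp_all add: P_def T'_def)
  then show "(3 * B) * G \<le> W" unfolding W_def by (intro mult_right_mono) auto
  show "L + P * B * G + (2 * B + Q) * G = L + W" unfolding W_def by (simp add: add_mult_distrib)
qed

lemma select_refs:
  assumes "z \<in> set zs" "y \<in> set (select z)" "length (s 3) = L + P * B * G"
  shows "fst y = 3 \<and> addr s y < L + W"
proof -
  have q: "fst z < Q" and rs: "\<And>j. j < k \<Longrightarrow> snd z ! j < Sy"
    using assms(1) by (auto simp: zs_iff symbols_ok_def)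
  from assms(2) consider "y = bref 3 (2 * B + fst z)" | j where "j < k" "y = bref 3 (ab j (snd z ! j))"
    by (auto simp: select_def)
  then obtain b where b: "y = bref 3 b" "b < 2 * B + Q"
  proof cases
    case 1
    then show ?thesis using that q by auto
  next
    case 2
    then show ?thesis using that[of "ab j (snd z ! j)"] bit_less_B(3)[OF 2(1) rs[OF 2(1)]] by simp
  qed
  show ?thesis
    using addr_bref_less[of s 3, OF assms(3) b(2), of "L + W"] three_cells_le_W(2)[of L] by (simp add: b(1)) (simp add: bref_def)
qed

lemma prev_refs:
  assumes "b < 3 * B" "length (s 1) = L + i * B * G" "L + W + (i + 1) * B * G \<le> l"
  shows "fst (bref 1 b) = 1 \<and> addr s (bref 1 b) < l"
proof -
  have "L + i * B * G + (3 * B) * G \<le> l" using three_cells_le_W(1) assms(3) by (simp add: add_mult_distrib)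
  then show ?thesis using addr_bref_less[of s 1, OF assms(2,1)] by (simp add: bref_def)
qed

lemma next_cell:
  assumes R: "Row (L + W) (cfg (Suc t)) i s gs (L + i * B * G) (L + P * B * G) e"
    and row: "\<And>u. length u = n0 \<Longrightarrow> row_ok (vals gs u) L (cfg t u)" and t: "t < T'" and i: "i < P"
  obtains gs' where "Row (L + W) (cfg (Suc t)) (Suc i) (sem (emit_cell next_head next_symbol) s) (gs @ gs')
    (L + i * B * G) (L + P * B * G) e"
proof -
  have s1: "length (s 1) = L + i * B * G" and s3: "length (s 3) = L + P * B * G"
    and len: "n0 + length gs = L + W + (i + 1) * B * G"
    using R by (auto simp: Row_def St_def)
  have LW: "L + W \<le> n0 + length gs" using len by simp
  have act: "r \<in> {1, 2, 3, 4, 5} \<and> n < n0 + length gs"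
    if "r = (3 :: nat) \<and> n < L + W" for r n using that LW by auto
  have shift_less: "shift dd + hb j < 3 * B" if "j < k" for dd j
    using bit_less_B(1)[OF that] by (cases dd) (auto simp: shift_def)
  have prev: "fst (bref 1 b) \<in> {1, 2, 3, 4, 5} \<and> addr s (bref 1 b) < n0 + length gs" if "b < 3 * B" for b
    using prev_refs[of _ s L i, OF that s1, of "n0 + length gs"] len by simp
  have refs1: "fst y \<in> {1, 2, 3, 4, 5} \<and> addr s y < n0 + length gs"
    if hyp: "j < k" "m \<in> set (next_head j)" "y \<in> set m" for j m y
  proof -
    obtain z where z: "z \<in> set zs" "m = select z @ [bref 1 (shift (snd (act z j)) + hb j)]"
      using hyp(2) by (auto simp: next_head_def)
    then consider "y \<in> set (select z)" | "y = bref 1 (shift (snd (act z j)) + hb j)" using hyp(3) by auto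
    then show ?thesis
    proof cases
      case 1
      then show ?thesis using select_refs[of _ _ s, OF z(1) _ s3] act by blast
    next
      case 2
      then show ?thesis using prev[OF shift_less[OF hyp(1)]] by simp
    qed
  qed
  have refs2: "fst y \<in> {1, 2, 3, 4, 5} \<and> addr s y < n0 + length gs"
    if hyp: "j < k" "a < Sy" "m \<in> set (next_symbol j a)" "y \<in> set m" for j a m y
  proof -
    consider "y = bref 1 (B + sb j a)" | "y = bref 1 (B + hb j)" | z where "z \<in> set zs" "y \<in> set (select z)"
      using hyp(3,4) by (auto simp: next_symbol_def)
    then show ?thesis
    proof cases
      case 1
      then show ?thesis using prev[of "B + sb j a"] bit_less_B(2)[OF hyp(1,2)] by simp
    next
      case 2
      then show ?thesis using prev[of "B + hb j"] bit_less_B(1)[OF hyp(1)] by simp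
    next
      case 3
      then show ?thesis using select_refs[of _ _ s, OF 3 s3] act by blast
    qed
  qed
  have row': "row_ok (vals (gs @ gs') u) L (cfg t u)" if "length u = n0" for u gs'
    using row[OF that] LW that by (intro row_ok_vals) auto
  have bits: "bv (vals (gs @ gs') u) (L + i * B * G) (d * B + hb j) = of_bool (snd (snd (cfg t u) ! j) = pos (i + d))"
    if "length u = n0" "j < k" "d \<le> 2" for u gs' j d
  proof -
    have "bv (vals (gs @ gs') u) (L + i * B * G) (d * B + hb j) = bv (vals (gs @ gs') u) L ((i + d) * B + hb j)"
      unfolding bv_shift by (simp only: add_mult_distrib add.assoc)
    also have "\<dots> = of_bool (snd (snd (cfg t u) ! j) = pos (i + d))"
    proof (cases "i + d \<le> P")
      case True
      then show ?thesis using row'[OF that(1)] that(2) by (simp add: row_ok_def cell_ok_def)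
    next
      \<comment> \<open>The right neighbour of the last cell is the border, whose head bits are 0;
        correctly so, since no head gets there in time.\<close>
      case False
      then have "i + d = P + 1" using i that(3) by simp
      moreover have "snd (snd (cfg t u) ! j) \<noteq> pos (P + 1)"
        using head_range(2)[of t j u] t that(2) by (simp add: pos_def)
      ultimately show ?thesis using row'[OF that(1), of gs'] that(2) by (simp add: row_ok_def)
    qed
    finally show ?thesis .
  qed
  have syms: "bv (vals (gs @ gs') u) (L + i * B * G) (B + sb j a) = of_bool (fst (snd (cfg t u) ! j) (pos (Suc i)) = a)"
    if "length u = n0" "j < k" "a < Sy" for u gs' j a
  proof -
    have "bv (vals (gs @ gs') u) (L + i * B * G) (B + sb j a) = bv (vals (gs @ gs') u) L (Suc i * B + sb j a)"
    proof -
      have "i * B + (B + sb j a) = Suc i * B + sb j a" by simp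
      then show ?thesis by (simp only: bv_shift)
    qed
    moreover have "cell_ok (vals (gs @ gs') u) L (cfg t u) (Suc i)"
      using row'[OF that(1), of gs'] Suc_leI[OF i] unfolding row_ok_def by blast
    ultimately show ?thesis using that(2,3) unfolding cell_ok_def by (simp del: mult_Suc)
  qed
  have sel: "(\<Prod>y\<leftarrow>select z. vals (gs @ gs') u ! addr s y) = of_bool (z = (fst (cfg t u), map read_tape (snd (cfg t u))))"
    if "length u = n0" "z \<in> set zs" for u gs' z
    using t by (intro select_value[of _ _ _ s, OF row'[OF that(1)] valid_cfg _ s3 that(2)] head_range(2)) auto
  have cfgS: "cfg (Suc t) u = gstep (cfg t u)" for u by (simp add: cfg_def)
  have sem1: "pv s (vals (gs @ gs') u) (next_head j) = of_bool (snd (snd (cfg (Suc t) u) ! j) = pos (Suc i))"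
    if u: "length u = n0" "j < k" for u gs' j
  proof -
    let ?v = "vals (gs @ gs') u" and ?z = "(fst (cfg t u), map read_tape (snd (cfg t u)))"
    note z = gstep_nth[OF valid_cfg[of t u] u(2) refl]
    let ?h = "\<lambda>z. bv ?v (L + i * B * G) (shift (snd (act z j)) + hb j)"
    \<comment> \<open>The selecting products are indicators, so the sum over all \<open>z\<close>
      collapses to the actual state and symbols.\<close>
    have "pv s ?v (next_head j) = (\<Sum>z\<leftarrow>zs. of_bool (z = ?z) * ?h z)"
      unfolding pv_def next_head_def map_map o_def
    proof (intro arg_cong[of _ _ sum_list] map_cong refl)
      fix z assume "z \<in> set zs"
      from sel[OF u(1) this, of gs']
      show "(\<Prod>y\<leftarrow>select z @ [bref 1 (shift (snd (act z j)) + hb j)]. ?v ! addr s y) = of_bool (z = ?z) * ?h z"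
        by (simp only: map_append prod_list.append list.map prod_list.Cons prod_list.Nil mult_1_right nth_addr_bref s1)
    qed
    also have "\<dots> = ?h ?z" by (rule sum_list_select[OF distinct_zs z(3)])
    also have "\<dots> = of_bool (move_head (snd (act ?z j)) (snd (snd (cfg t u) ! j)) = pos (Suc i))"
    proof (cases "snd (act ?z j)")
      case Left
      then show ?thesis using bits[OF u, of 2 gs'] by (auto simp: shift_def pos_def)
    next
      case Stay
      then show ?thesis using bits[OF u, of 1 gs'] by (simp add: shift_def)
    next
      case Right
      then show ?thesis using bits[OF u, of 0 gs'] by (auto simp: shift_def pos_def)
    qed
    finally show ?thesis by (simp only: cfgS z(1) snd_act_tape)
  qed
  have sem2: "pv s (vals (gs @ gs') u) (next_symbol j a) = of_bool (fst (snd (cfg (Suc t) u) ! j) (pos (Suc i)) = a)"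
    if u: "length u = n0" "j < k" "a < Sy" for u gs' j a
  proof -
    let ?v = "vals (gs @ gs') u" and ?z = "(fst (cfg t u), map read_tape (snd (cfg t u)))"
    note z = gstep_nth[OF valid_cfg[of t u] u(2) refl]
    obtain ct hd where th: "snd (cfg t u) ! j = (ct, hd)" by fastforce
    obtain b dd where ac: "act ?z j = (b, dd)" by fastforce
    let ?h = "bv ?v (L + i * B * G) (B + hb j)"
    have h: "?h = of_bool (hd = pos (Suc i))" using bits[OF u(1,2), of 1 gs'] by (simp add: th)
    have sy: "bv ?v (L + i * B * G) (B + sb j a) = of_bool (ct (pos (Suc i)) = a)" using syms[OF u] by (simp add: th)
    have "pv s ?v (map (\<lambda>z. select z @ [bref 1 (B + hb j)]) (filter (\<lambda>z. fst (act z j) = a) zs)) =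
        (\<Sum>z\<leftarrow>filter (\<lambda>z. fst (act z j) = a) zs. of_bool (z = ?z) * ?h)"
      unfolding pv_def map_map o_def
    proof (intro arg_cong[of _ _ sum_list] map_cong refl)
      fix z assume "z \<in> set (filter (\<lambda>z. fst (act z j) = a) zs)"
      then have "z \<in> set zs" by simp
      from sel[OF u(1) this, of gs']
      show "(\<Prod>y\<leftarrow>select z @ [bref 1 (B + hb j)]. ?v ! addr s y) = of_bool (z = ?z) * ?h"
        by (simp only: map_append prod_list.append list.map prod_list.Cons prod_list.Nil mult_1_right nth_addr_bref s1)
    qed
    also have "\<dots> = (if fst (act ?z j) = a then ?h else 0)"
      by (rule sum_list_filter_select[OF distinct_zs z(3)])
    finally have "pv s ?v (next_symbol j a) = of_bool (ct (pos (Suc i)) = a) +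
       (of_bool (hd = pos (Suc i)) * of_bool (ct (pos (Suc i)) = a) + (if b = a then of_bool (hd = pos (Suc i)) else 0))"
      by (simp only: next_symbol_def pv_simps list.map prod_list.Cons prod_list.Nil mult_1_right nth_addr_bref s1 h sy ac fst_conv)
    also have "\<dots> = of_bool ((ct(hd := b)) (pos (Suc i)) = a)" by auto
    finally show ?thesis by (simp only: cfgS z(1) th ac act_tape.simps fst_conv)
  qed
  show thesis
    by (rule Row_cell[OF R refs1 refs2 psize_next_head psize_next_symbol sem1 sem2]) (auto intro: that)
qed

lemma St_advance:
  assumes "St s gs a f d e"
  shows "St (sem (advance 1 n) s) gs (a + n * G) f d e" "St (sem (advance 3 n) s) gs a f (d + n * G) e"
  using assms regs_distinct by (auto simp: St_def emitted_def sem_advance)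

lemma Row_advance: "Row L c i s gs a d e \<Longrightarrow> Row L c i (sem (advance 1 n) s) gs (a + n * G) d e"
  unfolding Row_def using St_advance(1) by blast

text \<open>Before the row, registers 1, 2 and 3 point to the beginning of the old row, to its end
  and to its last cell. The same holds one row later, which makes the step iterable.\<close>

lemma next_row:
  assumes St: "St s gs L (L + W) (L + P * B * G) e" and len: "n0 + length gs = L + W"
    and row: "\<And>u. length u = n0 \<Longrightarrow> row_ok (vals gs u) L (cfg t u)" and t: "t < T'"
  obtains gs' where "St (sem next_row s) gs' (L + W) (L + W + W) (L + W + P * B * G) e"
    "n0 + length gs' = L + W + W" "\<And>u. length u = n0 \<Longrightarrow> row_ok (vals gs' u) (L + W) (cfg (Suc t) u)"
proof -
  let ?body = "emit_cell next_head next_symbol ;; advance 1 B" and ?d = "L + P * B * G"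
  obtain gs0 where R0: "Row (L + W) (cfg (Suc t)) 0 (sem row_start s) (gs @ gs0) L ?d e"
    using Row_start[OF St len, of "cfg (Suc t)"] head_range(1)[OF Suc_leI[OF t]] by blast
  \<comment> \<open>Correctness of the old row is carried along, because the gate list under which
    it is evaluated grows with every cell.\<close>
  have loop: "\<exists>gs'. Row (L + W) (cfg (Suc t)) i ((sem ?body ^^ i) (sem row_start s)) gs' (L + i * B * G) ?d e \<and>
      (\<forall>u. length u = n0 \<longrightarrow> row_ok (vals gs' u) L (cfg t u))" if "i \<le> P" for i
    using that
  proof (induction i)
    case 0
    have "row_ok (vals (gs @ gs0) u) L (cfg t u)" if "length u = n0" for u
      using row[OF that] len that by (intro row_ok_vals) auto
    then show ?case using R0 by (intro exI[of _ "gs @ gs0"]) simp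
  next
    case (Suc i)
    let ?s = "(sem ?body ^^ i) (sem row_start s)"
    obtain gs1 where R: "Row (L + W) (cfg (Suc t)) i ?s gs1 (L + i * B * G) ?d e"
      and row1: "\<And>u. length u = n0 \<Longrightarrow> row_ok (vals gs1 u) L (cfg t u)"
      using Suc.IH[OF Suc_leD[OF Suc.prems]] by blast
    have "i < P" using Suc.prems by simp
    from next_cell[OF R row1 t this] obtain gs2 where
      R2: "Row (L + W) (cfg (Suc t)) (Suc i) (sem (emit_cell next_head next_symbol) ?s) (gs1 @ gs2) (L + i * B * G) ?d e"
      by blast
    have "L + i * B * G + B * G = L + Suc i * B * G" by (simp add: add_mult_distrib)
    then have "Row (L + W) (cfg (Suc t)) (Suc i) (sem ?body ?s) (gs1 @ gs2) (L + Suc i * B * G) ?d e"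
      using Row_advance[OF R2, of B] by (simp only: sem.simps(4))
    moreover have "row_ok (vals (gs1 @ gs2) u) L (cfg t u)" if "length u = n0" for u
      using row1[OF that] R that by (intro row_ok_vals) (auto simp: Row_def)
    ultimately show ?case unfolding funpow.simps o_apply by blast
  qed
  let ?s1 = "sem (Loop 7 ?body) (sem row_start s)"
  have "length (sem row_start s 7) = P" using R0 by (simp add: Row_def St_def)
  then obtain gs1 where R1: "Row (L + W) (cfg (Suc t)) P ?s1 gs1 ?d ?d e"
    and row1: "\<And>u. length u = n0 \<Longrightarrow> row_ok (vals gs1 u) L (cfg t u)"
    using loop[OF order_refl] by (auto simp only: sem_Loop)
  have s3: "length (?s1 3) = ?d" and len1: "L + W \<le> n0 + length gs1" using R1 by (auto simp: Row_def St_def)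
  have row1': "row_ok (vals (gs1 @ gs') u) L (cfg t u)" if "length u = n0" for u gs'
    using row1[OF that] len1 that by (intro row_ok_vals) auto
  have refs: "fst y \<in> {1, 2, 3, 4, 5} \<and> addr ?s1 y < n0 + length gs1"
    if hyp: "q < Q" "m \<in> set (next_state q)" "y \<in> set m" for q m y
  proof -
    obtain z where "z \<in> set zs" "y \<in> set (select z)" using hyp by (auto simp: next_state_def)
    then have "fst y = 3 \<and> addr ?s1 y < L + W" by (rule select_refs[of _ _ ?s1, OF _ _ s3])
    then show ?thesis using len1 by auto
  qed
  have sem: "pv ?s1 (vals (gs1 @ gs') u) (next_state q) = of_bool (q = fst (cfg (Suc t) u))"
    if u: "length u = n0" "q < Q" for u gs' q
  proof -
    let ?v = "vals (gs1 @ gs') u" and ?z = "(fst (cfg t u), map read_tape (snd (cfg t u)))"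
    have k0: "0 < k" using k_pos by simp
    note z = gstep_nth[OF valid_cfg[of t u] k0 refl]
    have "pv ?s1 ?v (next_state q) = (\<Sum>z\<leftarrow>filter (\<lambda>z. fst (delta (fst z) (snd z)) = q) zs. of_bool (z = ?z) * 1)"
      unfolding pv_def next_state_def map_map o_def
    proof (intro arg_cong[of _ _ sum_list] map_cong refl)
      fix z assume "z \<in> set (filter (\<lambda>z. fst (delta (fst z) (snd z)) = q) zs)"
      then have "z \<in> set zs" by simp
      then show "(\<Prod>y\<leftarrow>select z. ?v ! addr ?s1 y) = of_bool (z = ?z) * 1"
        using t by (simp only: mult_1_right, intro select_value[of _ _ _ ?s1, OF row1'[OF u(1)] valid_cfg _ s3] head_range(2)) auto
    qed
    also have "\<dots> = (if fst (delta (fst ?z) (snd ?z)) = q then 1 else 0)"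
      by (rule sum_list_filter_select[OF distinct_zs z(3)])
    also have "fst (delta (fst ?z) (snd ?z)) = fst (cfg (Suc t) u)"
      using z(2) by (simp only: cfg_def funpow.simps o_apply)
    finally show ?thesis by (cases "q = fst (cfg (Suc t) u)") auto
  qed
  obtain gs2 where gs2: "St (sem (row_end next_state) ?s1) (gs1 @ gs2) ?d (L + W + W) ?d e"
    "n0 + length (gs1 @ gs2) = L + W + W"
    "\<And>u. length u = n0 \<Longrightarrow> row_ok (vals (gs1 @ gs2) u) (L + W) (cfg (Suc t) u)"
  proof (rule Row_end[OF R1, where qf = next_state])
    fix gs' assume "St (sem (row_end next_state) ?s1) (gs1 @ gs') ?d (L + W + W) ?d e"
      "n0 + length (gs1 @ gs') = L + W + W"
      "\<And>u. length u = n0 \<Longrightarrow> row_ok (vals (gs1 @ gs') u) (L + W) (cfg (Suc t) u)"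
    then show thesis by (rule that)
  qed (use refs psize_next_state sem in blast)+
  let ?s2 = "sem (advance 1 (2 * B + Q)) (sem (row_end next_state) ?s1)"
  have St2: "St ?s2 (gs1 @ gs2) (L + W) (L + W + W) ?d e"
    using St_advance(1)[OF gs2(1), of "2 * B + Q"] by (simp only: three_cells_le_W(2))
  have "St ((sem (advance 3 B) ^^ i) ?s2) (gs1 @ gs2) (L + W) (L + W + W) (?d + i * (B * G)) e" for i
  proof (induction i)
    case (Suc i)
    from St_advance(2)[OF this, of B] show ?case by (simp add: algebra_simps)
  qed (use St2 in simp)
  from this[of P] have "St (sem (Loop 7 (advance 3 B)) ?s2) (gs1 @ gs2) (L + W) (L + W + W) (?d + P * (B * G)) e"
    using St2 by (simp add: sem_Loop St_def)
  from St_advance(2)[OF this, of "2 * B + Q"]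
  have "St (sem next_row s) (gs1 @ gs2) (L + W) (L + W + W) (?d + P * (B * G) + (2 * B + Q) * G) e"
    by (simp only: next_row_def sem.simps(4))
  moreover have "?d + P * (B * G) + (2 * B + Q) * G = L + W + P * B * G"
    unfolding mult.assoc[symmetric] using three_cells_le_W(2)[of L] by linarith
  ultimately have "St (sem next_row s) (gs1 @ gs2) (L + W) (L + W + W) (L + W + P * B * G) e" by (simp only:)
  then show thesis using gs2(2,3) by (rule that)
qed

lemma start_nth: "j < k \<Longrightarrow> snd (cfg 0 u) ! j = (if j = 0 then fst (input_tape (word u)) else (\<lambda>_. 0), -1)"
  by (cases j) (auto simp: cfg_def start_config_def)

lemma pv_const: "pv s v (const_poly b) = of_bool b"
  by (simp add: const_poly_def)

lemma psize_const: "psize (const_poly b) < G"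
  using psize_constant by (simp add: const_poly_def)

lemma const_poly_refs: "ys \<in> set (const_poly b) \<Longrightarrow> y \<notin> set ys"
  by (auto simp: const_poly_def split: if_splits)

lemma fixed_cell:
  assumes R: "Row n0 (cfg 0) i s gs a d e" and b: "b \<longleftrightarrow> pos (Suc i) = -1"
    and c: "\<And>u. length u = n0 \<Longrightarrow> fst (input_tape (word u)) (pos (Suc i)) = c"
  shows "\<exists>gs'. Row n0 (cfg 0) (Suc i) (sem (fixed_cell b c) s) gs' a d e"
proof -
  have 1: "fst y \<in> {1, 2, 3, 4, 5} \<and> addr s y < n0 + length gs"
    if "j < k" "m \<in> set (const_poly b)" "y \<in> set m" for j m y using that const_poly_refs by blast
  have 2: "fst y \<in> {1, 2, 3, 4, 5} \<and> addr s y < n0 + length gs"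
    if "j < k" "a < Sy" "m \<in> set (fixed_symbol c j a)" "y \<in> set m" for j a m y
    using that const_poly_refs unfolding fixed_symbol_def by blast
  have 3: "psize (fixed_symbol c j a) < G" for j a unfolding fixed_symbol_def by (rule psize_const)
  have 4: "pv s (vals (gs @ gs') u) (const_poly b) = of_bool (snd (snd (cfg 0 u) ! j) = pos (Suc i))"
    if "length u = n0" "j < k" for u gs' j using that b by (auto simp: pv_const start_nth)
  have 5: "pv s (vals (gs @ gs') u) (fixed_symbol c j a) = of_bool (fst (snd (cfg 0 u) ! j) (pos (Suc i)) = a)"
    if "length u = n0" "j < k" "a < Sy" for u gs' j a
    using that c[of u] by (auto simp: fixed_symbol_def pv_const start_nth)
  obtain gs' where "Row n0 (cfg 0) (Suc i) (sem (emit_cell (\<lambda>_. const_poly b) (fixed_symbol c)) s) (gs @ gs') a d e"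
    by (rule Row_cell[OF R, where hf = "\<lambda>_. const_poly b" and sf = "fixed_symbol c", OF 1 2 psize_const 3 4 5])
  then show ?thesis unfolding fixed_cell_def by blast
qed

lemma input_tape_nth: "fst (input_tape y) (int i) = (if i < length y then bit_symbol (y ! i) else 0)"
  "p < 0 \<Longrightarrow> fst (input_tape y) p = 0"
  by (auto simp: input_tape_def)

lemma length_pairs: "length (concat (map (\<lambda>b. [True, b]) y)) = 2 * length y"
  by (induction y) auto

lemma nth_pairs:
  "p < length y \<Longrightarrow> concat (map (\<lambda>b. [True, b]) y) ! (2 * p) \<and>
   concat (map (\<lambda>b. [True, b]) y) ! Suc (2 * p) = y ! p"
proof (induction y arbitrary: p)
  case (Cons b y)
  then show ?case by (cases p) auto
qed simp

lemma word_nth: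
  assumes "length u = n0"
  shows "length (word u) = ell" "p < length x \<Longrightarrow> word u ! (2 * p)" "p < length x \<Longrightarrow> word u ! Suc (2 * p) = x ! p"
    "\<not> word u ! (2 * length x)" "p < m \<Longrightarrow> word u ! (2 * length x + 1 + p) \<longleftrightarrow> u ! (2 + p) = 1"
  using assms nth_pairs[of p x] by (auto simp: word_def pair_string_def length_pairs ell_def n0_def nth_append)

lemma input_cell:
  assumes R: "Row n0 (cfg 0) i s gs a d (2 + p)" and p: "p < m" and i: "pos (Suc i) = int (2 * length x + 1 + p)"
  shows "\<exists>gs'. Row n0 (cfg 0) (Suc i) (sem input_cell s) gs' a d (2 + Suc p)"
proof -
  have s4: "addr s (4, 0) = 2 + p" using R by (simp add: Row_def St_def addr_def)
  have lt: "2 + p < n0" using p by (simp add: n0_def)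
  have 1: "fst y \<in> {1, 2, 3, 4, 5} \<and> addr s y < n0 + length gs"
    if "j < k" "m \<in> set (const_poly False)" "y \<in> set m" for j m y using that const_poly_refs by blast
  have 2: "fst y \<in> {1, 2, 3, 4, 5} \<and> addr s y < n0 + length gs"
    if "j < k" "a < Sy" "m \<in> set (input_symbol j a)" "y \<in> set m" for j a m y
    using that const_poly_refs s4 lt unfolding input_symbol_def by (auto split: if_splits)
  have 3: "psize (input_symbol j a) < G" for j a
    unfolding input_symbol_def using psize_const psize_constant by (simp add: const_poly_def)
  have 4: "pv s (vals (gs @ gs') u) (const_poly False) = of_bool (snd (snd (cfg 0 u) ! j) = pos (Suc i))"
    if "length u = n0" "j < k" for u gs' j using that i by (auto simp: pv_const start_nth)
  have 5: "pv s (vals (gs @ gs') u) (input_symbol j a) = of_bool (fst (snd (cfg 0 u) ! j) (pos (Suc i)) = a)"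
    if u: "length u = n0" "j < k" "a < Sy" for u gs' j a
  proof -
    have v: "vals (gs @ gs') u ! (2 + p) = u ! (2 + p)" using lt u(1) by (intro vals_nth) simp
    have "2 * length x + 1 + p < length (word u)" using word_nth(1)[OF u(1)] p by (simp add: ell_def)
    then have "fst (input_tape (word u)) (pos (Suc i)) = bit_symbol (u ! (2 + p) = 1)"
      unfolding i input_tape_nth(1) using word_nth(5)[OF u(1) p] by (simp only: if_True)
    then show ?thesis
      using u(2) v by (cases "u ! (2 + p)") (auto simp: input_symbol_def pv_const start_nth s4 bit_symbol_def)
  qed
  obtain gs' where "Row n0 (cfg 0) (Suc i) (sem (emit_cell (\<lambda>_. const_poly False) input_symbol) s) (gs @ gs') a d (2 + p)"
    by (rule Row_cell[OF R, where hf = "\<lambda>_. const_poly False" and sf = input_symbol, OF 1 2 psize_const 3 4 5])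
  then have "Row n0 (cfg 0) (Suc i) (sem input_cell s) (gs @ gs') a d (2 + Suc p)"
    using regs_distinct by (simp add: Row_def St_def emitted_def input_cell_def)
  then show ?thesis by blast
qed

lemma blank_loop:
  assumes "Row n0 (cfg 0) i s gs a d e"
    and "\<And>i' u. i \<le> i' \<Longrightarrow> i' < i + n \<Longrightarrow> length u = n0 \<Longrightarrow>
      pos (Suc i') \<noteq> -1 \<and> fst (input_tape (word u)) (pos (Suc i')) = 0"
  shows "\<exists>gs'. Row n0 (cfg 0) (i + n) ((sem (fixed_cell False 0) ^^ n) s) gs' a d e"
  using assms(2)
proof (induction n)
  case 0
  then show ?case using assms(1) by auto
next
  case (Suc n)
  then obtain gs' where R: "Row n0 (cfg 0) (i + n) ((sem (fixed_cell False 0) ^^ n) s) gs' a d e" by auto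
  have "pos (Suc (i + n)) \<noteq> -1" using Suc.prems[of "i + n" "replicate n0 0"] by simp
  with fixed_cell[OF R, of False 0] Suc.prems[of "i + n"] show ?case by simp
qed

lemma first_row:
  assumes St: "St s [] n0 n0 (n0 + P * B * G) 2"
  shows "\<exists>gs. St (sem first_row s) gs n0 (n0 + W) (n0 + P * B * G) (2 + m) \<and> n0 + length gs = n0 + W \<and>
    (\<forall>u. length u = n0 \<longrightarrow> row_ok (vals gs u) n0 (cfg 0 u))"
proof -
  let ?d = "n0 + P * B * G"
  obtain gs0 where R0: "Row n0 (cfg 0) 0 (sem row_start s) ([] @ gs0) n0 ?d 2"
    using Row_start[OF St, of "cfg 0"] head_range(1)[of 0] by auto
  let ?s1 = "sem (Loop TT (fixed_cell False 0)) (sem row_start s)"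
  have "length (sem row_start s TT) = T'" using R0 by (simp add: Row_def St_def)
  moreover have "\<exists>gs'. Row n0 (cfg 0) (0 + T') ((sem (fixed_cell False 0) ^^ T') (sem row_start s)) gs' n0 ?d 2"
    by (rule blank_loop[OF R0]) (auto simp: pos_def input_tape_nth(2))
  ultimately obtain gs1 where R1: "Row n0 (cfg 0) T' ?s1 gs1 n0 ?d 2" by (auto simp: sem_Loop)
  let ?s2 = "sem (fixed_cell True 0) ?s1"
  obtain gs2 where R2: "Row n0 (cfg 0) (Suc T') ?s2 gs2 n0 ?d 2"
    using fixed_cell[OF R1, of True 0] by (auto simp: pos_def input_tape_nth(2))
  let ?c1 = "fixed_cell False 2 ;; fixed_cell False 1" and ?c2 = "fixed_cell False 2 ;; fixed_cell False 2"
  \<comment> \<open>Every bit of \<open>x\<close> fills two cells, the flag 1 and the bit itself, so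
    a prefix of \<open>x\<close> accounts for twice its length.\<close>
  have X: "\<exists>gs'. Row n0 (cfg 0) (Suc T' + 2 * length x) (sweep ?c1 ?c2 (map bit_symbol ys) s) gs' n0 ?d 2"
    if "x = pre @ ys" "Row n0 (cfg 0) (Suc T' + 2 * length pre) s gs n0 ?d 2" for pre ys s gs
    using that
  proof (induction ys arbitrary: pre s gs)
    case Nil
    then show ?case by auto
  next
    case (Cons b ys)
    let ?i = "Suc T' + 2 * length pre"
    have p: "length pre < length x" "x ! length pre = b" using Cons.prems(1) by auto
    have pos1: "pos (Suc ?i) = int (2 * length pre)" "pos (Suc (Suc ?i)) = int (Suc (2 * length pre))" by (simp_all add: pos_def)
    have n1: "False \<longleftrightarrow> pos (Suc ?i) = -1" "False \<longleftrightarrow> pos (Suc (Suc ?i)) = -1" by (simp_all add: pos_def)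
    have c2: "fst (input_tape (word u)) (pos (Suc ?i)) = 2" if "length u = n0" for u
      unfolding pos1 input_tape_nth(1) using word_nth(1)[OF that] word_nth(2)[OF that, of "length pre"] p by (simp add: ell_def bit_symbol_def)
    from fixed_cell[OF Cons.prems(2) n1(1) c2] obtain gs3 where
      R3: "Row n0 (cfg 0) (Suc ?i) (sem (fixed_cell False 2) s) gs3 n0 ?d 2" by blast
    have c: "fst (input_tape (word u)) (pos (Suc (Suc ?i))) = bit_symbol b" if "length u = n0" for u
      unfolding pos1 input_tape_nth(1) using word_nth(1)[OF that] word_nth(3)[OF that, of "length pre"] p by (simp add: ell_def)
    from fixed_cell[OF R3 n1(2) c] obtain gs4 where
      R4: "Row n0 (cfg 0) (Suc (Suc ?i)) (sem (fixed_cell False (bit_symbol b)) (sem (fixed_cell False 2) s)) gs4 n0 ?d 2"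
      by blast
    have "Suc (Suc ?i) = Suc T' + 2 * length (pre @ [b])" by simp
    with R4 have "\<exists>gs'. Row n0 (cfg 0) (Suc T' + 2 * length x)
        (sweep ?c1 ?c2 (map bit_symbol ys) (sem (fixed_cell False (bit_symbol b)) (sem (fixed_cell False 2) s))) gs' n0 ?d 2"
      using Cons.prems(1) by (intro Cons.IH[of "pre @ [b]"]) simp_all
    moreover have "bit_symbol True = 2" "bit_symbol False = 1" by (simp_all add: bit_symbol_def)
    ultimately show ?case by (cases b) simp_all
  qed
  let ?s3 = "sem (For 0 ?c1 ?c2) ?s2"
  have "?s2 0 = map bit_symbol x" using R2 by (simp add: Row_def St_def)
  then have "?s3 = sweep ?c1 ?c2 (map bit_symbol x) ?s2" by (simp only: sem.simps)
  with X[of "[]" x ?s2 gs2] R2 obtain gs3 where R3: "Row n0 (cfg 0) (Suc T' + 2 * length x) ?s3 gs3 n0 ?d 2" by auto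
  let ?s4 = "sem (fixed_cell False 1) ?s3" and ?i4 = "T' + 2 + 2 * length x"
  have pos4: "pos (Suc (Suc T' + 2 * length x)) = int (2 * length x)" by (simp add: pos_def)
  have n4: "False \<longleftrightarrow> pos (Suc (Suc T' + 2 * length x)) = -1" by (simp add: pos_def)
  have c4: "fst (input_tape (word u)) (pos (Suc (Suc T' + 2 * length x))) = 1" if "length u = n0" for u
    unfolding pos4 input_tape_nth(1) using word_nth(1,4)[OF that] by (simp add: ell_def bit_symbol_def)
  from fixed_cell[OF R3 n4 c4] obtain gs4 where R4: "Row n0 (cfg 0) ?i4 ?s4 gs4 n0 ?d (2 + 0)" by auto
  have "\<exists>gs'. Row n0 (cfg 0) (?i4 + p) ((sem input_cell ^^ p) ?s4) gs' n0 ?d (2 + p)" if "p \<le> m" for p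
    using that
  proof (induction p)
    case (Suc p)
    then obtain gs' where R: "Row n0 (cfg 0) (?i4 + p) ((sem input_cell ^^ p) ?s4) gs' n0 ?d (2 + p)" by auto
    have "pos (Suc (?i4 + p)) = int (2 * length x + 1 + p)" by (simp add: pos_def)
    from input_cell[OF R _ this] Suc.prems show ?case by simp
  qed (use R4 in auto)
  from this[of m] obtain gs5 where R5: "Row n0 (cfg 0) (?i4 + m) (sem (Loop MM input_cell) ?s4) gs5 n0 ?d (2 + m)"
    using R4 by (auto simp: sem_Loop Row_def St_def)
  let ?s5 = "sem (Loop MM input_cell) ?s4" and ?s6 = "sem (Loop TT (fixed_cell False 0)) (sem (Loop MM input_cell) ?s4)"
  have "\<exists>gs'. Row n0 (cfg 0) (?i4 + m + T') ((sem (fixed_cell False 0) ^^ T') ?s5) gs' n0 ?d (2 + m)"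
  proof (rule blank_loop[OF R5])
    fix i' and u :: "bit list" assume i': "?i4 + m \<le> i'" and u: "length u = n0"
    have "pos (Suc i') = int (Suc i' - T' - 2)" using i' by (simp add: pos_def of_nat_diff)
    moreover have "\<not> Suc i' - T' - 2 < length (word u)" using i' word_nth(1)[OF u] by (simp add: ell_def)
    ultimately show "pos (Suc i') \<noteq> -1 \<and> fst (input_tape (word u)) (pos (Suc i')) = 0"
      by (simp add: input_tape_nth(1))
  qed
  moreover have "?i4 + m + T' = P" by (simp add: P_def ell_def)
  moreover have "length (?s5 TT) = T'" using R5 by (simp add: Row_def St_def)
  ultimately obtain gs6 where R6: "Row n0 (cfg 0) P ?s6 gs6 n0 ?d (2 + m)" by (auto simp: sem_Loop)
  have refs: "fst y \<in> {1, 2, 3, 4, 5} \<and> addr ?s6 y < n0 + length gs6"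
    if "q < Q" "m \<in> set (const_poly (q = num_states M))" "y \<in> set m" for q m y
    using that const_poly_refs by blast
  have sem: "pv ?s6 (vals (gs6 @ gs') u) (const_poly (q = num_states M)) = of_bool (q = fst (cfg 0 u))"
    if "length u = n0" "q < Q" for u gs' q by (simp add: pv_const cfg_def start_config_def)
  show ?thesis
  proof (rule Row_end[OF R6, where qf = "\<lambda>q. const_poly (q = num_states M)"])
    fix gs7
    assume "St (sem (row_end (\<lambda>q. const_poly (q = num_states M))) ?s6) (gs6 @ gs7) n0 (n0 + W) ?d (2 + m)"
      "n0 + length (gs6 @ gs7) = n0 + W" "\<And>u. length u = n0 \<Longrightarrow> row_ok (vals (gs6 @ gs7) u) n0 (cfg 0 u)"
    then show ?thesis unfolding first_row_def sem.simps(4) by blast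
  qed (use refs psize_const sem in blast)+
qed

text \<open>Row \<open>t\<close> describes the configuration after \<open>t\<close> steps. The last
  block multiplies the acceptance bit, that is, symbol 2 in cell 0 of the last tape, by the two
  additional inputs.\<close>

theorem emit_tableau:
  assumes St: "St s [] n0 n0 (n0 + P * B * G) 2"
  shows "\<exists>C. wf_circuit C \<and> num_inputs C = n0 \<and> sem emit_tableau s out = map bit_symbol (encode_circuit C) \<and>
    (\<forall>u. length u = n0 \<longrightarrow> circuit_fun C u = of_bool (fst (last (snd (cfg T' u))) 0 = 2) * (u ! 0 * u ! 1))"
proof -
  let ?s1 = "sem first_row s"
  have loop: "\<exists>gs. St ((sem next_row ^^ t) ?s1) gs (n0 + t * W) (n0 + t * W + W) (n0 + t * W + P * B * G) (2 + m) \<and>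
     n0 + length gs = n0 + t * W + W \<and> (\<forall>u. length u = n0 \<longrightarrow> row_ok (vals gs u) (n0 + t * W) (cfg t u))"
    if "t \<le> T'" for t
    using that
  proof (induction t)
    case 0
    then show ?case using first_row[OF St] by simp
  next
    case (Suc t)
    then obtain gs where gs: "St ((sem next_row ^^ t) ?s1) gs (n0 + t * W) (n0 + t * W + W) (n0 + t * W + P * B * G) (2 + m)"
      "n0 + length gs = n0 + t * W + W" "\<And>u. length u = n0 \<Longrightarrow> row_ok (vals gs u) (n0 + t * W) (cfg t u)"
      by (meson Suc_leD)
    have "t < T'" using Suc.prems by simp
    from next_row[OF gs this] obtain gs' where
      gs': "St (sem next_row ((sem next_row ^^ t) ?s1)) gs' (n0 + t * W + W) (n0 + t * W + W + W) (n0 + t * W + W + P * B * G) (2 + m)"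
      "n0 + length gs' = n0 + t * W + W + W" "\<And>u. length u = n0 \<Longrightarrow> row_ok (vals gs' u) (n0 + t * W + W) (cfg (Suc t) u)"
      by blast
    have eq: "n0 + Suc t * W = n0 + t * W + W" by simp
    show ?case unfolding eq funpow.simps o_apply using gs' by blast
  qed
  let ?L = "n0 + T' * W" and ?s2 = "sem (Loop TT next_row) ?s1"
  have "length (?s1 TT) = T'" using first_row[OF St] by (auto simp: St_def)
  then have "?s2 = (sem next_row ^^ T') ?s1" by (simp only: sem_Loop)
  with loop[OF order_refl] obtain gs where gs: "St ?s2 gs ?L (?L + W) (?L + P * B * G) (2 + m)"
    "n0 + length gs = ?L + W" "\<And>u. length u = n0 \<Longrightarrow> row_ok (vals gs u) ?L (cfg T' u)"
    by auto
  \<comment> \<open>From the beginning of the last row register 1 moves on by \<open>T'\<close>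
    cells; two cells further is cell \<open>T' + 2\<close>, which stands for position 0 of the
    tapes.\<close>
  have "St ((sem (advance 1 B) ^^ i) ?s2) gs (?L + i * B * G) (?L + W) (?L + P * B * G) (2 + m)" for i
  proof (induction i)
    case (Suc i)
    from St_advance(1)[OF this, of B] show ?case by (simp add: algebra_simps)
  qed (use gs(1) in simp)
  moreover let ?s3 = "sem (Loop TT (advance 1 B)) ?s2"
  have "?s3 = (sem (advance 1 B) ^^ T') ?s2" using gs(1) by (simp add: sem_Loop St_def)
  ultimately have St3: "St ?s3 gs (?L + T' * B * G) (?L + W) (?L + P * B * G) (2 + m)" by simp
  let ?ref = "bref 1 (2 * B + sb (k - 1) 2)" and ?mss = "[[[bref 1 (2 * B + sb (k - 1) 2), (5, 0), (5, 1)]]]"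
  have k1: "k - 1 < k" using k_pos by simp
  have two: "2 < Sy" using Sy_ge by simp
  have s31: "length (?s3 1) = ?L + T' * B * G" and s35: "?s3 5 = []" using St3 by (auto simp: St_def)
  have len3: "n0 + length gs = ?L + W + 0 * G" using gs(2) by simp
  have refs: "fst y \<in> {1, 2, 3, 4, 5} \<and> addr ?s3 y < ?L + W + (0 + j) * G"
    if hyp: "j < length ?mss" "ms \<in> set (?mss ! j)" "y \<in> set ms" for j ms y
  proof -
    have n2: "2 \<le> ?L + W" using gs(2) by (simp add: n0_def)
    have "W \<ge> (T' + 3) * B * G"
    proof -
      have "(T' + 3) * B \<le> (P + 2) * B + Q" by (intro trans_le_add1 mult_right_mono) (simp_all add: P_def ell_def T'_def)
      then show ?thesis unfolding W_def by (intro mult_right_mono) auto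
    qed
    then have "?L + T' * B * G + (3 * B) * G \<le> ?L + W" by (simp add: add_mult_distrib)
    then have "addr ?s3 ?ref < ?L + W"
      using bit_less_B(2)[OF k1 two] by (intro addr_bref_less[of ?s3 1, OF s31, of _ "3 * B"]) auto
    moreover have "y \<in> {?ref, (5, 0), (5, 1)}" using hyp by auto
    ultimately show ?thesis using hyp(1) n2 s35 by (auto simp: addr_def bref_def)
  qed
  have size: "psize (?mss ! j) < G" if "j < length ?mss" for j
    using that k_pos by (intro psize_less_G) auto
  let ?s4 = "sem (emit_at 0 ?mss) ?s3"
  obtain gs' where gs': "St ?s4 (gs @ gs') (?L + T' * B * G) (?L + W) (?L + P * B * G) (2 + m)" "length gs' = length ?mss * G"
    "\<And>u j. length u = n0 \<Longrightarrow> j < length ?mss \<Longrightarrow>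
       bv (vals (gs @ gs') u) (?L + W) (0 + j) = pv ?s3 (vals (gs @ gs') u) (?mss ! j)"
    by (rule emit_row[OF St3 len3, where mss = ?mss]) (use refs size in blast)+
  define C where "C = \<lparr>num_inputs = n0, gates = gs @ gs', output_node = ?L + W + (G - 1)\<rparr>"
  have em: "?s4 out = map bit_symbol (encode_nat n0) @ encode_gates (gs @ gs')" "wf_gates n0 (gs @ gs')"
    using gs'(1) by (auto simp: St_def emitted_def)
  have "wf_circuit C"
    using em(2) gs(2) gs'(2) G_pos by (simp add: wf_circuit_def C_def wf_gates_def)
  moreover have "num_inputs C = n0" by (simp add: C_def)
  moreover have "sem emit_tableau s out = map bit_symbol (encode_circuit C)"
  proof -
    have a: "appends (pushes out [1, 1] ;; emit_ref (2, G - 1)) (\<lambda>s. [1, 1] @ map bit_symbol (encode_nat (addr s (2, G - 1))))"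
      by (intro appends_Seq appends_pushes appends_emit_ref) simp
    have "sem emit_tableau s = sem (pushes out [1, 1] ;; emit_ref (2, G - 1)) ?s4"
      by (simp only: emit_tableau_def finish_def sem.simps(4))
    moreover have "addr ?s4 (2, G - 1) = ?L + W + (G - 1)" using gs'(1) by (simp add: St_def addr_def)
    ultimately have "sem emit_tableau s out = ?s4 out @ [1, 1] @ map bit_symbol (encode_nat (?L + W + (G - 1)))"
      using a by (simp only: appends_def fun_upd_same)
    then show ?thesis
      unfolding em(1) by (simp add: encode_circuit_def C_def encode_gates_def bit_symbol_def)
  qed
  moreover have "circuit_fun C u = of_bool (fst (last (snd (cfg T' u))) 0 = 2) * (u ! 0 * u ! 1)" if u: "length u = n0" for u
  proof -
    let ?v = "vals (gs @ gs') u"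
    have row: "row_ok ?v ?L (cfg T' u)" using gs(3)[OF u] gs(2) u by (intro row_ok_vals) auto
    have "circuit_fun C u = bv ?v (?L + W) 0"
      by (simp add: circuit_fun_def node_values_def C_def bv_def vals_def)
    also have "\<dots> = pv ?s3 ?v [[?ref, (5, 0), (5, 1)]]" using gs'(3)[OF u, of 0] by (simp del: pv_simps vals_append)
    also have "\<dots> = bv ?v (?L + T' * B * G) (2 * B + sb (k - 1) 2) * (?v ! 0 * ?v ! 1)"
      using s31 s35 by (simp only: pv_simps list.map prod_list.Cons prod_list.Nil mult_1_right nth_addr_bref add_0_right) (simp add: addr_def)
    also have "bv ?v (?L + T' * B * G) (2 * B + sb (k - 1) 2) = bv ?v ?L ((T' + 2) * B + sb (k - 1) 2)"
      unfolding bv_shift by (simp only: add_mult_distrib add.assoc)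
    also have "\<dots> = of_bool (fst (snd (cfg T' u) ! (k - 1)) (pos (T' + 2)) = 2)"
    proof -
      have "T' + 2 \<le> P" by (simp add: P_def ell_def T'_def)
      then have "cell_ok ?v ?L (cfg T' u) (T' + 2)" using row by (simp only: row_ok_def)
      then show ?thesis using k1 two by (simp add: cell_ok_def)
    qed
    also have "snd (cfg T' u) ! (k - 1) = last (snd (cfg T' u))"
    proof -
      have "length (snd (cfg T' u)) = k" using valid_cfg[of T' u] by (simp add: valid_def)
      then show ?thesis using k1 by (subst last_conv_nth) auto
    qed
    also have "pos (T' + 2) = 0" by (simp add: pos_def)
    also have "?v ! 0 = u ! 0" using u by (intro vals_nth) (simp add: n0_def)
    also have "?v ! 1 = u ! 1" using u by (intro vals_nth) (simp add: n0_def)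
    finally show ?thesis .
  qed
  ultimately show ?thesis by blast
qed

end


section \<open>Well-formedness and running time of the reduction\<close>

context tableau
begin

lemma refs_cell:
  assumes "\<And>j m y. m \<in> set (hf j) \<Longrightarrow> y \<in> set m \<Longrightarrow> fst y \<in> {1, 2, 3, 4, 5}"
    "\<And>j a m y. m \<in> set (sf j a) \<Longrightarrow> y \<in> set m \<Longrightarrow> fst y \<in> {1, 2, 3, 4, 5}"
  shows "refs_in {1, 2, 3, 4, 5} (cell hf sf)"
proof -
  have a: "m \<in> set (accumulate j a) \<Longrightarrow> y \<in> set m \<Longrightarrow> fst y \<in> {1, 2, 3, 4, 5}" for j a m y
    by (auto simp: accumulate_def bref_def)
  show ?thesis unfolding refs_in_def
  proof (intro ballI)
    fix ms m y assume "ms \<in> set (cell hf sf)" and m: "m \<in> set ms" "y \<in> set m"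
    then obtain i where "ms = (if i mod w = 0 then hf (i div w)
     else if i mod w \<le> Sy then sf (i div w) (i mod w - 1)
     else accumulate (i div w) (i mod w - 1 - Sy))" unfolding cell_def set_map by blast
    then have "m \<in> set (hf (i div w)) \<or> m \<in> set (sf (i div w) (i mod w - 1)) \<or>
        m \<in> set (accumulate (i div w) (i mod w - 1 - Sy))"
      using m(1) by presburger
    then show "fst y \<in> {1, 2, 3, 4, 5}" using m(2) assms a by blast
  qed
qed

lemma refs_const: "m \<in> set (const_poly b) \<Longrightarrow> y \<in> set m \<Longrightarrow> fst y \<in> {1, 2, 3, 4, 5}"
  by (auto simp: const_poly_def split: if_splits)

lemma refs_next_cell: "refs_in {1, 2, 3, 4, 5} (cell next_head next_symbol)"
  by (rule refs_cell) (auto simp: next_head_def next_symbol_def select_def bref_def)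

lemma refs_fixed_cell: "refs_in {1, 2, 3, 4, 5} (cell (\<lambda>_. const_poly b) (fixed_symbol c))"
  unfolding fixed_symbol_def by (rule refs_cell) (rule refs_const; assumption)+

lemma refs_input_cell: "refs_in {1, 2, 3, 4, 5} (cell (\<lambda>_. const_poly False) input_symbol)"
  by (rule refs_cell) (auto simp: input_symbol_def const_poly_def split: if_splits)

lemma refs_others:
  "refs_in {1, 2, 3, 4, 5} (replicate n [])"
  "refs_in {1, 2, 3, 4, 5} (map next_state [0..<Q])"
  "refs_in {1, 2, 3, 4, 5} (map (\<lambda>q. const_poly (q = num_states M)) [0..<Q])"
  "refs_in {1, 2, 3, 4, 5} [[[bref 1 (2 * B + sb (k - 1) 2), (5, 0), (5, 1)]]]"
  by (auto simp: refs_in_def next_state_def select_def bref_def const_poly_def split: if_splits)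

lemmas refs_all = refs_next_cell refs_fixed_cell refs_input_cell refs_others

lemma regs_emit_at: "refs_in {1, 2, 3, 4, 5} mss \<Longrightarrow> regs (emit_at i mss) \<subseteq> {1, 2, 3, 4, 5, out}"
  unfolding emit_at_def using regs_emit_blocks[of "(2, i * G)" "(5, 0)" mss G] by auto

lemma regs_advance: "regs (advance r i) \<subseteq> {r}"
  unfolding advance_def by (rule regs_pushes)

lemma regs_emit_cell: "refs_in {1, 2, 3, 4, 5} (cell hf sf) \<Longrightarrow> regs (emit_cell hf sf) \<subseteq> {1, 2, 3, 4, 5, out}"
  unfolding emit_cell_def using regs_emit_at[of "cell hf sf" B] regs_advance[of 2 B] by auto

lemma regs_row:
  "regs row_start \<subseteq> {1, 2, 3, 4, 5, out}"
  "refs_in {1, 2, 3, 4, 5} (map qf [0..<Q]) \<Longrightarrow> regs (row_end qf) \<subseteq> {1, 2, 3, 4, 5, out}"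
proof -
  show "regs row_start \<subseteq> {1, 2, 3, 4, 5, out}" unfolding row_start_def by (intro regs_emit_at refs_others)
  assume "refs_in {1, 2, 3, 4, 5} (map qf [0..<Q])"
  from regs_emit_at[OF this, of "2 * B"] regs_emit_at[OF refs_others(1), of B B] regs_advance[of 2 "2 * B + Q"]
  show "regs (row_end qf) \<subseteq> {1, 2, 3, 4, 5, out}" unfolding row_end_def by auto
qed

lemma regs_cells:
  "regs (emit_cell next_head next_symbol) \<subseteq> {1, 2, 3, 4, 5, out}"
  "regs (fixed_cell b c) \<subseteq> {1, 2, 3, 4, 5, out}" "regs input_cell \<subseteq> {1, 2, 3, 4, 5, out}"
  unfolding fixed_cell_def input_cell_def
  using regs_emit_cell[OF refs_next_cell] regs_emit_cell[OF refs_fixed_cell] regs_emit_cell[OF refs_input_cell]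
  by auto

lemma regs_next_row: "regs next_row \<subseteq> {1, 2, 3, 4, 5, 7, out}"
proof -
  have "regs row_start \<subseteq> {1, 2, 3, 4, 5, 7, out}" "regs (row_end next_state) \<subseteq> {1, 2, 3, 4, 5, 7, out}"
    "regs (emit_cell next_head next_symbol) \<subseteq> {1, 2, 3, 4, 5, 7, out}"
    "\<And>i. regs (advance 1 i) \<subseteq> {1, 2, 3, 4, 5, 7, out}" "\<And>i. regs (advance 3 i) \<subseteq> {1, 2, 3, 4, 5, 7, out}"
    using regs_row(1) regs_row(2)[OF refs_others(2)] regs_cells(1) regs_advance by blast+
  then show ?thesis unfolding next_row_def regs.simps regs_Loop by (intro Un_least insert_subsetI) simp_all
qed

lemma notin_regs:
  assumes "r \<notin> {1, 2, 3, 4, 5, 7, out}"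
  shows "r \<notin> regs next_row" "r \<notin> regs (fixed_cell b c)" "r \<notin> regs input_cell"
  using assms regs_next_row regs_cells by blast+

lemma seven_notin: "7 \<notin> regs (emit_cell next_head next_symbol)" "7 \<notin> regs (advance 1 i)" "7 \<notin> regs (advance 3 i)"
  using regs_cells(1) regs_advance[of 1 i] regs_advance[of 3 i] regs_distinct by auto

lemma wfc_emit_tableau:
  assumes K: "out < K" "MM < K" "TT < K"
  shows "wfc K 3 emit_tableau"
proof -
  have R: "r < K" if "r \<in> {1, 2, 3, 4, 5 :: nat}" for r using that K regs_distinct by auto
  have at: "wfc K 3 (emit_at i mss)" if "refs_in {1, 2, 3, 4, 5} mss" for i mss
    unfolding emit_at_def using that K(1) R by (intro wfc_emit_blocks) auto
  have adv: "wfc K 3 (advance r i)" if "r < K" for r i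
    unfolding advance_def using that by (intro wfc_pushes) auto
  have less: "1 < K" "2 < K" "3 < K" "4 < K" "7 < K" "0 < K" using K regs_distinct by auto
  have cells: "wfc K 3 (emit_cell next_head next_symbol)" "wfc K 3 (fixed_cell b c)" "wfc K 3 input_cell" for b c
    unfolding fixed_cell_def input_cell_def emit_cell_def using at refs_all adv less by auto
  have rows: "wfc K 3 row_start" "wfc K 3 (row_end next_state)" "wfc K 3 (row_end (\<lambda>q. const_poly (q = num_states M)))"
    unfolding row_start_def row_end_def wfc.simps by (intro conjI at adv refs_all less)+
  have nr: "wfc K 3 next_row"
    unfolding next_row_def wfc.simps wfc_Loop regs.simps using cells rows adv less seven_notin by blast
  have fr: "wfc K 3 first_row"
    unfolding first_row_def wfc.simps wfc_Loop regs.simps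
    using cells rows less K notin_regs[of TT] notin_regs[of MM] notin_regs[of 0] regs_distinct by simp
  have "wfc K 3 (pushes out [1, 1])" using K by (intro wfc_pushes) auto
  moreover have "wfc K 3 (emit_ref (2, G - 1))" using K R by (intro wfc_emit_ref) auto
  moreover have "TT \<notin> regs (advance 1 B)" using regs_advance[of 1 B] regs_distinct by auto
  ultimately have "wfc K 3 finish"
    unfolding finish_def wfc.simps wfc_Loop using at[OF refs_others(4)] adv less K by blast
  then show ?thesis
    unfolding emit_tableau_def wfc.simps wfc_Loop using fr nr K notin_regs(1)[of TT] regs_distinct by simp
qed

text \<open>The registers of level 0 are complete before this stage. Register 7 is filled by loops
  over them, the pointers advance inside loops over 7, and references are written to
  \<open>out\<close> by loops over the pointers.\<close>

definition level :: "nat \<Rightarrow> nat" where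
  "level r = (if r = 7 then 1 else if r \<in> {1, 2, 3, 4} then 2 else if r = out then 3 else 0)"

abbreviation clocked_level :: "nat option \<Rightarrow> nat" where
  "clocked_level \<equiv> \<lambda>q. case q of None \<Rightarrow> 4 | Some r \<Rightarrow> level r"

lemma level_simps:
  "level 0 = 0" "level (Suc 0) = 2" "level 2 = 2" "level 3 = 2" "level 4 = 2" "level 5 = 0" "level 6 = 0"
  "level 7 = 1" "level out = 3" "level MM = 0" "level TT = 0"
  using regs_distinct by (auto simp: level_def)

lemma lvok_emit_tableau: "lvok clocked_level 0 emit_tableau"
proof -
  have at: "lvok clocked_level l (emit_at i mss)" if "refs_in {1, 2, 3, 4, 5} mss" "l \<le> 3" for l i mss
    unfolding emit_at_def using that by (intro lvok_emit_blocks) (auto simp: level_simps)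
  have adv: "lvok clocked_level l (advance r i)" if "l \<le> level r" for l r i
    unfolding advance_def using that by (intro lvok_pushes) simp
  have cells: "lvok clocked_level l (emit_cell next_head next_symbol)" "lvok clocked_level l (fixed_cell b c)"
    "lvok clocked_level l input_cell" if "l \<le> 2" for l b c
    unfolding fixed_cell_def input_cell_def emit_cell_def using that at refs_all adv[of l 2] by (auto simp: level_simps)
  have rows: "lvok clocked_level l row_start" "lvok clocked_level l (row_end next_state)"
    "lvok clocked_level l (row_end (\<lambda>q. const_poly (q = num_states M)))" if "l \<le> 2" for l
    unfolding row_start_def row_end_def lvok.simps using that at refs_all adv[of l 2] by (auto simp: level_simps)
  have "lvok clocked_level 1 next_row"
    unfolding next_row_def using cells rows adv by (simp add: level_simps)
  moreover have "lvok clocked_level 0 first_row"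
    unfolding first_row_def using cells rows by (simp add: level_simps)
  moreover have "lvok clocked_level 0 (pushes out [1, 1])" "lvok clocked_level 0 (emit_ref (2, G - 1))"
    by (intro lvok_pushes, simp) (intro lvok_emit_ref, auto simp: level_simps)
  ultimately show ?thesis
    unfolding emit_tableau_def finish_def using at[OF refs_others(4)] adv by (simp add: level_simps)
qed

text \<open>Register 7 receives \<open>P\<close>; the registers 1 to 3 receive the number of inputs,
  which is the first node of the first row; 4 receives 2, the node of the first witness bit;
  \<open>out\<close> receives the encoded number of inputs. Finally 3 is moved to the last cell of
  the first row.\<close>

definition prepare :: com where
  "prepare = Loop TT (Push 7 1) ;; Push 7 1 ;; Loop 6 (Push 7 1) ;; Loop TT (Push 7 1) ;;
     Loop MM (Push 1 1) ;; Loop MM (Push 2 1) ;; Loop MM (Push 3 1) ;; Loop MM (Push out 2) ;;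
     pushes 1 [1, 1] ;; pushes 2 [1, 1] ;; pushes 3 [1, 1] ;; pushes 4 [1, 1] ;; pushes out [2, 2, 1] ;;
     Loop 7 (advance 3 B)"

lemma poly_time_tableau: "poly_time (prepare ;; emit_tableau)"
proof (rule poly_time_lvok[where L = 4 and lv = level])
  have "lvok clocked_level (Suc (Suc 0)) (advance 3 B)"
    unfolding advance_def by (intro lvok_pushes) (simp add: level_simps)
  then have "lvok clocked_level 0 prepare"
    unfolding prepare_def by (simp add: level_simps lvok_pushes)
  then show "lvok clocked_level 0 (prepare ;; emit_tableau)" using lvok_emit_tableau by simp
  show "level r < 4" for r by (simp add: level_def)
qed

lemma wfc_prepare: "out < K \<Longrightarrow> MM < K \<Longrightarrow> TT < K \<Longrightarrow> wfc K 3 prepare"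
proof -
  assume K: "out < K" "MM < K" "TT < K"
  have "wfc K 3 (advance 3 B)" unfolding advance_def using K regs_distinct by (intro wfc_pushes) auto
  moreover have "wfc K 3 (pushes r xs)" if "r < K" "\<forall>a\<in>set xs. a = 1 \<or> a = 2" for r xs
    using that by (intro wfc_pushes) auto
  ultimately show ?thesis unfolding prepare_def using K regs_distinct seven_notin(3)[of B] by auto
qed

end

section \<open>Unary evaluation of polynomials and the initial registers\<close>

lemma sem_Loop_pushes:
  assumes "r \<noteq> q"
  shows "sem (Loop r (pushes q xs)) s = s(q := s q @ concat (replicate (length (s r)) xs))"
proof -
  have "(sem (pushes q xs) ^^ n) s = s(q := s q @ concat (replicate n xs))" for n
  proof (induction n)
    case (Suc n)
    have "concat (replicate n xs) @ xs = xs @ concat (replicate n xs)" by (induction n) auto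
    then have "sem (pushes q xs) (s(q := s q @ concat (replicate n xs))) = s(q := s q @ concat (replicate (Suc n) xs))"
      by (simp add: sem_pushes)
    then show ?case using Suc by (simp only: funpow.simps o_apply)
  qed simp
  then show ?thesis by (simp add: sem_Loop)
qed

lemma concat_replicate_single: "concat (replicate n [a]) = replicate n a"
  by (induction n) auto

lemma sem_Loop_Push:
  assumes "r \<noteq> q"
  shows "sem (Loop r (Push q a)) s = s(q := s q @ replicate (length (s r)) a)"
proof -
  have "sem (Push q a) = sem (pushes q [a])" by (rule ext) (simp add: pushes_def)
  then show ?thesis
    using sem_Loop_pushes[OF assms, of "[a]" s] by (simp only: sem_Loop concat_replicate_single)
qed

text \<open>Horner's scheme in unary: the nested loops push the product of the length of
  \<open>r\<close> and the value in register \<open>Suc b\<close>, then the coefficient is added.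
  Each coefficient has a register of its own, since registers only get longer here.\<close>

fun horner :: "nat \<Rightarrow> nat \<Rightarrow> nat list \<Rightarrow> com" where
  "horner r b [] = Skip"
| "horner r b (a # cs) = horner r (Suc b) cs ;; Loop r (Loop (Suc b) (Push b 1)) ;; pushes b (replicate a 1)"

lemma writes_horner: "writes (horner r b cs) \<subseteq> {b..<b + length cs}"
proof (induction cs arbitrary: b)
  case (Cons a cs)
  then show ?case using writes_pushes[of b "replicate a 1"] Cons.IH[of "Suc b"] by (fastforce simp: Loop_def)
qed simp

lemma sem_horner:
  assumes "r < b" "\<forall>q\<ge>b. s q = []"
  shows "length (sem (horner r b cs) s b) = poly (Poly cs) (length (s r))"
  using assms
proof (induction cs arbitrary: b)
  case (Cons a cs)
  let ?s = "sem (horner r (Suc b) cs) s"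
  have IH: "length (?s (Suc b)) = poly (Poly cs) (length (s r))" using Cons by simp
  have r: "?s r = s r" "?s b = []"
    using sem_unwritten[of r "horner r (Suc b) cs" s] sem_unwritten[of b "horner r (Suc b) cs" s] Cons.prems
      subsetD[OF writes_horner[of r "Suc b" cs], of r] subsetD[OF writes_horner[of r "Suc b" cs], of b] by auto
  have "(sem (Loop (Suc b) (Push b 1)) ^^ n) ?s = ?s(b := replicate (n * length (?s (Suc b))) 1)" for n
  proof (induction n)
    case (Suc n)
    have "sem (Loop (Suc b) (Push b 1)) (?s(b := replicate (n * length (?s (Suc b))) 1)) =
        ?s(b := replicate (Suc n * length (?s (Suc b))) 1)"
      by (simp add: sem_Loop_Push replicate_add[symmetric] add.commute)
    then show ?case using Suc by (simp only: funpow.simps o_apply)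
  qed (simp add: r(2) fun_upd_idem)
  then show ?case using IH r by (simp add: sem_Loop sem_pushes add.commute)
qed simp

text \<open>Each stage raises only its own register \<open>b\<close> above the others. The levels
  change from stage to stage, so the bound is assembled by \<open>poly_time_Seq\<close>.\<close>

lemma poly_time_horner: "r < b \<Longrightarrow> poly_time (horner r b cs)"
proof (induction cs arbitrary: b)
  case Nil
  show ?case by (rule poly_time_lvok[where L = 1 and lv = "\<lambda>_. 0"]) auto
next
  case (Cons a cs)
  have "poly_time (Loop r (Loop (Suc b) (Push b 1)) ;; pushes b (replicate a 1))"
    by (rule poly_time_lvok[where L = 2 and lv = "\<lambda>q. if q = b then 1 else 0"])
       (use Cons.prems in \<open>auto intro!: lvok_pushes\<close>)
  then show ?case using Cons by (auto intro!: poly_time_Seq)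
qed

lemma wfc_horner: "r < b \<Longrightarrow> b + length cs < K \<Longrightarrow> 2 \<le> S \<Longrightarrow> wfc K S (horner r b cs)"
proof (induction cs arbitrary: b)
  case (Cons a cs)
  then show ?case by (auto intro!: wfc_pushes)
qed simp

lemma (in tableau_run) St_prepare:
  assumes "s 0 = map bit_symbol x" "length (s MM) = m" "length (s TT) = T'" "length (s 6) = ell"
    "\<And>r. r \<in> {1, 2, 3, 4, 5, 7, out} \<Longrightarrow> s r = []"
  shows "St (sem prepare s) [] n0 n0 (n0 + P * B * G) 2"
proof -
  have e: "s 1 = []" "s 2 = []" "s 3 = []" "s 4 = []" "s 5 = []" "s 7 = []" "s out = []" using assms(5) by auto
  have ne: "MM \<noteq> 0" "TT \<noteq> 0" "out \<noteq> 0" "MM \<noteq> Suc 0" "TT \<noteq> Suc 0" "out \<noteq> Suc 0" "MM \<noteq> 2" "TT \<noteq> 2" "out \<noteq> 2"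
    "MM \<noteq> 3" "TT \<noteq> 3" "out \<noteq> 3" "MM \<noteq> 4" "TT \<noteq> 4" "out \<noteq> 4" "MM \<noteq> 5" "TT \<noteq> 5" "out \<noteq> 5" "MM \<noteq> 6" "TT \<noteq> 6" "out \<noteq> 6"
    "MM \<noteq> 7" "TT \<noteq> 7" "out \<noteq> 7" "MM \<noteq> TT" "MM \<noteq> out" "TT \<noteq> out" using regs_distinct by auto
  note ne' = ne ne[symmetric]
  have len: "length (concat (replicate n (replicate c (Suc 0)))) = n * c" for n c
    by (induction n) auto
  have hd: "map bit_symbol (encode_nat (Suc (Suc m))) = replicate m 2 @ [2, 2, Suc 0]"
    by (simp add: encode_nat_def bit_symbol_def replicate_app_Cons_same)
  show ?thesis
    unfolding St_def emitted_def prepare_def advance_def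
    by (simp add: sem_Loop_Push sem_Loop_pushes sem_pushes e assms ne' len n0_def hd)
       (simp add: P_def algebra_simps)
qed

section \<open>Hardness\<close>

text \<open>If \<open>g u\<close> holds, then among the points 0, (1, 0, u), (0, 1, 0) and their sum
  (1, 1, u) only the last one gives 1, which violates the four-point identity. Otherwise
  \<open>f\<close> is zero.\<close>

lemma affine_product_iff:
  fixes g :: "bit list \<Rightarrow> bool"
  assumes f: "\<And>u. length u = m + 2 \<Longrightarrow> f u = of_bool (g (drop 2 u)) * (u ! 0 * u ! 1)"
  shows "affine (m + 2) f \<longleftrightarrow> (\<forall>u. length u = m \<longrightarrow> \<not> g u)"
proof
  assume aff: "affine (m + 2) f"
  show "\<forall>u. length u = m \<longrightarrow> \<not> g u"
  proof (intro allI impI notI)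
    fix u assume u: "length u = m" "g u"
    let ?y = "1 # 0 # u" and ?z = "0 # 1 # replicate m 0"
    have yz: "map2 (+) ?y ?z = 1 # 1 # u"
      using u(1) by (intro nth_equalityI) (auto simp: nth_Cons split: nat.splits)
    have "length ?y = m + 2" "length ?z = m + 2" using u(1) by simp_all
    then have "f (replicate (m + 2) 0) + f ?y + f ?z + f (map2 (+) ?y ?z) = 0"
      using aff unfolding affine_iff_additive by blast
    moreover have "f (replicate (m + 2) 0) = 0" by (subst f) auto
    moreover have "f ?y = 0" "f ?z = 0" using u(1) by (subst f; simp)+
    moreover have "f (1 # 1 # u) = 1" using u by (subst f) auto
    ultimately show False unfolding yz by simp
  qed
next
  assume g: "\<forall>u. length u = m \<longrightarrow> \<not> g u"
  have "f u = 0" if "length u = m + 2" for u using f[OF that] g that by simp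
  then show "affine (m + 2) f"
    unfolding affine_def by (intro exI[of _ "replicate (m + 2) 0"] exI[of _ 0]) (simp del: replicate_Suc)
qed

theorem AFFINE_coNP_hard:
  assumes "L \<in> class_coNP"
  shows "L \<le>\<^sub>p AFFINE"
proof -
  obtain V and p :: "nat poly" where V: "V \<in> class_P"
    and L: "\<And>x. x \<in> - L \<longleftrightarrow> (\<exists>u. length u = poly p (length x) \<and> pair_string x u \<in> V)"
    using assms unfolding class_coNP_def class_NP_def by blast
  obtain M and q :: "nat poly" where M: "wf_tm M" "computes_in_time M (\<lambda>x. [x \<in> V]) (poly q)"
    using V unfolding class_P_def polytime_computable_def by blast
  \<comment> \<open>The evaluation of \<open>p\<close> touches registers 8 to \<open>TT - 1\<close>
    besides the input, and that of \<open>q\<close> touches \<open>TT\<close> to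
    \<open>out - 1\<close> besides register 6, so the stages do not disturb each other.\<close>
  define TT where "TT = 9 + length (coeffs p)"
  define out where "out = Suc (TT + length (coeffs q))"
  interpret tableau M out 8 TT
    using M(1) by unfold_locales (simp_all add: TT_def out_def)
  \<comment> \<open>Leaves the length of the paired string in register 6: twice the length of
    \<open>x\<close>, plus the length of the witness, plus 1. This is the argument of the time bound
    \<open>q\<close>.\<close>
  define count where "count = Loop 0 (pushes 6 [1, 1]) ;; Loop 8 (Push 6 1) ;; Push 6 1"
  \<comment> \<open>The single \<open>Push TT 1\<close> counts the step out of the added start
    state.\<close>
  define red where "red = (horner 0 8 (coeffs p) ;; count) ;; (horner 6 TT (coeffs q) ;; Push TT 1) ;; prepare ;; emit_tableau"
  have "poly_time count"
    by (rule poly_time_lvok[where L = 2 and lv = "\<lambda>q. if q = 6 then 1 else 0"])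
       (auto simp: count_def intro!: lvok_pushes)
  moreover have "poly_time (Push TT 1)"
    by (rule poly_time_lvok[where L = 1 and lv = "\<lambda>_. 0"]) auto
  ultimately have pt: "poly_time red"
    unfolding red_def
    by (intro poly_time_Seq[OF poly_time_Seq poly_time_Seq[OF poly_time_Seq poly_time_tableau]] poly_time_horner)
       (auto simp: TT_def)
  have wf: "wfc (Suc out) 3 red"
  proof -
    have "wfc (Suc out) 3 count"
      unfolding count_def using regs_pushes[of 6 "[1, 1]"] by (auto simp: out_def TT_def intro!: wfc_pushes)
    moreover have "wfc (Suc out) 3 (horner 0 8 (coeffs p))" "wfc (Suc out) 3 (horner 6 TT (coeffs q))"
      by (intro wfc_horner; simp add: out_def TT_def)+
    moreover have "wfc (Suc out) 3 prepare" "wfc (Suc out) 3 emit_tableau"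
      by (intro wfc_prepare wfc_emit_tableau; simp add: out_def TT_def)+
    ultimately show ?thesis by (simp add: red_def out_def)
  qed
  have "\<exists>C. wf_circuit C \<and> sem red (input_store x) out = map bit_symbol (encode_circuit C) \<and>
      (affine (num_inputs C) (circuit_fun C) \<longleftrightarrow> x \<in> L)" for x
  proof -
    define m where "m = poly p (length x)"
    define T where "T = poly q (2 * length x + 1 + m)"
    interpret tableau_run M out 8 TT x m T by unfold_locales
    let ?s0 = "input_store x"
    define s1 where "s1 = sem (horner 0 8 (coeffs p)) ?s0"
    have "s1 r = ?s0 r" if "r \<notin> {8..<TT - 1}" for r
      unfolding s1_def using that subsetD[OF writes_horner[of 0 8 "coeffs p"], of r]
      by (intro sem_unwritten) (auto simp: TT_def)
    then have s1: "s1 0 = map bit_symbol x" "\<And>r. r \<notin> {8..<TT - 1} \<Longrightarrow> r \<noteq> 0 \<Longrightarrow> s1 r = []"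
      by (simp_all add: input_store_def)
    have m: "length (s1 8) = m"
      using sem_horner[of 0 8 ?s0 "coeffs p"] by (simp add: s1_def input_store_def m_def)
    define s2 where "s2 = sem count s1"
    have s2: "length (s2 6) = ell" "\<And>r. r \<noteq> 6 \<Longrightarrow> s2 r = s1 r"
    proof -
      have "length (concat (replicate n [1 :: nat, 1])) = 2 * n" for n by (induction n) auto
      then show "length (s2 6) = ell" "\<And>r. r \<noteq> 6 \<Longrightarrow> s2 r = s1 r"
        using s1(1) s1(2)[of 6] m by (simp_all add: s2_def count_def sem_Loop_pushes sem_Loop_Push ell_def)
    qed
    define s3 where "s3 = sem (horner 6 TT (coeffs q) ;; Push TT 1) s2"
    have s3: "length (s3 TT) = T'" "\<And>r. r \<notin> {TT..<out - 1} \<Longrightarrow> r \<noteq> TT \<Longrightarrow> s3 r = s2 r"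
    proof -
      have "length (sem (horner 6 TT (coeffs q)) s2 TT) = poly (Poly (coeffs q)) (length (s2 6))"
        using s1(2) s2(2) by (intro sem_horner) (auto simp: TT_def)
      also have "\<dots> = T" by (simp only: s2(1) T_def ell_def Poly_coeffs)
      finally show "length (s3 TT) = T'" by (simp add: s3_def T'_def)
      show "s3 r = s2 r" if "r \<notin> {TT..<out - 1}" "r \<noteq> TT" for r
        using that sem_unwritten[of r "horner 6 TT (coeffs q)" s2] subsetD[OF writes_horner[of 6 TT "coeffs q"], of r]
        by (auto simp: s3_def out_def)
    qed
    have St: "St (sem prepare s3) [] n0 n0 (n0 + P * B * G) 2"
    proof (rule St_prepare)
      show "s3 0 = map bit_symbol x" "length (s3 8) = m" "length (s3 6) = ell" "length (s3 TT) = T'"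
        using s1(1) m s2 s3 by (auto simp: TT_def)
      show "s3 r = []" if "r \<in> {1, 2, 3, 4, 5, 7, out}" for r
        using that s1(2)[of r] s2(2)[of r] s3(2)[of r] by (auto simp: TT_def out_def)
    qed
    have red: "sem red ?s0 = sem emit_tableau (sem prepare s3)"
      by (simp add: red_def s1_def s2_def s3_def)
    from emit_tableau[OF St] obtain C where C: "wf_circuit C" "num_inputs C = n0"
      "sem red ?s0 out = map bit_symbol (encode_circuit C)"
      "\<And>u. length u = n0 \<Longrightarrow> circuit_fun C u = of_bool (fst (last (snd (cfg T' u))) 0 = 2) * (u ! 0 * u ! 1)"
      unfolding red by blast
    have acc: "fst (last (snd (cfg T' u))) 0 = 2 \<longleftrightarrow> word u \<in> V" if "length u = n0" for u
    proof -
      have "poly q (length (word u)) = T" using word_nth(1)[OF that] by (simp only: T_def ell_def)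
      \<comment> \<open>The first step only leads to the initial configuration of \<open>M\<close>,
        so \<open>T'\<close> steps amount to \<open>T\<close> steps of \<open>M\<close>.\<close>
      then have "cfg T' u = (step M ^^ poly q (length (word u))) (init_config M (word u))"
        by (simp only: cfg_def T'_def gsteps_Suc_steps)
      then have "tape_holds (last (snd (cfg T' u))) [word u \<in> V]"
        using M(2)[unfolded computes_in_time_def, THEN spec, of "word u"] by (simp add: case_prod_unfold)
      then show ?thesis by (simp add: tape_holds_def bit_symbol_def)
    qed
    have "affine (m + 2) (circuit_fun C) \<longleftrightarrow> (\<forall>u :: bit list. length u = m \<longrightarrow> \<not> pair_string x (map (\<lambda>b. b = 1) u) \<in> V)"
    proof (rule affine_product_iff)
      fix u :: "bit list" assume u: "length u = m + 2"
      then show "circuit_fun C u = of_bool (pair_string x (map (\<lambda>b. b = 1) (drop 2 u)) \<in> V) * (u ! 0 * u ! 1)"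
        using C(4)[of u] acc[of u] by (simp only: n0_def word_def)
    qed
    also have "\<dots> \<longleftrightarrow> x \<in> L"
    proof -
      have "(\<exists>t :: bit list. length t = m \<and> pair_string x (map (\<lambda>b. b = 1) t) \<in> V) \<longleftrightarrow> x \<in> - L"
      proof
        assume "\<exists>t :: bit list. length t = m \<and> pair_string x (map (\<lambda>b. b = 1) t) \<in> V"
        then obtain t :: "bit list" where "length t = m" "pair_string x (map (\<lambda>b. b = 1) t) \<in> V" by blast
        then show "x \<in> - L" unfolding L m_def[symmetric] by (intro exI[of _ "map (\<lambda>b. b = 1) t"]) simp
      next
        assume "x \<in> - L"
        then obtain t :: "bool list" where t: "length t = m" "pair_string x t \<in> V" unfolding L m_def[symmetric] by blast
        have "map (\<lambda>b. b = 1) (map of_bool t :: bit list) = t" by (simp add: o_def)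
        with t show "\<exists>t :: bit list. length t = m \<and> pair_string x (map (\<lambda>b. b = 1) t) \<in> V"
          by (intro exI[of _ "map of_bool t"]) (simp only: length_map)
      qed
      then show ?thesis by blast
    qed
    finally show ?thesis using C(1,2,3) n0_def by auto
  qed
  then obtain Cf where Cf: "\<And>x. wf_circuit (Cf x)"
    "\<And>x. sem red (input_store x) out = map bit_symbol (encode_circuit (Cf x))"
    "\<And>x. affine (num_inputs (Cf x)) (circuit_fun (Cf x)) \<longleftrightarrow> x \<in> L" by metis
  have "polytime_computable (\<lambda>x. encode_circuit (Cf x))"
  proof (rule polytime_computableI[OF wf _ _ pt])
    show "sem red (input_store x) (Suc out - 1) = map bit_symbol (encode_circuit (Cf x))" for x
      using Cf(2) by simp
    show "Suc out - 1 \<in> regs red" by (simp add: red_def prepare_def)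
  qed simp_all
  \<comment> \<open>Injectivity of the encoding excludes that the string is in \<open>AFFINE\<close>
    on account of another circuit.\<close>
  moreover have "x \<in> L \<longleftrightarrow> encode_circuit (Cf x) \<in> AFFINE" for x
    using Cf(1,3)[of x] inj_encode_circuit by (auto simp: AFFINE_def dest: injD)
  ultimately show ?thesis unfolding polytime_reducible_def by blast
qed

theorem theorem3: "coNP_complete AFFINE"
  unfolding coNP_complete_def using AFFINE_in_coNP AFFINE_coNP_hard by blast

end
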